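(* Let $V$ be an oriented eight-dimensional real vector space, let $\mathrm{Met}(V)$ be the cone of Euclidean metrics on $V$, and let $$W:\mathrm{Met}(V)\times\wedge^4V^*\to\mathbb{R},\qquad W(h,\Phi)=\frac{\sqrt{14}}{3}\langle\Phi\,\Delta_2^h\,\Phi,\Phi\rangle_h+4\langle\Phi,\Phi\rangle_h^{3/2}.$$ A pair $(h,\Phi)\in\mathrm{Met}(V)\times\wedge^4V^*$ is a conformal $\mathrm{Spin}(7)$ structure on $V$ (that is, a conformal $\mathrm{Spin}(7)_+$ pair) if and only if it is a self-dual critical point of the function $W$.
   Context: A metric $h$ induces on $\wedge V^*$ (whose elements are called polyforms) the determinant scalar product $\langle\cdot,\cdot\rangle_h$, for which the $e^{i_1}\wedge\cdots\wedge e^{i_k}$ ($i_1<\dots<i_k$) are orthonormal whenever $(e^1,\dots,e^8)$ is an $h$-orthonormal basis of $V^*$. A pair $(h,\Phi)$ is self-dual if $*_h\Phi=\Phi$, where $*_h$ is the Hodge operator of $h$ and the given orientation. A critical point of $W$ is a pair $(h,\Phi)$ at which the differential $\mathrm{d}_{(h,\Phi)}W:(V^*\odot V^* )\oplus\wedge^4V^*\to\mathbb{R}$ vanishes, where $V^*\odot V^*$ is the space of symmetric bilinear forms on $V$. For polyforms $\alpha,\beta$, $$\alpha\,\Delta_2^h\,\beta=\tfrac12 h^{a_1b_1}h^{a_2b_2}(\iota_{e_{a_1}}\iota_{e_{a_2}}\alpha)\wedge(\iota_{e_{b_1}}\iota_{e_{b_2}}\beta)$$ for any basis $(e_a)$ of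 $V$ with dual basis $(e^a)$ (summation implied, $h^{ab}=h^*(e^a,e^b)$). On $\mathbb{R}^8$ with its standard metric $h_0$ and orientation, write $e^{ijkl}=e^i\wedge e^j\wedge e^k\wedge e^l$ and set $$\Phi_0=e^{1234}+e^{1256}+e^{1278}+e^{1357}-e^{1368}-e^{1458}-e^{1467}+e^{5678}+e^{3478}+e^{3456}+e^{2468}-e^{2457}-e^{2358}-e^{2367}.$$ A $\mathrm{Spin}(7)_+$ form on $V$ is a four-form $\Phi=f^*\Phi_0$ with $f:V\to\mathbb{R}^8$ an orientation-preserving linear isomorphism; it induces the Euclidean metric $h_\Phi=f^*h_0$ (independent of the choice of $f$). A pair $(h,\Phi)$ is a conformal $\mathrm{Spin}(7)_+$ pair if $\Phi$ is a $\mathrm{Spin}(7)_+$ form on $V$ with $h_\Phi=c\,h$ for some $c>0$.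
   Formalization: The model form Φ_0 is replaced by −Φ_0, since with the printed sign Φ_0 Δ_2 Φ_0 = 12Φ_0 and (h_0,Φ_0) is not a critical point of W; and the self-dual critical point is required to have Φ ≠ 0, since (h,0) is always one. *)

theory Defs
  imports "HOL-Analysis.Analysis"
begin

section \<open>Ordered bases and orientations\<close>

text \<open>
  Ordered bases of an eight-dimensional real vector space are indexed by the type \<open>8\<close>, so that
  Einstein sums are sums over this type. Its elements are written \<open>1, \<dots>, 8\<close>; recall that the
  numeral \<open>8\<close> denotes the same element as \<open>0\<close>, which only matters where an order of the
  basis vectors is needed (see \<open>frame\<close> below).
\<close>

definition is_basis :: "(8 \<Rightarrow> 'v::real_vector) \<Rightarrow> bool" where
  "is_basis e \<longleftrightarrow> inj e \<and> independent (range e) \<and> span (range e) = UNIV"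

definition same_orientation :: "(8 \<Rightarrow> 'v::real_vector) \<Rightarrow> (8 \<Rightarrow> 'v) \<Rightarrow> bool" where
  "same_orientation e e' \<longleftrightarrow>
     (\<exists>M :: real^8^8. (\<forall>j. e' j = (\<Sum>i\<in>UNIV. (M $ i $ j) *\<^sub>R e i)) \<and> det M > 0)"

text \<open>An orientation is an equivalence class of ordered bases (the positive ones).\<close>

definition orientation :: "(8 \<Rightarrow> 'v::real_vector) set \<Rightarrow> bool" where
  "orientation Or \<longleftrightarrow> (\<exists>e. is_basis e \<and> Or = {e'. is_basis e' \<and> same_orientation e e'})"

definition std_orientation :: "(8 \<Rightarrow> real^8) set" where
  "std_orientation = {e. is_basis e \<and> same_orientation (\<lambda>i. axis i 1) e}"

definition frame :: "(8 \<Rightarrow> 'v) \<Rightarrow> 'v list" where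
  "frame e = map e [1, 2, 3, 4, 5, 6, 7, 8]"


section \<open>Polyforms\<close>

text \<open>
  A polyform is a function on finite lists of vectors: its restriction to lists of length \<open>k\<close>
  is its component of degree \<open>k\<close>, an alternating \<open>k\<close>-linear form.
\<close>

definition polyform :: "('v::real_vector list \<Rightarrow> real) \<Rightarrow> bool" where
  "polyform \<alpha> \<longleftrightarrow> (\<forall>us ws. linear (\<lambda>v. \<alpha> (us @ v # ws))) \<and> (\<forall>vs. \<not> distinct vs \<longrightarrow> \<alpha> vs = 0)"

definition forms :: "nat \<Rightarrow> ('v::real_vector list \<Rightarrow> real) set" where
  "forms k = {\<alpha>. polyform \<alpha> \<and> (\<forall>vs. length vs \<noteq> k \<longrightarrow> \<alpha> vs = 0)}"

text \<open>
  The wedge product as a sum over shuffles, normalised such that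
  \<open>(\<lambda> \<and> \<mu>) [v, w] = \<lambda> v * \<mu> w - \<lambda> w * \<mu> v\<close> for covectors; \<open>I\<close> is the set of positions of the
  arguments that are fed to the first factor.
\<close>

definition shuffle_sign :: "nat \<Rightarrow> nat set \<Rightarrow> real" where
  "shuffle_sign n I = (-1) ^ card {(i, j). i \<in> I \<and> j \<in> {..<n} - I \<and> j < i}"

definition wedge :: "('v list \<Rightarrow> real) \<Rightarrow> ('v list \<Rightarrow> real) \<Rightarrow> 'v list \<Rightarrow> real"  (infixr "\<and>\<^sub>w" 70) where
  "(\<alpha> \<and>\<^sub>w \<beta>) vs =
     (\<Sum>I \<in> Pow {..<length vs}.
        shuffle_sign (length vs) I * \<alpha> (nths vs I) * \<beta> (nths vs ({..<length vs} - I)))"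

definition interior :: "'v \<Rightarrow> ('v list \<Rightarrow> real) \<Rightarrow> 'v list \<Rightarrow> real" where
  "interior v \<alpha> = (\<lambda>vs. \<alpha> (v # vs))"

definition pullback :: "('v \<Rightarrow> 'w) \<Rightarrow> ('w list \<Rightarrow> real) \<Rightarrow> 'v list \<Rightarrow> real" where
  "pullback f \<alpha> = (\<lambda>vs. \<alpha> (map f vs))"


section \<open>Euclidean metrics and the structures they induce\<close>

definition Met :: "('v::real_vector \<Rightarrow> 'v \<Rightarrow> real) set" where
  "Met = {h. bilinear h \<and> (\<forall>v w. h v w = h w v) \<and> (\<forall>v. v \<noteq> 0 \<longrightarrow> h v v > 0)}"

definition orthonormal_basis :: "('v::real_vector \<Rightarrow> 'v \<Rightarrow> real) \<Rightarrow> (8 \<Rightarrow> 'v) \<Rightarrow> bool" where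
  "orthonormal_basis h e \<longleftrightarrow> is_basis e \<and> (\<forall>i j. h (e i) (e j) = (if i = j then 1 else 0))"

text \<open>
  The determinant scalar product. If \<open>(e\<^sub>i)\<close> is an \<open>h\<close>-orthonormal basis, then its dual basis
  \<open>(e\<^sup>i)\<close> is orthonormal and \<open>\<alpha> (e\<^sub>i\<^sub>1, \<dots>, e\<^sub>i\<^sub>k)\<close>, \<open>i\<^sub>1 < \<dots> < i\<^sub>k\<close>, is the coefficient of
  \<open>e\<^sup>i\<^sup>1 \<and> \<dots> \<and> e\<^sup>i\<^sup>k\<close> in \<open>\<alpha>\<close>. The value does not depend on the orthonormal basis.
\<close>

definition form_inner ::
  "('v::real_vector \<Rightarrow> 'v \<Rightarrow> real) \<Rightarrow> ('v list \<Rightarrow> real) \<Rightarrow> ('v list \<Rightarrow> real) \<Rightarrow> real" where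
  "form_inner h \<alpha> \<beta> =
     (let e = (SOME e. orthonormal_basis h e)
      in \<Sum>I \<in> Pow {..<8}. \<alpha> (nths (frame e) I) * \<beta> (nths (frame e) I))"

definition volume_form ::
  "(8 \<Rightarrow> 'v::real_vector) set \<Rightarrow> ('v \<Rightarrow> 'v \<Rightarrow> real) \<Rightarrow> 'v list \<Rightarrow> real" where
  "volume_form Or h =
     (THE \<nu>. \<nu> \<in> forms 8 \<and> (\<forall>e\<in>Or. orthonormal_basis h e \<longrightarrow> \<nu> (frame e) = 1))"

definition hodge ::
  "(8 \<Rightarrow> 'v::real_vector) set \<Rightarrow> ('v \<Rightarrow> 'v \<Rightarrow> real) \<Rightarrow> nat \<Rightarrow> ('v list \<Rightarrow> real) \<Rightarrow> 'v list \<Rightarrow> real" where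
  "hodge Or h k \<beta> =
     (THE \<gamma>. \<gamma> \<in> forms (8 - k) \<and>
        (\<forall>\<alpha>\<in>forms k. \<alpha> \<and>\<^sub>w \<gamma> = (\<lambda>vs. form_inner h \<alpha> \<beta> * volume_form Or h vs)))"

definition self_dual ::
  "(8 \<Rightarrow> 'v::real_vector) set \<Rightarrow> ('v \<Rightarrow> 'v \<Rightarrow> real) \<Rightarrow> ('v list \<Rightarrow> real) \<Rightarrow> bool" where
  "self_dual Or h \<Phi> \<longleftrightarrow> hodge Or h 4 \<Phi> = \<Phi>"

definition sharp :: "('v::real_vector \<Rightarrow> 'v \<Rightarrow> real) \<Rightarrow> ('v \<Rightarrow> real) \<Rightarrow> 'v" where
  "sharp h \<xi> = (THE v. \<forall>w. h v w = \<xi> w)"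

definition dual_metric ::
  "('v::real_vector \<Rightarrow> 'v \<Rightarrow> real) \<Rightarrow> ('v \<Rightarrow> real) \<Rightarrow> ('v \<Rightarrow> real) \<Rightarrow> real" where
  "dual_metric h \<xi> \<eta> = h (sharp h \<xi>) (sharp h \<eta>)"

definition dual_basis :: "(8 \<Rightarrow> 'v::real_vector) \<Rightarrow> 8 \<Rightarrow> 'v \<Rightarrow> real" where
  "dual_basis e a = (\<lambda>v. representation (range e) v (e a))"

text \<open>The product \<open>\<alpha> \<Delta>\<^sub>2 \<beta>\<close>; it does not depend on the basis.\<close>

definition Delta2 ::
  "('v::real_vector \<Rightarrow> 'v \<Rightarrow> real) \<Rightarrow> ('v list \<Rightarrow> real) \<Rightarrow> ('v list \<Rightarrow> real) \<Rightarrow> 'v list \<Rightarrow> real" where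
  "Delta2 h \<alpha> \<beta> =
     (let e = (SOME e. is_basis e);
          hh = (\<lambda>a b. dual_metric h (dual_basis e a) (dual_basis e b))
      in (\<lambda>vs. 1/2 * (\<Sum>a1\<in>UNIV. \<Sum>a2\<in>UNIV. \<Sum>b1\<in>UNIV. \<Sum>b2\<in>UNIV.
            hh a1 b1 * hh a2 b2 *
            (interior (e a1) (interior (e a2) \<alpha>) \<and>\<^sub>w interior (e b1) (interior (e b2) \<beta>)) vs)))"


section \<open>The potential and its critical points\<close>

definition W :: "('v::real_vector \<Rightarrow> 'v \<Rightarrow> real) \<times> ('v list \<Rightarrow> real) \<Rightarrow> real" where
  "W = (\<lambda>(h, \<Phi>). sqrt 14 / 3 * form_inner h (Delta2 h \<Phi> \<Phi>) \<Phi>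
                  + 4 * form_inner h \<Phi> \<Phi> powr (3/2))"

text \<open>
  The components of a bilinear form and of a four-form with respect to a basis. On symmetric
  bilinear forms and four-forms this is an injective linear map into a Euclidean space.
\<close>

definition components ::
  "(8 \<Rightarrow> 'v::real_vector) \<Rightarrow> ('v \<Rightarrow> 'v \<Rightarrow> real) \<times> ('v list \<Rightarrow> real)
     \<Rightarrow> (real^8^8) \<times> (real^8^8^8^8)" where
  "components e = (\<lambda>(h, \<Phi>). (\<chi> i j. h (e i) (e j), \<chi> i j k l. \<Phi> [e i, e j, e k, e l]))"

text \<open>
  The Frechet differential of \<open>F : Met(V) \<times> \<Lambda>\<^sup>4V\<^sup>* \<rightarrow> \<real>\<close> at \<open>p\<close> exists and vanishes. As usual
  for functions on open subsets of finite-dimensional vector spaces, this is expressed in linear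
  coordinates. The domain is open in \<open>(V\<^sup>* \<odot> V\<^sup>*) \<oplus> \<Lambda>\<^sup>4V\<^sup>*\<close>, so its image under
  \<open>components e\<close> is open in the linear subspace of symmetric and alternating arrays; the derivative
  within the image therefore only sees symmetric and alternating variations, and is determined on
  that subspace.
\<close>

definition critical_point ::
  "(('v::real_vector \<Rightarrow> 'v \<Rightarrow> real) \<times> ('v list \<Rightarrow> real) \<Rightarrow> real)
     \<Rightarrow> ('v \<Rightarrow> 'v \<Rightarrow> real) \<times> ('v list \<Rightarrow> real) \<Rightarrow> bool" where
  "critical_point F p \<longleftrightarrow>
     (\<forall>e. is_basis e \<longrightarrow>
        ((F \<circ> inv_into (Met \<times> forms 4) (components e)) has_derivative (\<lambda>_. 0))
          (at (components e p) within components e ` (Met \<times> forms 4)))"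


section \<open>Conformal \<open>Spin(7)\<^sub>+\<close> pairs\<close>

definition coord_form :: "8 \<Rightarrow> (real^8) list \<Rightarrow> real" where
  "coord_form i = (\<lambda>vs. case vs of [v] \<Rightarrow> v $ i | _ \<Rightarrow> 0)"

definition e4 :: "8 \<Rightarrow> 8 \<Rightarrow> 8 \<Rightarrow> 8 \<Rightarrow> (real^8) list \<Rightarrow> real" where
  "e4 i j k l = coord_form i \<and>\<^sub>w coord_form j \<and>\<^sub>w coord_form k \<and>\<^sub>w coord_form l"

definition Phi0 :: "(real^8) list \<Rightarrow> real" where
  "Phi0 vs = e4 1 2 3 4 vs + e4 1 2 5 6 vs + e4 1 2 7 8 vs + e4 1 3 5 7 vs - e4 1 3 6 8 vs
           - e4 1 4 5 8 vs - e4 1 4 6 7 vs + e4 5 6 7 8 vs + e4 3 4 7 8 vs + e4 3 4 5 6 vs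
           + e4 2 4 6 8 vs - e4 2 4 5 7 vs - e4 2 3 5 8 vs - e4 2 3 6 7 vs"

text \<open>
  Two opposite sign conventions for the model \<open>Spin(7)\<close> form are in use; both \<open>Phi0\<close> and
  \<open>-Phi0\<close> are self-dual with stabiliser \<open>Spin(7)\<close>, but they lie in different orbits. The
  relevant one for the potential \<open>W\<close> is \<open>-Phi0\<close>: for the standard metric,
  \<open>Phi0 \<Delta>\<^sub>2 Phi0 = 12 Phi0\<close> and \<open>|Phi0|\<^sup>2 = 14\<close>, whence \<open>W\<close>, which is positively homogeneous
  of degree three in the form, equals \<open>112 sqrt 14\<close> at \<open>Phi0\<close>, and \<open>Phi0\<close> is not critical,
  whereas \<open>-Phi0\<close> is.
\<close>

definition model_form :: "(real^8) list \<Rightarrow> real" where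
  "model_form vs = - Phi0 vs"

definition oriented_iso :: "(8 \<Rightarrow> 'v::real_vector) set \<Rightarrow> ('v \<Rightarrow> real^8) \<Rightarrow> bool" where
  "oriented_iso Or f \<longleftrightarrow> linear f \<and> bij f \<and> (\<forall>e\<in>Or. f \<circ> e \<in> std_orientation)"

text \<open>
  \<open>\<Phi>\<close> is a \<open>Spin(7)\<^sub>+\<close> form and \<open>g\<close> is the metric \<open>h\<^sub>\<Phi>\<close> it induces; by the independence of \<open>h\<^sub>\<Phi>\<close>
  of the choice of \<open>f\<close>, there is exactly one such \<open>g\<close> for every \<open>Spin(7)\<^sub>+\<close> form.
\<close>

definition spin7_form_inducing ::
  "(8 \<Rightarrow> 'v::real_vector) set \<Rightarrow> ('v list \<Rightarrow> real) \<Rightarrow> ('v \<Rightarrow> 'v \<Rightarrow> real) \<Rightarrow> bool" where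
  "spin7_form_inducing Or \<Phi> g \<longleftrightarrow>
     (\<exists>f. oriented_iso Or f \<and> \<Phi> = pullback f model_form \<and> g = (\<lambda>v w. f v \<bullet> f w))"

definition conformal_spin7_pair ::
  "(8 \<Rightarrow> 'v::real_vector) set \<Rightarrow> ('v \<Rightarrow> 'v \<Rightarrow> real) \<Rightarrow> ('v list \<Rightarrow> real) \<Rightarrow> bool" where
  "conformal_spin7_pair Or h \<Phi> \<longleftrightarrow>
     (\<exists>g c. spin7_form_inducing Or \<Phi> g \<and> c > 0 \<and> g = (\<lambda>v w. c * h v w))"

end

theory Submission
  imports Defs
begin

text \<open>
  Why the theorem holds. The potential is invariant under linear automorphisms of \<open>V\<close>, since it
  is built from the metric and the form alone. Moving the metric in a direction \<open>k\<close> is therefore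
  the same, up to first order, as moving the form by an infinitesimal pullback, and the metric part of
  the differential vanishes as soon as the form part does (lemma \<open>critical_pointI\<close>). In an
  \<open>h\<close>-orthonormal basis a four-form becomes a symmetric matrix \<open>A\<close> indexed by pairs of indices, for
  which \<open>\<langle>\<Phi>, \<Phi>\<rangle>\<close> and \<open>\<langle>\<Phi> \<Delta>\<^sub>2 \<Phi>, \<Phi>\<rangle>\<close> are multiples of the traces of \<open>A\<^sup>2\<close> and \<open>A\<^sup>3\<close>. The
  form part of the differential is read off from this, and \<open>(h, \<Phi>)\<close> with \<open>\<Phi> \<noteq> 0\<close> is critical if
  and only if \<open>\<Phi> \<Delta>\<^sub>2 \<Phi> = - 12 \<kappa> \<Phi>\<close>, where \<open>14 \<kappa>\<^sup>2 = \<langle>\<Phi>, \<Phi>\<rangle>\<close> and \<open>\<kappa> > 0\<close>.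

  It remains to solve this quadratic equation for self-dual forms, and here spinors enter. The model
  form defines the octonion product on \<open>\<real>\<^sup>8\<close>, the octonion product defines a Clifford multiplication,
  and self-dual four-forms act on the eight-dimensional space of spinors by symmetric matrices of trace
  zero. The Clifford square of \<open>\<Phi>\<close> consists of a scalar, which is determined by the norm, and of a
  four-form, which is \<open>\<Phi> \<Delta>\<^sub>2 \<Phi>\<close> up to sign; the parts of degree two and six cancel. So the quadratic
  equation says that the matrix \<open>Q\<close> of \<open>\<Phi>\<close> (normalised as in \<open>spinor_matrix\<close>) satisfies
  \<open>Q\<^sup>2 = 6 \<kappa> Q + 7 \<kappa>\<^sup>2\<close> (lemma \<open>spinor_matrix_square\<close>). Its eigenvalues are \<open>7 \<kappa>\<close> and \<open>- \<kappa>\<close>, and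
  trace zero forces the first one to be simple. Hence \<open>(Q + \<kappa>) / (8 \<kappa>)\<close> is the projection onto the
  line of a unit spinor \<open>s\<close>, and \<open>\<Phi>\<close> is \<open>\<kappa>\<close> times the four-form of \<open>s\<close> (lemma \<open>ex_spinor\<close>). The
  product of two half turns carries the model form, which is the four-form of the spinor \<open>e\<^sub>1\<close>, to
  that of \<open>s\<close> (lemma \<open>spinor_form_rotation\<close>), so that \<open>\<Phi>\<close> belongs to a conformal pair.

  Conversely, the components of \<open>\<Phi>\<close> in a conformal pair are \<open>\<kappa>\<close> times those of the model form in a
  suitable oriented orthonormal basis, and self-duality and the quadratic equation are checked
  component by component.
\<close>

section \<open>Alternating forms\<close>

lemma polyformI:
  assumes "\<And>us ws. linear (\<lambda>v. \<alpha> (us @ v # ws))" "\<And>vs. \<not> distinct vs \<Longrightarrow> \<alpha> vs = 0"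
  shows "polyform \<alpha>"
  using assms unfolding polyform_def by blast

lemma polyform_linear: "polyform \<alpha> \<Longrightarrow> linear (\<lambda>v. \<alpha> (us @ v # ws))"
  unfolding polyform_def by blast

lemma polyform_repeat: "polyform \<alpha> \<Longrightarrow> \<not> distinct vs \<Longrightarrow> \<alpha> vs = 0"
  unfolding polyform_def by blast

lemma polyform_add: "polyform \<alpha> \<Longrightarrow> \<alpha> (us @ (v + w) # ws) = \<alpha> (us @ v # ws) + \<alpha> (us @ w # ws)"
  using linear_add[OF polyform_linear] .

lemma polyform_sum:
  "polyform \<alpha> \<Longrightarrow> \<alpha> (us @ (\<Sum>i\<in>A. c i *\<^sub>R f i) # ws) = (\<Sum>i\<in>A. c i * \<alpha> (us @ f i # ws))"
  by (simp add: linear_sum[OF polyform_linear] linear_scale[OF polyform_linear])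

lemma polyform_interior: "polyform \<alpha> \<Longrightarrow> polyform (interior v \<alpha>)"
  using polyform_linear[of \<alpha> "v # _"] polyform_repeat[of \<alpha>]
  by (intro polyformI) (auto simp: interior_def)

lemma polyform_lincomb:
  fixes f :: "'i \<Rightarrow> 'v::real_vector list \<Rightarrow> real"
  assumes "\<And>i. i \<in> A \<Longrightarrow> polyform (f i)"
  shows "polyform (\<lambda>vs. \<Sum>i\<in>A. c i * f i vs)"
proof (rule polyformI)
  fix us ws :: "'v list"
  show "linear (\<lambda>v. \<Sum>i\<in>A. c i * f i (us @ v # ws))"
    using assms linear_compose_scale_right[OF polyform_linear] by (intro linear_compose_sum) force
next
  fix vs :: "'v list"
  assume "\<not> distinct vs"
  then show "(\<Sum>i\<in>A. c i * f i vs) = 0"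
    using assms by (intro sum.neutral) (simp add: polyform_repeat)
qed

lemma polyform_swap:
  assumes "polyform \<alpha>"
  shows "\<alpha> (us @ x # y # ws) = - \<alpha> (us @ y # x # ws)"
proof -
  have "0 = \<alpha> (us @ (x + y) # (x + y) # ws)"
    using polyform_repeat[OF assms] by auto
  also have "\<dots> = \<alpha> (us @ x # (x + y) # ws) + \<alpha> (us @ y # (x + y) # ws)"
    by (rule polyform_add[OF assms])
  also have "\<dots> = \<alpha> (us @ x # x # ws) + \<alpha> (us @ x # y # ws) + \<alpha> (us @ y # x # ws) + \<alpha> (us @ y # y # ws)"
    using polyform_add[OF assms, of "us @ [x]"] polyform_add[OF assms, of "us @ [y]"] by simp
  finally show ?thesis
    using polyform_repeat[OF assms, of "us @ x # x # ws"] polyform_repeat[OF assms, of "us @ y # y # ws"]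
    by simp
qed

lemma abs_polyform_move:
  assumes "polyform \<alpha>"
  shows "\<bar>\<alpha> (us @ ws @ x # zs)\<bar> = \<bar>\<alpha> (us @ x # ws @ zs)\<bar>"
proof (induction ws arbitrary: us)
  case (Cons w ws)
  show ?case
    using Cons[of "us @ [w]"] polyform_swap[OF assms, of us w x "ws @ zs"] by simp
qed simp

text \<open>
  The absolute value spares the sign of the permutation; it suffices for deciding whether a form vanishes.
\<close>

lemma abs_polyform_permute:
  assumes "polyform \<alpha>" and "mset xs = mset ys"
  shows "\<bar>\<alpha> (us @ xs)\<bar> = \<bar>\<alpha> (us @ ys)\<bar>"
  using assms(2)
proof (induction xs arbitrary: us ys)
  case (Cons x xs)
  then have "x \<in> set ys" by (metis list.set_intros(1) mset_eq_setD)
  then obtain a b where ys: "ys = a @ x # b" by (meson split_list)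
  with Cons.prems have "mset xs = mset (a @ b)" by simp
  from Cons.IH[OF this, of "us @ [x]"] show ?case
    by (simp add: ys abs_polyform_move[OF assms(1)])
qed simp

text \<open>
  The arguments are expanded in the basis one after the other, from the left.
\<close>

lemma polyform_eq_zero_on_basis:
  assumes "polyform \<alpha>" and "is_basis e" and "\<And>is. length is = n \<Longrightarrow> \<alpha> (map e is) = 0"
    and "length vs = n"
  shows "\<alpha> vs = 0"
proof -
  have "\<alpha> (map e is @ ws) = 0" if "length is + length ws = n" for "is" ws
    using that
  proof (induction ws arbitrary: "is")
    case Nil
    then show ?case using assms(3) by simp
  next
    case (Cons w ws)
    have "w \<in> span (range e)" using assms(2) by (simp add: is_basis_def)
    then obtain c where w: "w = (\<Sum>v\<in>range e. c v *\<^sub>R v)"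
      by (auto simp: span_finite)
    have "\<alpha> (map e is @ w # ws) = (\<Sum>v\<in>range e. c v * \<alpha> (map e is @ v # ws))"
      unfolding w by (rule polyform_sum[OF assms(1)])
    also have "\<dots> = 0"
    proof (rule sum.neutral, safe)
      fix i
      show "c (e i) * \<alpha> (map e is @ e i # ws) = 0"
        using Cons.IH[of "is @ [i]"] Cons.prems by simp
    qed
    finally show ?case .
  qed
  from this[of "[]" vs] assms(4) show ?thesis by simp
qed

lemma polyform_high_degree:
  assumes "polyform (\<alpha> :: 'v::real_vector list \<Rightarrow> real)" and "is_basis (e :: 8 \<Rightarrow> 'v)" and "length vs > 8"
  shows "\<alpha> vs = 0"
proof (rule polyform_eq_zero_on_basis[OF assms(1,2) _ refl])
  fix "is" :: "8 list"
  assume "length is = length vs"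
  moreover have "card (set is) \<le> 8"
    using card_mono[of "UNIV :: 8 set" "set is"] by simp
  ultimately have "\<not> distinct is" using assms(3) by (metis distinct_card not_le)
  then have "\<not> distinct (map e is)" by (simp add: distinct_map)
  then show "\<alpha> (map e is) = 0" by (rule polyform_repeat[OF assms(1)])
qed

lemma UNIV_8: "(UNIV :: 8 set) = {1, 2, 3, 4, 5, 6, 7, 8}"
proof -
  have "distinct [1, 2, 3, 4, 5, 6, 7, 8 :: 8]" by simp
  then have "card (set [1, 2, 3, 4, 5, 6, 7, 8 :: 8]) = 8" by (subst distinct_card) simp_all
  then have "set [1, 2, 3, 4, 5, 6, 7, 8 :: 8] = UNIV" by (intro card_subset_eq) auto
  then show ?thesis by auto
qed

lemma sum_8: "(\<Sum>i\<in>(UNIV :: 8 set). f i) = f 1 + f 2 + f 3 + f 4 + f 5 + f 6 + f 7 + f 8"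
  unfolding UNIV_8 by (simp add: algebra_simps)

lemma forall_8: "(\<forall>i::8. P i) \<longleftrightarrow> P 1 \<and> P 2 \<and> P 3 \<and> P 4 \<and> P 5 \<and> P 6 \<and> P 7 \<and> P 8"
  using UNIV_8 by (metis UNIV_I insertE singletonD)

lemma top_form_eq_zero:
  assumes "\<nu> \<in> forms 8" and "is_basis (e :: 8 \<Rightarrow> 'v::real_vector)" and "\<nu> (frame e) = 0"
  shows "\<nu> vs = 0"
proof (cases "length vs = 8")
  case True
  have \<nu>: "polyform \<nu>" using assms(1) by (simp add: forms_def)
  show ?thesis
  proof (rule polyform_eq_zero_on_basis[OF \<nu> assms(2) _ True])
    fix "is" :: "8 list"
    assume len: "length is = 8"
    show "\<nu> (map e is) = 0"
    proof (cases "distinct is")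
      case True
      then have "card (set is) = card (UNIV :: 8 set)" using len by (simp add: distinct_card)
      then have "set is = UNIV" by (intro card_subset_eq) auto
      then have "set is = set [1, 2, 3, 4, 5, 6, 7, 8]" unfolding UNIV_8 by simp
      moreover have "distinct [1, 2, 3, 4, 5, 6, 7, 8 :: 8]" by simp
      ultimately have "mset is = mset [1, 2, 3, 4, 5, 6, 7, 8]"
        using True by (simp only: set_eq_iff_mset_eq_distinct)
      then have "mset (map e is) = mset (frame e)" unfolding frame_def by (metis mset_map)
      from abs_polyform_permute[OF \<nu> this, of "[]"] assms(3) show ?thesis by simp
    next
      case False
      then show ?thesis by (intro polyform_repeat[OF \<nu>]) (simp add: distinct_map)
    qed
  qed
next
  case False
  then show ?thesis using assms(1) by (simp add: forms_def)
qed

section \<open>The wedge product\<close>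

text \<open>
  Together with the next lemma, this describes how the sign of a shuffle changes when a new first
  argument is given to the second or to the first factor: in the former case it has to jump over all
  arguments of the first factor.
\<close>

lemma shuffle_sign_Suc_image:
  assumes "J \<subseteq> {..<n}"
  shows "shuffle_sign (Suc n) (Suc ` J) = (-1) ^ card J * shuffle_sign n J"
proof -
  let ?P = "{(i, j). i \<in> J \<and> j \<in> {..<n} - J \<and> j < i}"
  have fin: "finite J" using assms finite_subset by blast
  have finP: "finite ?P"
    by (rule finite_subset[of _ "J \<times> {..<n}"]) (use fin in auto)
  have "{(i, j). i \<in> Suc ` J \<and> j \<in> {..<Suc n} - Suc ` J \<and> j < i}
      = (\<lambda>i. (Suc i, 0)) ` J \<union> map_prod Suc Suc ` ?P" (is "?L = ?A \<union> ?B")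
  proof (intro set_eqI iffI)
    fix p assume "p \<in> ?L"
    then obtain i j where p: "p = (Suc i, j)" "i \<in> J" "j < Suc n" "j \<notin> Suc ` J" "j < Suc i" by auto
    show "p \<in> ?A \<union> ?B"
    proof (cases j)
      case (Suc k)
      then have "(i, k) \<in> ?P" using p by auto
      then show ?thesis using p Suc by (force simp: image_iff)
    qed (use p in auto)
  qed auto
  moreover have "?A \<inter> ?B = {}" by auto
  moreover have "card ?A = card J" by (rule card_image) (simp add: inj_on_def)
  moreover have "card ?B = card ?P" by (rule card_image) (auto simp: inj_on_def)
  ultimately have "card {(i, j). i \<in> Suc ` J \<and> j \<in> {..<Suc n} - Suc ` J \<and> j < i} = card J + card ?P"
    using fin finP by (simp add: card_Un_disjoint)
  then show ?thesis unfolding shuffle_sign_def by (simp add: power_add)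
qed

lemma shuffle_sign_insert_0:
  assumes "J \<subseteq> {..<n}"
  shows "shuffle_sign (Suc n) (insert 0 (Suc ` J)) = shuffle_sign n J"
proof -
  let ?P = "{(i, j). i \<in> J \<and> j \<in> {..<n} - J \<and> j < i}"
  have "{(i, j). i \<in> insert 0 (Suc ` J) \<and> j \<in> {..<Suc n} - insert 0 (Suc ` J) \<and> j < i}
      = map_prod Suc Suc ` ?P" (is "?L = ?B")
  proof (intro set_eqI iffI)
    fix p assume "p \<in> ?L"
    then obtain i j where p: "p = (Suc i, j)" "i \<in> J" "j < Suc n" "j \<notin> Suc ` J" "j < Suc i" "j \<noteq> 0" by auto
    then obtain k where "j = Suc k" by (cases j) auto
    then have "(i, k) \<in> ?P" using p by auto
    then show "p \<in> ?B" using p \<open>j = Suc k\<close> by (force simp: image_iff)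
  qed auto
  moreover have "card ?B = card ?P" by (rule card_image) (auto simp: inj_on_def)
  ultimately show ?thesis unfolding shuffle_sign_def by simp
qed

text \<open>
  The grading automorphism \<open>\<alpha> \<mapsto> (-1)\<^sup>k \<alpha>\<close> on \<open>k\<close>-forms, written without reference to the degree.
\<close>

definition graded_sign :: "('v list \<Rightarrow> real) \<Rightarrow> 'v list \<Rightarrow> real" where
  "graded_sign \<alpha> = (\<lambda>vs. (-1) ^ length vs * \<alpha> vs)"

lemma sum_Pow_Suc:
  fixes g :: "nat set \<Rightarrow> real"
  shows "(\<Sum>I\<in>Pow {..<Suc n}. g I) = (\<Sum>J\<in>Pow {..<n}. g (insert 0 (Suc ` J))) + (\<Sum>J\<in>Pow {..<n}. g (Suc ` J))"
proof -
  have P: "Pow {..<Suc n} = image Suc ` Pow {..<n} \<union> (\<lambda>J. insert 0 (Suc ` J)) ` Pow {..<n}"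
    by (simp add: lessThan_Suc_eq_insert_0 Pow_insert image_Pow_surj[symmetric] image_image)
  have "(\<Sum>I\<in>Pow {..<Suc n}. g I)
      = (\<Sum>I\<in>image Suc ` Pow {..<n}. g I) + (\<Sum>I\<in>(\<lambda>J. insert 0 (Suc ` J)) ` Pow {..<n}. g I)"
    unfolding P by (rule sum.union_disjoint) auto
  also have "(\<Sum>I\<in>image Suc ` Pow {..<n}. g I) = (\<Sum>J\<in>Pow {..<n}. g (Suc ` J))"
    by (rule sum.reindex[unfolded comp_def]) (auto simp: inj_on_def inj_image_eq_iff)
  also have "(\<Sum>I\<in>(\<lambda>J. insert 0 (Suc ` J)) ` Pow {..<n}. g I) = (\<Sum>J\<in>Pow {..<n}. g (insert 0 (Suc ` J)))"
  proof (rule sum.reindex[unfolded comp_def], rule inj_onI)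
    fix A B assume "insert 0 (Suc ` A) = insert 0 (Suc ` B)"
    then have "Suc ` A = Suc ` B" by (simp add: insert_eq_iff)
    then show "A = B" by (simp add: inj_image_eq_iff)
  qed
  finally show ?thesis by simp
qed

lemma wedge_Nil: "(\<alpha> \<and>\<^sub>w \<beta>) [] = \<alpha> [] * \<beta> []"
  by (simp add: wedge_def shuffle_sign_def)

text \<open>
  Contraction is a graded derivation. Read as a recursion on the list of arguments, this replaces the sum
  over shuffles in the definition: all properties of the wedge product, and its explicit values on
  lists of given length, are derived from it.
\<close>

lemma wedge_Cons:
  "(\<alpha> \<and>\<^sub>w \<beta>) (v # vs) = (interior v \<alpha> \<and>\<^sub>w \<beta>) vs + (graded_sign \<alpha> \<and>\<^sub>w interior v \<beta>) vs"
proof -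
  define n where "n = length vs"
  define g where "g I = shuffle_sign (Suc n) I * \<alpha> (nths (v # vs) I) * \<beta> (nths (v # vs) ({..<Suc n} - I))" for I
  have "(\<alpha> \<and>\<^sub>w \<beta>) (v # vs) = (\<Sum>I\<in>Pow {..<Suc n}. g I)"
    unfolding wedge_def g_def n_def by simp
  also have "\<dots> = (\<Sum>J\<in>Pow {..<n}. g (insert 0 (Suc ` J))) + (\<Sum>J\<in>Pow {..<n}. g (Suc ` J))"
    by (rule sum_Pow_Suc)
  also have "(\<Sum>J\<in>Pow {..<n}. g (insert 0 (Suc ` J))) = (interior v \<alpha> \<and>\<^sub>w \<beta>) vs"
    unfolding wedge_def n_def[symmetric]
  proof (rule sum.cong[OF refl])
    fix J assume "J \<in> Pow {..<n}"
    then have J: "J \<subseteq> {..<n}" by simp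
    have "{j. Suc j \<in> {..<Suc n} - insert 0 (Suc ` J)} = {..<n} - J" by auto
    then show "g (insert 0 (Suc ` J)) = shuffle_sign n J * interior v \<alpha> (nths vs J) * \<beta> (nths vs ({..<n} - J))"
      unfolding g_def by (simp add: shuffle_sign_insert_0[OF J] nths_Cons interior_def image_iff)
  qed
  also have "(\<Sum>J\<in>Pow {..<n}. g (Suc ` J)) = (graded_sign \<alpha> \<and>\<^sub>w interior v \<beta>) vs"
    unfolding wedge_def n_def[symmetric]
  proof (rule sum.cong[OF refl])
    fix J assume "J \<in> Pow {..<n}"
    then have J: "J \<subseteq> {..<n}" by simp
    have "{j. Suc j \<in> {..<Suc n} - Suc ` J} = {..<n} - J" by auto
    moreover have "{i. i < length vs \<and> i \<in> J} = J" using J n_def by auto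
    ultimately show "g (Suc ` J) = shuffle_sign n J * graded_sign \<alpha> (nths vs J) * interior v \<beta> (nths vs ({..<n} - J))"
      unfolding g_def
      by (simp add: shuffle_sign_Suc_image[OF J] nths_Cons interior_def image_iff graded_sign_def length_nths)
  qed
  finally show ?thesis by simp
qed

lemma polyform_graded_sign: "polyform \<alpha> \<Longrightarrow> polyform (graded_sign \<alpha>)"
proof (rule polyformI)
  fix us ws :: "'a list"
  assume "polyform \<alpha>"
  from linear_compose_scale_right[OF polyform_linear[OF this, of us ws], of "(-1) ^ length (us @ undefined # ws)"]
  show "linear (\<lambda>v. graded_sign \<alpha> (us @ v # ws))" by (simp add: graded_sign_def)
qed (simp add: graded_sign_def polyform_repeat)

lemma wedge_minus_left: "((\<lambda>vs. - \<alpha> vs) \<and>\<^sub>w \<beta>) vs = - (\<alpha> \<and>\<^sub>w \<beta>) vs"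
  by (simp add: wedge_def sum_negf)

lemma linear_wedge_first:
  assumes "polyform \<alpha>" "polyform \<beta>"
  shows "linear (\<lambda>v. (interior v \<alpha> \<and>\<^sub>w \<beta>) vs)" "linear (\<lambda>v. (\<alpha> \<and>\<^sub>w interior v \<beta>) vs)"
  unfolding wedge_def interior_def
  using linear_add[OF polyform_linear[OF assms(1), of "[]"]] linear_scale[OF polyform_linear[OF assms(1), of "[]"]]
    linear_add[OF polyform_linear[OF assms(2), of "[]"]] linear_scale[OF polyform_linear[OF assms(2), of "[]"]]
  by (auto intro!: linear_compose_sum linearI simp: algebra_simps)

lemma linear_wedge:
  assumes "polyform \<alpha>" "polyform \<beta>"
  shows "linear (\<lambda>v. (\<alpha> \<and>\<^sub>w \<beta>) (us @ v # ws))"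
  using assms
proof (induction us arbitrary: \<alpha> \<beta>)
  case Nil
  then show ?case
    unfolding append_Nil wedge_Cons
    by (intro linear_compose_add linear_wedge_first polyform_graded_sign)
next
  case (Cons u us)
  then show ?case
    unfolding append_Cons wedge_Cons
    by (intro linear_compose_add Cons.IH polyform_graded_sign polyform_interior)
qed

text \<open>
  Two derivations with the same vector: the mixed terms cancel because contraction anticommutes with
  the grading automorphism.
\<close>

lemma wedge_twice:
  assumes "polyform \<alpha>" "polyform \<beta>"
  shows "(\<alpha> \<and>\<^sub>w \<beta>) (v # v # vs) = 0"
proof -
  have a: "interior v (interior v \<gamma>) = (\<lambda>_. 0)" if "polyform \<gamma>" for \<gamma> :: "'a list \<Rightarrow> real"
    using polyform_repeat[OF that] by (auto simp: interior_def)
  have b: "interior v (graded_sign \<alpha>) = (\<lambda>vs. - graded_sign (interior v \<alpha>) vs)"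
    by (auto simp: interior_def graded_sign_def)
  have z: "((\<lambda>_. 0) \<and>\<^sub>w \<gamma>) vs = 0" "(\<gamma> \<and>\<^sub>w (\<lambda>_. 0)) vs = 0" for \<gamma> :: "'a list \<Rightarrow> real"
    by (simp_all add: wedge_def)
  show ?thesis
    by (simp add: wedge_Cons a[OF assms(1)] a[OF assms(2)] b z wedge_minus_left)
qed

text \<open>
  Vanishing on lists with a repetition goes by induction on the length. A repetition that does not
  involve the first argument is covered by the recursion; one between the first and a later argument is
  moved away from the front by exchanging the first two arguments, which is possible by polarising
  \<open>wedge_twice\<close>.
\<close>

lemma polyform_wedge:
  assumes "polyform \<alpha>" "polyform \<beta>"
  shows "polyform (\<alpha> \<and>\<^sub>w \<beta>)"
proof -
  have "(\<alpha> \<and>\<^sub>w \<beta>) vs = 0" if "\<not> distinct vs" for vs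
    using that assms
  proof (induction "length vs" arbitrary: vs \<alpha> \<beta> rule: less_induct)
    case less
    obtain u w ws where vs: "vs = u # w # ws"
      using less.prems(1) by (metis distinct.simps(1) distinct_singleton list.exhaust)
    note tail = less.hyps[OF _ _ polyform_interior[OF less.prems(2)] less.prems(3)]
      less.hyps[OF _ _ polyform_graded_sign[OF less.prems(2)] polyform_interior[OF less.prems(3)]]
    consider "\<not> distinct (w # ws)" | "u = w" | "\<not> distinct (u # ws)"
      using less.prems(1) vs by auto
    then show ?case
    proof cases
      case 1
      then show ?thesis unfolding vs wedge_Cons[of _ _ u] using tail vs by simp
    next
      case 2
      then show ?thesis unfolding vs using wedge_twice less.prems by simp
    next
      case 3
      have sw: "(\<alpha> \<and>\<^sub>w \<beta>) (x # y # ws) + (\<alpha> \<and>\<^sub>w \<beta>) (y # x # ws) = 0" for x y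
      proof -
        note l = linear_wedge[OF less.prems(2,3)]
        have "0 = (\<alpha> \<and>\<^sub>w \<beta>) ((x + y) # (x + y) # ws)" using wedge_twice less.prems by simp
        also have "\<dots> = (\<alpha> \<and>\<^sub>w \<beta>) (x # (x + y) # ws) + (\<alpha> \<and>\<^sub>w \<beta>) (y # (x + y) # ws)"
          using linear_add[OF l[of "[]"]] by simp
        also have "\<dots> = (\<alpha> \<and>\<^sub>w \<beta>) (x # y # ws) + (\<alpha> \<and>\<^sub>w \<beta>) (y # x # ws)"
          using linear_add[OF l[of "[x]" ws]] linear_add[OF l[of "[y]" ws]] wedge_twice[OF less.prems(2,3)]
          by simp
        finally show ?thesis by simp
      qed
      have "(\<alpha> \<and>\<^sub>w \<beta>) (w # u # ws) = 0"
        unfolding wedge_Cons[of _ _ w] using tail 3 vs by simp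
      then show ?thesis using sw[of u w] vs by simp
    qed
  qed
  then show ?thesis using linear_wedge[OF assms] by (intro polyformI) auto
qed

lemma wedge_forms:
  assumes "\<alpha> \<in> forms k" "\<beta> \<in> forms l"
  shows "\<alpha> \<and>\<^sub>w \<beta> \<in> forms (k + l)"
proof -
  have "(\<alpha> \<and>\<^sub>w \<beta>) vs = 0" if "length vs \<noteq> k + l" for vs
    unfolding wedge_def
  proof (rule sum.neutral, rule ballI)
    fix I assume "I \<in> Pow {..<length vs}"
    then have I: "I \<subseteq> {..<length vs}" by simp
    have "{i. i < length vs \<and> i \<in> I} = I" "{i. i < length vs \<and> i \<in> {..<length vs} - I} = {..<length vs} - I"
      using I by auto
    then have "length (nths vs I) + length (nths vs ({..<length vs} - I)) = length vs"
      unfolding length_nths using I card_mono[OF _ I]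
      by (simp add: card_Diff_subset finite_subset)
    then have "length (nths vs I) \<noteq> k \<or> length (nths vs ({..<length vs} - I)) \<noteq> l" using that by auto
    then show "shuffle_sign (length vs) I * \<alpha> (nths vs I) * \<beta> (nths vs ({..<length vs} - I)) = 0"
      using assms by (auto simp: forms_def)
  qed
  then show ?thesis using assms polyform_wedge by (auto simp: forms_def)
qed

section \<open>Bases and orientations\<close>

lemma basis_coords:
  assumes "is_basis e"
  obtains c where "v = (\<Sum>i\<in>UNIV. c i *\<^sub>R e i)"
proof -
  have "v \<in> span (range e)" and inj: "inj e" using assms by (auto simp: is_basis_def)
  then obtain c where v: "v = (\<Sum>w\<in>range e. c w *\<^sub>R w)" by (auto simp: span_finite)
  show ?thesis
    by (rule that[of "c \<circ> e"]) (simp add: v sum.reindex[OF inj] comp_def)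
qed

lemma is_basisI:
  assumes "\<And>c. (\<Sum>i\<in>UNIV. c i *\<^sub>R e i) = 0 \<Longrightarrow> c = (\<lambda>_. 0)" and "\<And>v. \<exists>c. v = (\<Sum>i\<in>UNIV. c i *\<^sub>R e i)"
  shows "is_basis (e :: 8 \<Rightarrow> 'v::real_vector)"
proof -
  have inj: "inj e"
  proof (rule injI, rule ccontr)
    fix i j assume ij: "e i = e j" "i \<noteq> j"
    have "(\<Sum>k\<in>UNIV. (if k = i then 1 else if k = j then -1 else 0) *\<^sub>R e k)
        = (\<Sum>k\<in>UNIV. (if k = i then e k else 0) + (if k = j then - e k else 0))"
      using ij by (intro sum.cong) auto
    also have "\<dots> = 0" using ij by (simp add: sum.distrib)
    finally have "(\<lambda>k. if k = i then 1 else if k = j then -1 else 0 :: real) = (\<lambda>_. 0)"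
      by (rule assms(1))
    then show False by (metis zero_neq_one)
  qed
  have "independent (range e)"
    unfolding dependent_finite[OF finite_imageI[OF finite]]
  proof (intro notI, elim exE conjE bexE)
    fix c v assume nz: "c v \<noteq> 0" and "(\<Sum>v\<in>range e. c v *\<^sub>R v) = 0" and v: "v \<in> range e"
    then have "(\<Sum>i\<in>UNIV. (c \<circ> e) i *\<^sub>R e i) = 0" by (simp add: sum.reindex[OF inj])
    then have "c \<circ> e = (\<lambda>_. 0)" by (rule assms(1))
    moreover from v obtain i where "v = e i" by blast
    ultimately have "c v = 0" by (metis comp_apply)
    with nz show False by simp
  qed
  moreover have "span (range e) = UNIV"
  proof (rule UNIV_eq_I[symmetric])
    fix v
    obtain c where "v = (\<Sum>i\<in>UNIV. c i *\<^sub>R e i)" using assms(2) by blast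
    then show "v \<in> span (range e)" by (simp add: span_sum span_scale span_base)
  qed
  ultimately show ?thesis using inj by (simp add: is_basis_def)
qed

lemma basis_coords_unique:
  assumes "is_basis e" "(\<Sum>i\<in>UNIV. c i *\<^sub>R e i) = (\<Sum>i\<in>UNIV. d i *\<^sub>R e i)"
  shows "c i = d i"
proof -
  have inj: "inj e" and ind: "independent (range e)" using assms by (auto simp: is_basis_def)
  have "(\<Sum>v\<in>range e. (c (inv e v) - d (inv e v)) *\<^sub>R v) = 0"
    using assms(2) by (simp add: sum.reindex[OF inj] inj inv_f_f algebra_simps sum_subtractf)
  note zero = this
  have "\<forall>v\<in>range e. c (inv e v) - d (inv e v) = 0"
  proof (rule ccontr)
    assume "\<not> (\<forall>v\<in>range e. c (inv e v) - d (inv e v) = 0)"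
    then have "dependent (range e)"
      unfolding dependent_finite[OF finite_imageI[OF finite]]
      using zero by (intro exI[of _ "\<lambda>v. c (inv e v) - d (inv e v)"]) auto
    then show False using ind by simp
  qed
  then show ?thesis using inj by simp
qed

lemma basis_change:
  assumes "is_basis e"
  shows "\<exists>M :: real^8^8. \<forall>j. e' j = (\<Sum>i\<in>UNIV. (M $ i $ j) *\<^sub>R e i)"
proof -
  have "\<forall>j. \<exists>c. e' j = (\<Sum>i\<in>UNIV. c i *\<^sub>R e i)"
    using basis_coords[OF assms] by blast
  then obtain c where "\<And>j. e' j = (\<Sum>i\<in>UNIV. c j i *\<^sub>R e i)" unfolding choice_iff by blast
  then show ?thesis by (intro exI[of _ "\<chi> i j. c j i"]) simp
qed

lemma basis_change_compose:
  fixes M N :: "real^8^8" and e :: "8 \<Rightarrow> 'v::real_vector"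
  assumes "\<And>j. e' j = (\<Sum>i\<in>UNIV. (M $ i $ j) *\<^sub>R e i)" "\<And>j. e'' j = (\<Sum>i\<in>UNIV. (N $ i $ j) *\<^sub>R e' i)"
  shows "e'' j = (\<Sum>i\<in>UNIV. ((M ** N) $ i $ j) *\<^sub>R e i)"
proof -
  have "e'' j = (\<Sum>k\<in>UNIV. \<Sum>i\<in>UNIV. (N $ k $ j * M $ i $ k) *\<^sub>R e i)"
    unfolding assms(2) by (simp add: assms(1) real_vector.scale_sum_right)
  also have "\<dots> = (\<Sum>i\<in>UNIV. ((M ** N) $ i $ j) *\<^sub>R e i)"
    by (subst sum.swap) (simp add: matrix_matrix_mult_def real_vector.scale_sum_left mult.commute)
  finally show ?thesis .
qed

lemma basis_change_inverse:
  fixes M N :: "real^8^8"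
  assumes "is_basis e" "\<And>j. e' j = (\<Sum>i\<in>UNIV. (M $ i $ j) *\<^sub>R e i)" "\<And>j. e j = (\<Sum>i\<in>UNIV. (N $ i $ j) *\<^sub>R e' i)"
  shows "M ** N = mat 1"
proof -
  have "(M ** N) $ i $ j = mat 1 $ i $ j" for i j
  proof (rule basis_coords_unique[OF assms(1), of "\<lambda>i. (M ** N) $ i $ j" "\<lambda>i. mat 1 $ i $ j"])
    have "(\<Sum>i\<in>UNIV. ((M ** N) $ i $ j) *\<^sub>R e i) = e j"
      by (rule basis_change_compose[OF assms(2,3), symmetric])
    also have "\<dots> = (\<Sum>i\<in>UNIV. (if i = j then e i else 0))" by simp
    also have "\<dots> = (\<Sum>i\<in>UNIV. (mat 1 $ i $ j :: real) *\<^sub>R e i)"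
      by (intro sum.cong) (auto simp: mat_def)
    finally show "(\<Sum>i\<in>UNIV. ((M ** N) $ i $ j) *\<^sub>R e i) = (\<Sum>i\<in>UNIV. (mat 1 $ i $ j :: real) *\<^sub>R e i)" .
  qed
  then show ?thesis by (simp add: vec_eq_iff)
qed

lemma same_orientation_trans:
  assumes "same_orientation e e'" "same_orientation e' e''"
  shows "same_orientation e e''"
proof -
  obtain M N :: "real^8^8" where M: "\<And>j. e' j = (\<Sum>i\<in>UNIV. (M $ i $ j) *\<^sub>R e i)" "det M > 0"
    and N: "\<And>j. e'' j = (\<Sum>i\<in>UNIV. (N $ i $ j) *\<^sub>R e' i)" "det N > 0"
    using assms unfolding same_orientation_def by blast
  have "det (M ** N) > 0" using M(2) N(2) by (simp add: det_mul)
  then show ?thesis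
    unfolding same_orientation_def using basis_change_compose[OF M(1) N(1)] by blast
qed

lemma same_orientation_sym:
  assumes "is_basis e" "is_basis e'" "same_orientation e e'"
  shows "same_orientation e' e"
proof -
  obtain M :: "real^8^8" where M: "\<And>j. e' j = (\<Sum>i\<in>UNIV. (M $ i $ j) *\<^sub>R e i)" "det M > 0"
    using assms(3) unfolding same_orientation_def by blast
  obtain N :: "real^8^8" where N: "\<And>j. e j = (\<Sum>i\<in>UNIV. (N $ i $ j) *\<^sub>R e' i)"
    using basis_change[OF assms(2), where e' = e] by blast
  have "det M * det N = 1"
    using basis_change_inverse[OF assms(1) M(1) N] by (simp flip: det_mul)
  then have "det N > 0" using M(2) by (metis zero_less_mult_pos zero_less_one)
  then show ?thesis unfolding same_orientation_def using N by blast
qed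

lemma orientation_class:
  assumes "orientation Or" "e \<in> Or"
  shows "is_basis e" and "Or = {e'. is_basis e' \<and> same_orientation e e'}"
proof -
  obtain d where d: "is_basis d" "Or = {e'. is_basis e' \<and> same_orientation d e'}"
    using assms(1) unfolding orientation_def by blast
  with assms(2) show e: "is_basis e" by simp
  have "same_orientation d e" "same_orientation e d"
    using d e assms(2) same_orientation_sym by auto
  then show "Or = {e'. is_basis e' \<and> same_orientation e e'}"
    unfolding d(2) using same_orientation_trans by blast
qed

lemma orientation_nonempty: "orientation Or \<Longrightarrow> \<exists>e. e \<in> Or"
proof -
  assume "orientation Or"
  then obtain d where d: "is_basis d" "Or = {e'. is_basis e' \<and> same_orientation d e'}"
    unfolding orientation_def by blast
  have "same_orientation d d" unfolding same_orientation_def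
  proof (intro exI[of _ "mat 1 :: real^8^8"] conjI allI)
    fix j
    have "d j = (\<Sum>i\<in>UNIV. (if i = j then d i else 0))" by simp
    also have "\<dots> = (\<Sum>i\<in>UNIV. (mat 1 $ i $ j :: real) *\<^sub>R d i)"
      by (intro sum.cong) (auto simp: mat_def)
    finally show "d j = (\<Sum>i\<in>UNIV. (mat 1 $ i $ j :: real) *\<^sub>R d i)" .
  qed (simp add: det_I)
  then show ?thesis using d by blast
qed

section \<open>Orthonormal bases\<close>

lemma Met_bilinear: "h \<in> Met \<Longrightarrow> bilinear h" and Met_sym: "h \<in> Met \<Longrightarrow> h v w = h w v"
  and Met_pos: "h \<in> Met \<Longrightarrow> v \<noteq> 0 \<Longrightarrow> h v v > 0"
  by (auto simp: Met_def)

lemma bilinear_lincomb_left: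
  fixes h :: "'v::real_vector \<Rightarrow> 'w::real_vector \<Rightarrow> real"
  assumes "bilinear h"
  shows "h (\<Sum>i\<in>A. c i *\<^sub>R f i) w = (\<Sum>i\<in>A. c i * h (f i) w)"
proof -
  have l: "linear (\<lambda>x. h x w)" using assms by (simp add: bilinear_def)
  show ?thesis by (simp add: linear_sum[OF l] linear_scale[OF l])
qed

lemma bilinear_lincomb_right:
  fixes h :: "'v::real_vector \<Rightarrow> 'w::real_vector \<Rightarrow> real"
  assumes "bilinear h"
  shows "h w (\<Sum>i\<in>A. c i *\<^sub>R f i) = (\<Sum>i\<in>A. c i * h w (f i))"
proof -
  have l: "linear (h w)" using assms by (simp add: bilinear_def)
  show ?thesis by (simp add: linear_sum[OF l] linear_scale[OF l])
qed

lemma orthonormal_coord: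
  assumes "bilinear h" "\<And>i j. h (e i) (e j) = (if i = j then 1 else 0)"
  shows "h (\<Sum>i\<in>(UNIV :: 8 set). c i *\<^sub>R e i) (e j) = c j"
  by (simp add: bilinear_lincomb_left[OF assms(1)] assms(2) if_distrib cong: if_cong)

lemma orthonormal_expansion:
  assumes "h \<in> Met" "orthonormal_basis h e"
  shows "v = (\<Sum>i\<in>UNIV. h v (e i) *\<^sub>R e i)"
proof -
  have e: "is_basis e" "\<And>i j. h (e i) (e j) = (if i = j then 1 else 0)"
    using assms(2) by (auto simp: orthonormal_basis_def)
  obtain c where v: "v = (\<Sum>i\<in>UNIV. c i *\<^sub>R e i)" using basis_coords[OF e(1)] .
  have "h v (e i) = c i" for i
    unfolding v by (rule orthonormal_coord[OF Met_bilinear[OF assms(1)] e(2)])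
  then show ?thesis using v by simp
qed

lemma orthonormal_inner:
  assumes "h \<in> Met" "orthonormal_basis h e"
  shows "h v w = (\<Sum>i\<in>UNIV. h v (e i) * h w (e i))"
  using bilinear_lincomb_left[OF Met_bilinear[OF assms(1)], of "\<lambda>i. h v (e i)" e UNIV w]
  by (simp add: orthonormal_expansion[OF assms, of v, symmetric] Met_sym[OF assms(1), of _ w])

text \<open>
  The Gram-Schmidt process, carried out for families indexed by natural numbers because the metric is
  not the inner product of a type class.
\<close>

lemma ex_orthonormal_basis:
  fixes h :: "'v::real_vector \<Rightarrow> 'v \<Rightarrow> real"
  assumes "h \<in> Met" "is_basis (b :: 8 \<Rightarrow> 'v::real_vector)"
  shows "\<exists>e. orthonormal_basis h e"
proof -
  have b: "card (range b) = 8" "independent (range b)" "span (range b) = UNIV"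
    using assms(2) by (auto simp: is_basis_def card_image)
  have "\<exists>f :: nat \<Rightarrow> 'v. \<forall>i<n. \<forall>j<n. h (f i) (f j) = (if i = j then 1 else 0)" if "n \<le> 8" for n
    using that
  proof (induction n)
    case (Suc n)
    then obtain f :: "nat \<Rightarrow> 'v" where f: "\<And>i j. i < n \<Longrightarrow> j < n \<Longrightarrow> h (f i) (f j) = (if i = j then 1 else 0)"
      by auto
    have "card (f ` {..<n}) \<le> n" using card_image_le[of "{..<n}" f] by simp
    then have "card (f ` {..<n}) < card (range b)" using Suc.prems b by simp
    then have "span (f ` {..<n}) \<noteq> UNIV"
      using independent_span_bound[of "f ` {..<n}" "range b"] b(2) by auto
    then obtain v where v: "v \<notin> span (f ` {..<n})" by auto
    define w where "w = v - (\<Sum>i<n. h v (f i) *\<^sub>R f i)"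
    have "w \<noteq> 0"
    proof
      assume "w = 0"
      then have "v = (\<Sum>i<n. h v (f i) *\<^sub>R f i)" by (simp add: w_def)
      also have "\<dots> \<in> span (f ` {..<n})" by (intro span_sum span_scale span_base) auto
      finally show False using v by simp
    qed
    then have pos: "h w w > 0" by (rule Met_pos[OF assms(1)])
    have lin: "linear (\<lambda>x. h x y)" "linear (h y)" for y
      using Met_bilinear[OF assms(1)] by (auto simp: bilinear_def)
    have wf: "h w (f j) = 0" if "j < n" for j
    proof -
      have "h (\<Sum>i<n. h v (f i) *\<^sub>R f i) (f j) = (\<Sum>i<n. h v (f i) * h (f i) (f j))"
        by (rule bilinear_lincomb_left[OF Met_bilinear[OF assms(1)]])
      also have "\<dots> = (\<Sum>i<n. if i = j then h v (f i) else 0)" using f that by (intro sum.cong) auto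
      also have "\<dots> = h v (f j)" using that by simp
      finally show ?thesis unfolding w_def by (simp add: linear_diff[OF lin(1)])
    qed
    then have fw: "h (f j) w = 0" if "j < n" for j using that Met_sym[OF assms(1)] by metis
    let ?g = "f(n := (1 / sqrt (h w w)) *\<^sub>R w)"
    have "h (?g i) (?g j) = (if i = j then 1 else 0)" if "i < Suc n" "j < Suc n" for i j
    proof -
      have "i < n \<or> i = n" "j < n \<or> j = n" using that by auto
      then show ?thesis
        using f wf fw pos
        by (auto simp: linear_scale[OF lin(1)] linear_scale[OF lin(2)] field_simps real_sqrt_mult[symmetric])
    qed
    then show ?case by blast
  qed simp
  from this[of 8] obtain f :: "nat \<Rightarrow> 'v" where f: "\<And>i j. i < 8 \<Longrightarrow> j < 8 \<Longrightarrow> h (f i) (f j) = (if i = j then 1 else 0)"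
    by auto
  obtain g where g: "bij_betw g (UNIV :: 8 set) {0..<8::nat}"
    using ex_bij_betw_finite_nat[of "UNIV :: 8 set"] by auto
  define e where "e = f \<circ> g"
  have gi: "g i < 8" "g i = g j \<longleftrightarrow> i = j" for i j
    using g by (auto simp: bij_betw_def inj_eq)
  have e: "h (e i) (e j) = (if i = j then 1 else 0)" for i j
    using f[OF gi(1) gi(1)] gi(2) by (simp add: e_def)
  note coord = orthonormal_coord[of h e, OF Met_bilinear[OF assms(1)] e]
  have inj: "inj e"
    using e by (intro injI) (metis zero_neq_one)
  have ind: "independent (range e)" unfolding dependent_finite[OF finite_imageI[OF finite]]
  proof (intro notI, elim exE conjE bexE)
    fix c v assume nz: "c v \<noteq> 0" and "(\<Sum>v\<in>range e. c v *\<^sub>R v) = 0" and v: "v \<in> range e"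
    then have "(\<Sum>i\<in>UNIV. (c \<circ> e) i *\<^sub>R e i) = 0" by (simp add: sum.reindex[OF inj])
    then have "(c \<circ> e) j = h 0 (e j)" for j using coord[of "c \<circ> e" j] by simp
    then have "(c \<circ> e) j = 0" for j using Met_bilinear[OF assms(1)] by (simp add: bilinear_lzero)
    then show False using v nz by auto
  qed
  have "span (range e) = UNIV"
  proof (rule ccontr)
    assume "span (range e) \<noteq> UNIV"
    then obtain v where v: "v \<notin> span (range e)" by auto
    then have "independent (insert v (range e))" "v \<notin> range e"
      using ind by (auto simp: independent_insert intro: span_base)
    moreover have "card (range e) = 8" using inj by (simp add: card_image)
    ultimately show False
      using independent_span_bound[of "range b" "insert v (range e)"] b by simp
  qed
  then have "is_basis e" using inj ind by (simp add: is_basis_def)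
  then show ?thesis using e by (auto simp: orthonormal_basis_def)
qed

text \<open>
  Reversing one vector turns an orthonormal basis of the wrong orientation into a positive one.
\<close>

lemma is_basis_flip:
  assumes "is_basis e"
  shows "is_basis (e(1 := - e 1))"
proof (rule is_basisI)
  have eq: "(\<Sum>i\<in>UNIV. c i *\<^sub>R (e(1 := - e 1)) i) = (\<Sum>i\<in>UNIV. (c(1 := - c 1)) i *\<^sub>R e i)" for c :: "8 \<Rightarrow> real"
    by (intro sum.cong) auto
  show "c = (\<lambda>_. 0)" if "(\<Sum>i\<in>UNIV. c i *\<^sub>R (e(1 := - e 1)) i) = 0" for c
  proof -
    have "(\<Sum>i\<in>UNIV. (c(1 := - c 1)) i *\<^sub>R e i) = (\<Sum>i\<in>UNIV. 0 *\<^sub>R e i)" using that eq by simp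
    then have *: "(c(1 := - c 1)) i = 0" for i
      by (rule basis_coords_unique[OF assms, of "c(1 := - c 1)" "\<lambda>_. 0"])
    show ?thesis
    proof
      show "c i = 0" for i using *[of i] by (cases "i = 1") auto
    qed
  qed
  show "\<exists>c. v = (\<Sum>i\<in>UNIV. c i *\<^sub>R (e(1 := - e 1)) i)" for v
  proof -
    obtain c where c: "v = (\<Sum>i\<in>UNIV. c i *\<^sub>R e i)" using basis_coords[OF assms] .
    have "(c(1 := - c 1))(1 := - (c(1 := - c 1)) 1) = c" by auto
    then have "v = (\<Sum>i\<in>UNIV. (c(1 := - c 1)) i *\<^sub>R (e(1 := - e 1)) i)"
      using c eq[of "c(1 := - c 1)"] by (simp only:)
    then show ?thesis by blast
  qed
qed

lemma orientation_flip:
  assumes "orientation Or" "is_basis e" "e \<notin> Or"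
  shows "e(1 := - e 1) \<in> Or"
proof -
  obtain d where "d \<in> Or" using orientation_nonempty[OF assms(1)] by blast
  note d = orientation_class[OF assms(1) this]
  obtain M :: "real^8^8" where M: "\<And>j. e j = (\<Sum>i\<in>UNIV. (M $ i $ j) *\<^sub>R d i)"
    using basis_change[OF d(1), where e' = e] by blast
  obtain N :: "real^8^8" where N: "\<And>j. d j = (\<Sum>i\<in>UNIV. (N $ i $ j) *\<^sub>R e i)"
    using basis_change[OF assms(2), where e' = d] by blast
  have "det M * det N = 1"
    using basis_change_inverse[OF d(1) M N] by (simp flip: det_mul)
  moreover have "\<not> det M > 0" using assms(2,3) d(2) M unfolding same_orientation_def by blast
  ultimately have "det M < 0" by (cases "det M = 0") auto
  \<comment> \<open>The matrix that reverses the first basis vector.\<close>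
  define D :: "real^8^8" where "D = (\<chi> i j. if i = j then (if i = 1 then -1 else 1) else 0)"
  have "det D = (\<Prod>i\<in>UNIV. D $ i $ i)" by (rule det_diagonal) (simp add: D_def)
  also have "\<dots> = -1" by (simp add: D_def prod.delta)
  finally have "det (M ** D) > 0" using \<open>det M < 0\<close> by (simp add: det_mul)
  have D: "(e(1 := - e 1)) j = (\<Sum>i\<in>UNIV. (D $ i $ j) *\<^sub>R e i)" for j
  proof -
    have "(\<Sum>i\<in>UNIV. (D $ i $ j) *\<^sub>R e i) = (\<Sum>i\<in>UNIV. if i = j then (if i = 1 then - e i else e i) else 0)"
      by (intro sum.cong) (auto simp: D_def)
    then show ?thesis by simp
  qed
  have "same_orientation d (e(1 := - e 1))"
    unfolding same_orientation_def
    using basis_change_compose[OF M D] \<open>det (M ** D) > 0\<close> by blast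
  then show ?thesis using d(2) is_basis_flip[OF assms(2)] by blast
qed

lemma ex_oriented_orthonormal_basis:
  assumes "orientation Or" "h \<in> Met"
  shows "\<exists>e\<in>Or. orthonormal_basis h e"
proof -
  obtain d where "d \<in> Or" using orientation_nonempty[OF assms(1)] by blast
  then obtain e where e: "orthonormal_basis h e"
    using ex_orthonormal_basis[OF assms(2)] orientation_class(1)[OF assms(1)] by blast
  then have b: "is_basis e" by (simp add: orthonormal_basis_def)
  show ?thesis
  proof (cases "e \<in> Or")
    case False
    have "orthonormal_basis h (e(1 := - e 1))"
      using e is_basis_flip[OF b] bilinear_lneg[OF Met_bilinear[OF assms(2)]] bilinear_rneg[OF Met_bilinear[OF assms(2)]]
      by (auto simp: orthonormal_basis_def)
    then show ?thesis using orientation_flip[OF assms(1) b False] by blast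
  qed (use e in blast)
qed

section \<open>Traces with respect to a metric\<close>

text \<open>
  A linear form is represented by the vector that has its values on an orthonormal basis as coordinates,
  which justifies the definite description in \<open>sharp\<close>.
\<close>

lemma sharp_dual_basis:
  assumes "h \<in> Met" "is_basis b"
  shows "h (sharp h (dual_basis b a)) w = dual_basis b a w"
proof -
  obtain e where e: "orthonormal_basis h e" using ex_orthonormal_basis[OF assms] by blast
  have rep: "linear (dual_basis b a)"
    unfolding dual_basis_def using assms(2)
    by (intro linearI) (auto simp: is_basis_def representation_add representation_scale)
  have *: "\<forall>w. h (\<Sum>i\<in>UNIV. dual_basis b a (e i) *\<^sub>R e i) w = dual_basis b a w"
  proof
    fix w
    have "dual_basis b a w = dual_basis b a (\<Sum>i\<in>UNIV. h w (e i) *\<^sub>R e i)"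
      by (simp flip: orthonormal_expansion[OF assms(1) e])
    also have "\<dots> = (\<Sum>i\<in>UNIV. dual_basis b a (e i) * h (e i) w)"
      by (simp add: linear_sum[OF rep] linear_scale[OF rep] Met_sym[OF assms(1), of w] mult.commute)
    finally show "h (\<Sum>i\<in>UNIV. dual_basis b a (e i) *\<^sub>R e i) w = dual_basis b a w"
      by (simp add: bilinear_lincomb_left[OF Met_bilinear[OF assms(1)]])
  qed
  have "\<forall>w. h (sharp h (dual_basis b a)) w = dual_basis b a w"
    unfolding sharp_def
  proof (rule theI[of "\<lambda>v. \<forall>w. h v w = dual_basis b a w", OF *])
    fix v assume "\<forall>w. h v w = dual_basis b a w"
    then have "h v (e i) = dual_basis b a (e i)" for i by simp
    then show "v = (\<Sum>i\<in>UNIV. dual_basis b a (e i) *\<^sub>R e i)"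
      using orthonormal_expansion[OF assms(1) e, of v] by simp
  qed
  then show ?thesis by simp
qed

lemma dual_basis_expansion:
  assumes "is_basis b"
  shows "v = (\<Sum>a\<in>UNIV. dual_basis b a v *\<^sub>R b a)"
proof -
  have inj: "inj b" using assms by (simp add: is_basis_def)
  have "(\<Sum>w\<in>range b. representation (range b) v w *\<^sub>R w) = v"
    using assms by (intro sum_representation_eq) (auto simp: is_basis_def)
  then show ?thesis by (simp add: sum.reindex[OF inj] dual_basis_def comp_def)
qed

text \<open>
  The inverse metric contracts a bilinear form to its trace over any orthonormal basis. This is what
  removes the auxiliary basis and the dual metric from \<open>\<Delta>\<^sub>2\<close>.
\<close>

lemma dual_metric_trace:
  assumes "h \<in> Met" "is_basis b" "orthonormal_basis h e" "bilinear B"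
  shows "(\<Sum>a\<in>UNIV. \<Sum>c\<in>UNIV. dual_metric h (dual_basis b a) (dual_basis b c) * B (b a) (b c))
       = (\<Sum>i\<in>UNIV. B (e i) (e i) :: real)"
proof -
  let ?d = "\<lambda>a i. dual_basis b a (e i)"
  have dm: "dual_metric h (dual_basis b a) (dual_basis b c) = (\<Sum>i\<in>UNIV. ?d a i * ?d c i)" for a c
    unfolding dual_metric_def
    by (subst orthonormal_inner[OF assms(1,3)]) (simp add: sharp_dual_basis[OF assms(1,2)])
  have "B (e i) (e i) = (\<Sum>a\<in>UNIV. \<Sum>c\<in>UNIV. ?d a i * ?d c i * B (b a) (b c))" for i
  proof -
    have "B (e i) (e i) = B (\<Sum>a\<in>UNIV. ?d a i *\<^sub>R b a) (\<Sum>c\<in>UNIV. ?d c i *\<^sub>R b c)"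
      by (simp flip: dual_basis_expansion[OF assms(2)])
    then show ?thesis
      unfolding bilinear_lincomb_left[OF assms(4)]
      by (simp add: bilinear_lincomb_right[OF assms(4)] sum_distrib_left mult.assoc)
  qed
  then have "(\<Sum>i\<in>UNIV. B (e i) (e i)) = (\<Sum>i\<in>UNIV. \<Sum>a\<in>UNIV. \<Sum>c\<in>UNIV. ?d a i * ?d c i * B (b a) (b c))"
    by simp
  also have "\<dots> = (\<Sum>a\<in>UNIV. \<Sum>c\<in>UNIV. \<Sum>i\<in>UNIV. ?d a i * ?d c i * B (b a) (b c))"
    by (subst sum.swap, rule sum.cong[OF refl], rule sum.swap)
  finally show ?thesis by (simp add: dm sum_distrib_right)
qed

lemma orthonormal_trace_unique:
  assumes "h \<in> Met" "orthonormal_basis h e" "orthonormal_basis h f" "bilinear B"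
  shows "(\<Sum>i\<in>UNIV. B (f i) (f i) :: real) = (\<Sum>i\<in>UNIV. B (e i) (e i))"
proof -
  have "is_basis e" using assms(2) by (simp add: orthonormal_basis_def)
  from dual_metric_trace[OF assms(1) this assms(2,4)] dual_metric_trace[OF assms(1) this assms(3,4)]
  show ?thesis by simp
qed

section \<open>The scalar product of four-forms\<close>

text \<open>
  Sums over the sublists with \<open>k\<close> entries of a list and over all \<open>k\<close>-tuples of its entries, by
  recursion, so that for a concrete frame they unfold by rewriting. The first is the sum in
  \<open>form_inner\<close>, the second the one that matrix calculus can handle.
\<close>

fun subset_sum :: "nat \<Rightarrow> 'v list \<Rightarrow> ('v list \<Rightarrow> real) \<Rightarrow> real" where
  "subset_sum 0 L g = g []"
| "subset_sum (Suc k) [] g = 0"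
| "subset_sum (Suc k) (x # L) g = subset_sum k L (\<lambda>vs. g (x # vs)) + subset_sum (Suc k) L g"

fun tuple_sum :: "nat \<Rightarrow> 'v list \<Rightarrow> ('v list \<Rightarrow> real) \<Rightarrow> real" where
  "tuple_sum 0 L g = g []"
| "tuple_sum (Suc k) L g = (\<Sum>x\<leftarrow>L. tuple_sum k L (\<lambda>vs. g (x # vs)))"

lemma sum_nths_eq_subset_sum:
  assumes "\<And>vs. length vs \<noteq> k \<Longrightarrow> g vs = 0"
  shows "(\<Sum>I\<in>Pow {..<length L}. g (nths L I)) = subset_sum k L g"
  using assms
proof (induction L arbitrary: k g)
  case Nil
  then show ?case by (cases k) simp_all
next
  case (Cons x L)
  have "{j. Suc j \<in> insert 0 (Suc ` J)} = J" "{j. Suc j \<in> Suc ` J} = J" for J by auto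
  then have *: "(\<Sum>I\<in>Pow {..<length (x # L)}. g (nths (x # L) I))
      = (\<Sum>J\<in>Pow {..<length L}. g (x # nths L J)) + (\<Sum>J\<in>Pow {..<length L}. g (nths L J))"
    by (simp add: sum_Pow_Suc nths_Cons image_iff)
  show ?case
  proof (cases k)
    case 0
    then have "(\<lambda>vs. g (x # vs)) = (\<lambda>_. 0)" using Cons.prems by auto
    then have "g (x # vs) = 0" for vs by meson
    moreover have "(\<Sum>J\<in>Pow {..<length L}. g (nths L J)) = subset_sum k L g"
      by (rule Cons.IH[OF Cons.prems])
    ultimately show ?thesis using 0 * by simp
  next
    case (Suc m)
    then have "(\<Sum>J\<in>Pow {..<length L}. g (x # nths L J)) = subset_sum m L (\<lambda>vs. g (x # vs))"
      using Cons.prems by (intro Cons.IH) simp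
    moreover have "(\<Sum>J\<in>Pow {..<length L}. g (nths L J)) = subset_sum k L g"
      by (rule Cons.IH[OF Cons.prems])
    ultimately show ?thesis using Suc * by simp
  qed
qed

lemma tuple_sum_zero: "tuple_sum k L (\<lambda>_. 0) = 0"
  by (induction k) simp_all

text \<open>
  For a symmetric summand that vanishes on repetitions, the new entry \<open>x\<close> occurs at most once in a
  tuple that contributes, and it can then be moved to the front from each of the \<open>k\<close> places.
\<close>

lemma tuple_sum_Cons:
  assumes "\<And>us x y ws. g (us @ x # y # ws) = g (us @ y # x # ws)"
    and "\<And>us x ws. g (us @ x # x # ws) = (0 :: real)"
  shows "tuple_sum k (x # L) g = tuple_sum k L g + k * tuple_sum (k - 1) L (\<lambda>vs. g (x # vs))"
  using assms
proof (induction k arbitrary: g)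
  case (Suc k)
  have IH: "tuple_sum k (x # L) (\<lambda>vs. g (v # vs))
      = tuple_sum k L (\<lambda>vs. g (v # vs)) + k * tuple_sum (k - 1) L (\<lambda>vs. g (v # x # vs))" for v
    using Suc.prems[of "v # _"] by (intro Suc.IH) simp_all
  have sw: "g (v # x # vs) = g (x # v # vs)" and z: "g (x # x # vs) = 0" for v vs
    using Suc.prems[of "[]"] by simp_all
  have "(\<Sum>v\<leftarrow>L. k * tuple_sum (k - 1) L (\<lambda>vs. g (v # x # vs))) = k * tuple_sum k L (\<lambda>vs. g (x # vs))"
    by (cases k) (simp_all add: sw sum_list_const_mult)
  then show ?case
    by (simp add: IH z tuple_sum_zero sum_list_addf algebra_simps)
qed simp

lemma tuple_sum_eq_subset_sum:
  assumes "\<And>us x y ws. g (us @ x # y # ws) = g (us @ y # x # ws)"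
    and "\<And>us x ws. g (us @ x # x # ws) = (0 :: real)"
  shows "tuple_sum k L g = fact k * subset_sum k L g"
  using assms
proof (induction L arbitrary: k g)
  case Nil
  then show ?case by (cases k) simp_all
next
  case (Cons x L)
  show ?case
  proof (cases k)
    case (Suc m)
    have "tuple_sum m L (\<lambda>vs. g (x # vs)) = fact m * subset_sum m L (\<lambda>vs. g (x # vs))"
      using Cons.prems[of "x # _"] by (intro Cons.IH) simp_all
    moreover have "tuple_sum k L g = fact k * subset_sum k L g"
      using Cons.prems by (intro Cons.IH) simp_all
    moreover have "tuple_sum k (x # L) g = tuple_sum k L g + k * tuple_sum (k - 1) L (\<lambda>vs. g (x # vs))"
      using Cons.prems by (intro tuple_sum_Cons) simp_all
    ultimately show ?thesis using Suc by (simp add: algebra_simps)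
  qed simp
qed

lemma sum_list_frame: "(\<Sum>v\<leftarrow>frame e. f v) = (\<Sum>i\<in>UNIV. f (e i) :: real)"
  by (simp add: frame_def sum_8)

lemma length_frame [simp]: "length (frame e) = 8"
  by (simp add: frame_def)

lemma forms_length: "\<alpha> \<in> forms k \<Longrightarrow> length vs \<noteq> k \<Longrightarrow> \<alpha> vs = 0"
  and forms_polyform: "\<alpha> \<in> forms k \<Longrightarrow> polyform \<alpha>"
  by (simp_all add: forms_def)

text \<open>
  The product of two alternating functions is symmetric and vanishes on repetitions, so a sum over
  index sets is \<open>1 / 4!\<close> times the unrestricted sum.
\<close>

lemma frame_subset_sum:
  assumes "\<alpha> \<in> forms 4" "polyform \<beta>"
  shows "(\<Sum>I\<in>Pow {..<8}. \<alpha> (nths (frame e) I) * \<beta> (nths (frame e) I))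
    = subset_sum 4 (frame e) (\<lambda>vs. \<alpha> vs * \<beta> vs)"
    and "24 * subset_sum 4 (frame e) (\<lambda>vs. \<alpha> vs * \<beta> vs)
    = (\<Sum>i\<in>UNIV. \<Sum>j\<in>UNIV. \<Sum>k\<in>UNIV. \<Sum>l\<in>UNIV. \<alpha> [e i, e j, e k, e l] * \<beta> [e i, e j, e k, e l])"
proof -
  show "(\<Sum>I\<in>Pow {..<8}. \<alpha> (nths (frame e) I) * \<beta> (nths (frame e) I))
    = subset_sum 4 (frame e) (\<lambda>vs. \<alpha> vs * \<beta> vs)"
    using sum_nths_eq_subset_sum[of 4 "\<lambda>vs. \<alpha> vs * \<beta> vs" "frame e"] forms_length[OF assms(1)] by simp
  have \<alpha>: "polyform \<alpha>" using assms(1) by (rule forms_polyform)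
  have "tuple_sum 4 (frame e) (\<lambda>vs. \<alpha> vs * \<beta> vs) = fact 4 * subset_sum 4 (frame e) (\<lambda>vs. \<alpha> vs * \<beta> vs)"
  proof (rule tuple_sum_eq_subset_sum)
    fix us ws :: "'a list" and x y :: 'a
    show "\<alpha> (us @ x # y # ws) * \<beta> (us @ x # y # ws) = \<alpha> (us @ y # x # ws) * \<beta> (us @ y # x # ws)"
      using polyform_swap[OF \<alpha>, of us x y ws] polyform_swap[OF assms(2), of us x y ws] by simp
    show "\<alpha> (us @ x # x # ws) * \<beta> (us @ x # x # ws) = 0"
      using polyform_repeat[OF \<alpha>] by simp
  qed
  then show "24 * subset_sum 4 (frame e) (\<lambda>vs. \<alpha> vs * \<beta> vs)
    = (\<Sum>i\<in>UNIV. \<Sum>j\<in>UNIV. \<Sum>k\<in>UNIV. \<Sum>l\<in>UNIV. \<alpha> [e i, e j, e k, e l] * \<beta> [e i, e j, e k, e l])"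
    by (simp add: eval_nat_numeral sum_list_frame fact_numeral)
qed

lemma bilinear_form_slots:
  assumes "polyform \<alpha>" "polyform \<beta>"
  shows "bilinear (\<lambda>v w. \<alpha> (us @ v # ws) * \<beta> (us' @ w # ws') :: real)"
  unfolding bilinear_def
  using linear_compose_scale_right[OF polyform_linear[OF assms(2), of us' ws'], of "\<alpha> (us @ _ # ws)"]
    linear_compose_scale_right[OF polyform_linear[OF assms(1), of us ws], of "\<beta> (us' @ _ # ws')"]
  by (simp add: mult.commute)

lemma bilinear_sum:
  assumes "\<And>i. i \<in> A \<Longrightarrow> bilinear (B i)"
  shows "bilinear (\<lambda>v w. \<Sum>i\<in>A. B i v w)"
  using assms unfolding bilinear_def by (auto intro!: linear_compose_sum)

text \<open>
  Independence of the orthonormal basis: one replaces the four vectors of the chosen basis by the given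
  ones in one slot after the other, since in each slot the sum is the trace of a bilinear form.
\<close>

lemma form_inner_orthonormal:
  fixes h :: "'v::real_vector \<Rightarrow> 'v \<Rightarrow> real"
  assumes "h \<in> Met" "orthonormal_basis h e" "\<alpha> \<in> forms 4" "polyform \<beta>"
  shows "form_inner h \<alpha> \<beta> = (\<Sum>i\<in>UNIV. \<Sum>j\<in>UNIV. \<Sum>k\<in>UNIV. \<Sum>l\<in>UNIV.
      \<alpha> [e i, e j, e k, e l] * \<beta> [e i, e j, e k, e l]) / 24"
proof -
  define f where "f = (SOME e. orthonormal_basis h e)"
  have f: "orthonormal_basis h f"
    unfolding f_def using someI[of "orthonormal_basis h"] assms(2) by blast
  have \<alpha>: "polyform \<alpha>" using assms(3) by (rule forms_polyform)
  note tr = orthonormal_trace_unique[OF assms(1) assms(2) f]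
  note bl = bilinear_form_slots[OF \<alpha> assms(4)]
  have "(\<Sum>i\<in>UNIV. \<Sum>j\<in>UNIV. \<Sum>k\<in>UNIV. \<Sum>l\<in>UNIV. \<alpha> [f i, f j, f k, f l] * \<beta> [f i, f j, f k, f l])
     = (\<Sum>i\<in>UNIV. \<Sum>j\<in>UNIV. \<Sum>k\<in>UNIV. \<Sum>l\<in>UNIV. \<alpha> [f i, f j, f k, e l] * \<beta> [f i, f j, f k, e l])"
    by (intro sum.cong refl tr bl[of "[_, _, _]" "[]" "[_, _, _]" "[]", simplified])
  also have "\<dots> = (\<Sum>i\<in>UNIV. \<Sum>j\<in>UNIV. \<Sum>k\<in>UNIV. \<Sum>l\<in>UNIV. \<alpha> [f i, f j, e k, e l] * \<beta> [f i, f j, e k, e l])"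
    by (intro sum.cong refl tr bilinear_sum bl[of "[_, _]" "[_]" "[_, _]" "[_]", simplified])
  also have "\<dots> = (\<Sum>i\<in>UNIV. \<Sum>j\<in>UNIV. \<Sum>k\<in>UNIV. \<Sum>l\<in>UNIV. \<alpha> [f i, e j, e k, e l] * \<beta> [f i, e j, e k, e l])"
    by (intro sum.cong refl tr bilinear_sum bl[of "[_]" "[_, _]" "[_]" "[_, _]", simplified])
  also have "\<dots> = (\<Sum>i\<in>UNIV. \<Sum>j\<in>UNIV. \<Sum>k\<in>UNIV. \<Sum>l\<in>UNIV. \<alpha> [e i, e j, e k, e l] * \<beta> [e i, e j, e k, e l])"
    by (intro sum.cong refl tr bilinear_sum bl[of "[]" "[_, _, _]" "[]" "[_, _, _]", simplified])
  finally show ?thesis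
    unfolding form_inner_def Let_def f_def[symmetric]
    using frame_subset_sum[OF assms(3,4), of f] by simp
qed

section \<open>The product in an orthonormal basis\<close>

lemma wedge_2_2:
  assumes "\<alpha> \<in> forms 2" "\<beta> \<in> forms 2"
  shows "(\<alpha> \<and>\<^sub>w \<beta>) [w, x, y, z]
    = \<alpha> [w, x] * \<beta> [y, z] - \<alpha> [w, y] * \<beta> [x, z] + \<alpha> [w, z] * \<beta> [x, y]
    + \<alpha> [x, y] * \<beta> [w, z] - \<alpha> [x, z] * \<beta> [w, y] + \<alpha> [y, z] * \<beta> [w, x]"
  using forms_length[OF assms(1)] forms_length[OF assms(2)]
  by (simp add: wedge_Cons wedge_Nil interior_def graded_sign_def)

lemma interior_forms: "\<alpha> \<in> forms (Suc k) \<Longrightarrow> interior v \<alpha> \<in> forms k"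
  unfolding forms_def using polyform_interior by (auto simp: interior_def)

lemma linear_wedge_param:
  assumes "\<And>vs. linear (\<lambda>v. f v vs)"
  shows "linear (\<lambda>v. (f v \<and>\<^sub>w \<beta>) vs)" "linear (\<lambda>v. (\<beta> \<and>\<^sub>w f v) vs)"
  unfolding wedge_def
  using linear_add[OF assms] linear_scale[OF assms]
  by (auto intro!: linear_compose_sum linearI simp: algebra_simps)

text \<open>
  Two applications of \<open>dual_metric_trace\<close>, one for each of the contracted pairs of indices.
\<close>

lemma Delta2_orthonormal:
  fixes h :: "'v::real_vector \<Rightarrow> 'v \<Rightarrow> real"
  assumes "h \<in> Met" "orthonormal_basis h e" "polyform \<alpha>" "polyform \<beta>"
  shows "Delta2 h \<alpha> \<beta> vs = 1/2 * (\<Sum>i\<in>UNIV. \<Sum>j\<in>UNIV.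
     (interior (e i) (interior (e j) \<alpha>) \<and>\<^sub>w interior (e i) (interior (e j) \<beta>)) vs)"
proof -
  define b where "b = (SOME b :: 8 \<Rightarrow> 'v. is_basis b)"
  have "is_basis e" using assms(2) by (simp add: orthonormal_basis_def)
  then have b: "is_basis b" unfolding b_def using someI[of "is_basis :: (8 \<Rightarrow> 'v) \<Rightarrow> bool"] by blast
  define hh where "hh a c = dual_metric h (dual_basis b a) (dual_basis b c)" for a c
  define X where "X v v' w w' = (interior v (interior v' \<alpha>) \<and>\<^sub>w interior w (interior w' \<beta>)) vs" for v v' w w'
  note tr = dual_metric_trace[OF assms(1) b assms(2), folded hh_def]
  have l: "linear (\<lambda>v. interior x (interior v \<gamma>) us)" "linear (\<lambda>v. interior v (interior x \<gamma>) us)"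
    if "polyform \<gamma>" for x us and \<gamma> :: "'v list \<Rightarrow> real"
    using polyform_linear[OF that, of "[]" "x # us"] polyform_linear[OF that, of "[x]" us]
    by (simp_all add: interior_def)
  have X: "bilinear (\<lambda>v' w'. X v v' w w')" "bilinear (\<lambda>v w. X v v' w w')" for v v' w w'
    unfolding X_def bilinear_def using assms(3,4) by (auto intro!: linear_wedge_param l)
  have "Delta2 h \<alpha> \<beta> vs = 1/2 * (\<Sum>a1\<in>UNIV. \<Sum>a2\<in>UNIV. \<Sum>b1\<in>UNIV. \<Sum>b2\<in>UNIV.
      hh a1 b1 * hh a2 b2 * X (b a1) (b a2) (b b1) (b b2))"
    unfolding Delta2_def Let_def b_def[symmetric] hh_def X_def ..
  also have "(\<Sum>a1\<in>UNIV. \<Sum>a2\<in>UNIV. \<Sum>b1\<in>UNIV. \<Sum>b2\<in>UNIV.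
      hh a1 b1 * hh a2 b2 * X (b a1) (b a2) (b b1) (b b2))
    = (\<Sum>a1\<in>UNIV. \<Sum>b1\<in>UNIV. hh a1 b1 * (\<Sum>a2\<in>UNIV. \<Sum>b2\<in>UNIV. hh a2 b2 * X (b a1) (b a2) (b b1) (b b2)))"
    by (rule sum.cong[OF refl], subst sum.swap) (simp add: sum_distrib_left mult.assoc)
  also have "\<dots> = (\<Sum>a1\<in>UNIV. \<Sum>b1\<in>UNIV. hh a1 b1 * (\<Sum>j\<in>UNIV. X (b a1) (e j) (b b1) (e j)))"
    by (intro sum.cong refl arg_cong[where f = "\<lambda>x. _ * x"] tr X)
  also have "\<dots> = (\<Sum>i\<in>UNIV. \<Sum>j\<in>UNIV. X (e i) (e j) (e i) (e j))"
    by (intro tr bilinear_sum X)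
  finally show ?thesis unfolding X_def .
qed

lemma Delta2_forms:
  fixes h :: "'v::real_vector \<Rightarrow> 'v \<Rightarrow> real"
  assumes "h \<in> Met" "orthonormal_basis h e" "\<alpha> \<in> forms 4" "\<beta> \<in> forms 4"
  shows "Delta2 h \<alpha> \<beta> \<in> forms 4"
proof -
  have "interior (e i) (interior (e j) \<alpha>) \<in> forms 2" "interior (e i) (interior (e j) \<beta>) \<in> forms 2" for i j
    using assms(3,4) by (auto intro!: interior_forms simp: eval_nat_numeral)
  then have w: "interior (e i) (interior (e j) \<alpha>) \<and>\<^sub>w interior (e i) (interior (e j) \<beta>) \<in> forms 4" for i j
    using wedge_forms[of _ 2 _ 2] by fastforce
  have eq: "Delta2 h \<alpha> \<beta> = (\<lambda>vs. \<Sum>p\<in>UNIV. 1/2 *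
     (interior (e (fst p)) (interior (e (snd p)) \<alpha>) \<and>\<^sub>w interior (e (fst p)) (interior (e (snd p)) \<beta>)) vs)"
    by (rule ext) (simp add: Delta2_orthonormal[OF assms(1,2) forms_polyform[OF assms(3)] forms_polyform[OF assms(4)]]
      sum.cartesian_product sum_distrib_left case_prod_beta' flip: UNIV_Times_UNIV)
  have "polyform (Delta2 h \<alpha> \<beta>)"
    unfolding eq using forms_polyform[OF w] by (intro polyform_lincomb)
  moreover have "Delta2 h \<alpha> \<beta> vs = 0" if "length vs \<noteq> 4" for vs
    unfolding eq using forms_length[OF w that] by simp
  ultimately show ?thesis by (simp add: forms_def)
qed

section \<open>The potential as a function of matrices indexed by pairs\<close>

text \<open>
  In this arrangement of the components, the contraction of two pairs of indices is a matrix product, and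
  the whole potential becomes a combination of traces.
\<close>

definition pair_matrix :: "(8 \<Rightarrow> 'v) \<Rightarrow> ('v list \<Rightarrow> real) \<Rightarrow> real^(8 \<times> 8)^(8 \<times> 8)" where
  "pair_matrix e \<alpha> = (\<chi> p q. \<alpha> [e (fst p), e (snd p), e (fst q), e (snd q)])"

lemma four_form_swaps:
  assumes "polyform \<alpha>"
  shows "\<alpha> [j, i, k, l] = - \<alpha> [i, j, k, l]" "\<alpha> [i, k, j, l] = - \<alpha> [i, j, k, l]" "\<alpha> [i, j, l, k] = - \<alpha> [i, j, k, l]"
  using polyform_swap[OF assms, of "[]" j i "[k, l]"] polyform_swap[OF assms, of "[i]" k j "[l]"]
    polyform_swap[OF assms, of "[i, j]" l k "[]"] by simp_all

lemma four_form_permutes: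
  assumes "polyform \<alpha>"
  shows "\<alpha> [i, k, l, j] = \<alpha> [i, j, k, l]" "\<alpha> [k, i, j, l] = \<alpha> [i, j, k, l]"
    "\<alpha> [k, i, l, j] = - \<alpha> [i, j, k, l]" "\<alpha> [k, l, i, j] = \<alpha> [i, j, k, l]"
proof -
  note sw = four_form_swaps[OF assms]
  show a: "\<alpha> [i, k, l, j] = \<alpha> [i, j, k, l]" using sw(3)[of i k j l] sw(2)[of i k j l] by simp
  show b: "\<alpha> [k, i, j, l] = \<alpha> [i, j, k, l]" using sw(1)[of i k j l] sw(2)[of i k j l] by simp
  show "\<alpha> [k, i, l, j] = - \<alpha> [i, j, k, l]" using sw(3)[of k i j l] b by simp
  show "\<alpha> [k, l, i, j] = \<alpha> [i, j, k, l]"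
    using sw(2)[of k i l j] sw(3)[of k i j l] b by simp
qed

lemma sum_pairs:
  fixes f :: "'a::finite \<times> 'b::finite \<Rightarrow> real"
  shows "(\<Sum>p\<in>UNIV. f p) = (\<Sum>i\<in>UNIV. \<Sum>j\<in>UNIV. f (i, j))"
  by (simp add: sum.cartesian_product case_prod_beta' flip: UNIV_Times_UNIV)

lemma trace_mult: "trace (A ** B) = (\<Sum>p\<in>UNIV. \<Sum>q\<in>UNIV. A $ p $ q * B $ q $ p)"
  for A B :: "real^'n^'n"
  by (simp add: trace_def matrix_matrix_mult_def)

lemma form_inner_trace:
  assumes "h \<in> Met" "orthonormal_basis h e" "\<alpha> \<in> forms 4" "\<beta> \<in> forms 4"
  shows "form_inner h \<alpha> \<beta> = trace (pair_matrix e \<alpha> ** pair_matrix e \<beta>) / 24"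
  unfolding form_inner_orthonormal[OF assms(1-3) forms_polyform[OF assms(4)]] trace_mult sum_pairs pair_matrix_def
  by (simp add: four_form_permutes(4)[OF forms_polyform[OF assms(4)]])

text \<open>
  All six ways to distribute four arguments over two two-forms; each contraction is a matrix product.
\<close>

lemma Delta2_components:
  assumes "h \<in> Met" "orthonormal_basis h e" "\<alpha> \<in> forms 4" "\<beta> \<in> forms 4"
  defines "X \<equiv> \<lambda>i j k l. (pair_matrix e \<alpha> ** pair_matrix e \<beta>) $ (i, j) $ (k, l)"
  shows "Delta2 h \<alpha> \<beta> [e i, e j, e k, e l]
    = (X i j k l - X i k j l + X i l j k + X j k i l - X j l i k + X k l i j) / 2"
proof -
  have i2: "interior (e a) (interior (e b) \<gamma>) \<in> forms 2" if "\<gamma> \<in> forms 4" for a b \<gamma>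
    using that by (auto intro!: interior_forms simp: eval_nat_numeral)
  have X: "X p q r s = (\<Sum>a\<in>UNIV. \<Sum>b\<in>UNIV. \<alpha> [e b, e a, e p, e q] * \<beta> [e b, e a, e r, e s])" for p q r s
    unfolding X_def matrix_matrix_mult_def pair_matrix_def
    by (simp add: sum_pairs four_form_permutes(4)[OF forms_polyform[OF assms(3)], of _ _ "e p" "e q"])
      (rule sum.swap)
  show ?thesis
    unfolding Delta2_orthonormal[OF assms(1,2) forms_polyform[OF assms(3)] forms_polyform[OF assms(4)]]
      wedge_2_2[OF i2[OF assms(3)] i2[OF assms(4)]]
    unfolding X interior_def
    by (simp add: sum.distrib sum_subtractf)
qed

lemma sum_exchange_slots:
  fixes f :: "8 \<Rightarrow> 8 \<Rightarrow> 8 \<Rightarrow> 8 \<Rightarrow> real"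
  shows "(\<Sum>i\<in>UNIV. \<Sum>j\<in>UNIV. \<Sum>k\<in>UNIV. \<Sum>l\<in>UNIV. f i j k l) = (\<Sum>i\<in>UNIV. \<Sum>j\<in>UNIV. \<Sum>k\<in>UNIV. \<Sum>l\<in>UNIV. f j i k l)"
    "(\<Sum>i\<in>UNIV. \<Sum>j\<in>UNIV. \<Sum>k\<in>UNIV. \<Sum>l\<in>UNIV. f i j k l) = (\<Sum>i\<in>UNIV. \<Sum>j\<in>UNIV. \<Sum>k\<in>UNIV. \<Sum>l\<in>UNIV. f i k j l)"
    "(\<Sum>i\<in>UNIV. \<Sum>j\<in>UNIV. \<Sum>k\<in>UNIV. \<Sum>l\<in>UNIV. f i j k l) = (\<Sum>i\<in>UNIV. \<Sum>j\<in>UNIV. \<Sum>k\<in>UNIV. \<Sum>l\<in>UNIV. f i j l k)"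
  by (rule sum.swap, (rule sum.cong[OF refl], rule sum.swap),
      (rule sum.cong[OF refl], rule sum.cong[OF refl], rule sum.swap))

text \<open>
  Against an alternating form, the six terms of \<open>Delta2_components\<close> contribute equally, because
  the permutation of the arguments can be moved to \<open>\<gamma>\<close>, whose sign compensates the one in front.
\<close>

lemma form_inner_Delta2:
  assumes "h \<in> Met" "orthonormal_basis h e" "\<alpha> \<in> forms 4" "\<beta> \<in> forms 4" "\<gamma> \<in> forms 4"
  shows "form_inner h (Delta2 h \<alpha> \<beta>) \<gamma> = trace (pair_matrix e \<alpha> ** pair_matrix e \<beta> ** pair_matrix e \<gamma>) / 8"
proof -
  let ?S = "\<lambda>f :: 8 \<Rightarrow> 8 \<Rightarrow> 8 \<Rightarrow> 8 \<Rightarrow> real. \<Sum>i\<in>UNIV. \<Sum>j\<in>UNIV. \<Sum>k\<in>UNIV. \<Sum>l\<in>UNIV. f i j k l"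
  define g where "g i j k l = \<gamma> [e i, e j, e k, e l]" for i j k l
  define X where "X i j k l = (pair_matrix e \<alpha> ** pair_matrix e \<beta>) $ (i, j) $ (k, l)" for i j k l
  have \<gamma>: "polyform \<gamma>" using assms(5) by (rule forms_polyform)
  note perm = four_form_swaps(2)[OF \<gamma>, of "e _" "e _" "e _" "e _", folded g_def]
    four_form_permutes[OF \<gamma>, of "e _" "e _" "e _" "e _", folded g_def]
  have s1: "?S (\<lambda>i j k l. X i k j l * g i j k l) = - ?S (\<lambda>i j k l. X i j k l * g i j k l)"
    by (subst sum_exchange_slots(2), unfold sum_negf[symmetric], intro sum.cong refl, subst perm(1), simp)
  have s2: "?S (\<lambda>i j k l. X i l j k * g i j k l) = ?S (\<lambda>i j k l. X i j k l * g i j k l)"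
    by (subst sum_exchange_slots(3), subst sum_exchange_slots(2), intro sum.cong refl, subst perm(2), simp)
  have s3: "?S (\<lambda>i j k l. X j k i l * g i j k l) = ?S (\<lambda>i j k l. X i j k l * g i j k l)"
    by (subst sum_exchange_slots(1), subst sum_exchange_slots(2), intro sum.cong refl, subst perm(3), simp)
  have s4: "?S (\<lambda>i j k l. X j l i k * g i j k l) = - ?S (\<lambda>i j k l. X i j k l * g i j k l)"
    by (subst sum_exchange_slots(1), subst sum_exchange_slots(3), subst sum_exchange_slots(2),
        unfold sum_negf[symmetric], intro sum.cong refl, subst perm(4), simp)
  have s5: "?S (\<lambda>i j k l. X k l i j * g i j k l) = ?S (\<lambda>i j k l. X i j k l * g i j k l)"
    by (subst sum_exchange_slots(2), subst sum_exchange_slots(1), subst sum_exchange_slots(3),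
        subst sum_exchange_slots(2), intro sum.cong refl, subst perm(5), simp)
  have "form_inner h (Delta2 h \<alpha> \<beta>) \<gamma>
    = ?S (\<lambda>i j k l. (X i j k l - X i k j l + X i l j k + X j k i l - X j l i k + X k l i j) / 2 * g i j k l) / 24"
    unfolding form_inner_orthonormal[OF assms(1,2) Delta2_forms[OF assms(1-4)] \<gamma>]
      Delta2_components[OF assms(1-4)] X_def g_def ..
  also have "?S (\<lambda>i j k l. (X i j k l - X i k j l + X i l j k + X j k i l - X j l i k + X k l i j) / 2 * g i j k l)
    = (?S (\<lambda>i j k l. X i j k l * g i j k l) - ?S (\<lambda>i j k l. X i k j l * g i j k l)
     + ?S (\<lambda>i j k l. X i l j k * g i j k l) + ?S (\<lambda>i j k l. X j k i l * g i j k l)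
     - ?S (\<lambda>i j k l. X j l i k * g i j k l) + ?S (\<lambda>i j k l. X k l i j * g i j k l)) / 2"
    by (simp add: sum.distrib sum_subtractf sum_divide_distrib[symmetric] ring_distribs add_divide_distrib diff_divide_distrib)
  also have "\<dots> = 3 * ?S (\<lambda>i j k l. X i j k l * g i j k l)"
    unfolding s1 s2 s3 s4 s5 by simp
  also have "?S (\<lambda>i j k l. X i j k l * g i j k l) = trace (pair_matrix e \<alpha> ** pair_matrix e \<beta> ** pair_matrix e \<gamma>)"
    unfolding trace_mult sum_pairs X_def g_def
    by (simp add: pair_matrix_def[of e \<gamma>] four_form_permutes(4)[OF \<gamma>])
  finally show ?thesis by simp
qed

text \<open>
  The potential, expressed through the matrix of the form in an orthonormal basis.
\<close>

definition trace_potential :: "real^'n^'n \<Rightarrow> real" where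
  "trace_potential A = sqrt 14 / 24 * trace (A ** A ** A) + 4 * (trace (A ** A) / 24) powr (3/2)"

lemma W_orthonormal:
  assumes "h \<in> Met" "orthonormal_basis h e" "\<Phi> \<in> forms 4"
  shows "W (h, \<Phi>) = trace_potential (pair_matrix e \<Phi>)"
  unfolding W_def trace_potential_def prod.case
    form_inner_Delta2[OF assms(1,2) assms(3,3,3)] form_inner_trace[OF assms(1,2) assms(3,3)]
  by simp

lemma form_inner_pos:
  assumes "h \<in> Met" "orthonormal_basis h e" "\<alpha> \<in> forms 4" "\<alpha> \<noteq> (\<lambda>_. 0)"
  shows "form_inner h \<alpha> \<alpha> > 0"
proof -
  have p: "polyform \<alpha>" using assms(3) by (rule forms_polyform)
  have e: "is_basis e" using assms(2) by (simp add: orthonormal_basis_def)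
  obtain i j k l where ne: "\<alpha> [e i, e j, e k, e l] \<noteq> 0"
  proof -
    obtain vs where vs: "\<alpha> vs \<noteq> 0" using assms(4) by auto
    then have "length vs = 4" using forms_length[OF assms(3)] by blast
    then obtain js where "length js = 4" "\<alpha> (map e js) \<noteq> 0"
      using polyform_eq_zero_on_basis[OF p e, of 4 vs] vs by blast
    then show thesis using that by (auto simp: eval_nat_numeral length_Suc_conv)
  qed
  have "0 < (\<Sum>i\<in>UNIV. \<Sum>j\<in>UNIV. \<Sum>k\<in>UNIV. \<Sum>l\<in>UNIV. \<alpha> [e i, e j, e k, e l] * \<alpha> [e i, e j, e k, e l])"
    by (rule sum_pos2[of _ i], simp, simp, rule sum_pos2[of _ j], simp, simp, rule sum_pos2[of _ k], simp, simp,
        rule sum_pos2[of _ l]) (use ne in \<open>auto intro!: sum_nonneg simp: zero_less_mult_iff\<close>)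
  then show ?thesis unfolding form_inner_orthonormal[OF assms(1,2,3) p] by simp
qed

lemma forms_add_scale:
  assumes "\<alpha> \<in> forms k" "\<beta> \<in> forms k"
  shows "(\<lambda>vs. a * \<alpha> vs + b * \<beta> vs) \<in> forms k"
proof -
  have "polyform (\<lambda>vs. \<Sum>i\<in>(UNIV :: bool set). (if i then a else b) * (if i then \<alpha> else \<beta>) vs)"
    using forms_polyform[OF assms(1)] forms_polyform[OF assms(2)] by (intro polyform_lincomb) auto
  then show ?thesis
    using forms_length[OF assms(1)] forms_length[OF assms(2)] by (simp add: forms_def UNIV_bool add.commute)
qed

lemma trace_line:
  fixes A B :: "real^'n^'n"
  shows "trace ((A + t *\<^sub>R B) ** (A + t *\<^sub>R B)) = trace (A ** A) + 2 * t * trace (A ** B) + t\<^sup>2 * trace (B ** B)"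
    and "trace ((A + t *\<^sub>R B) ** (A + t *\<^sub>R B) ** (A + t *\<^sub>R B))
      = trace (A ** A ** A) + 3 * t * trace (A ** A ** B) + 3 * t\<^sup>2 * trace (A ** B ** B) + t^3 * trace (B ** B ** B)"
proof -
  have sc: "(c *\<^sub>R B) ** C = c *\<^sub>R (B ** C)" "C ** (c *\<^sub>R B) = c *\<^sub>R (C ** B)"
    for c and B C :: "real^'n^'n"
    by (simp_all add: scalar_matrix_assoc matrix_scalar_ac flip: scalar_mult_eq_scaleR)
  have matrix_add_rdistrib: "(B + C) ** D = B ** D + C ** D" for B C D :: "real^'n^'n"
    by (simp add: vec_eq_iff matrix_matrix_mult_def distrib_right sum.distrib)
  have tr: "trace (c *\<^sub>R B) = c * trace B" for c and B :: "real^'n^'n"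
    by (simp add: trace_def sum_distrib_left)
  have cyc: "trace (B ** A) = trace (A ** B)" "trace (A ** B ** A) = trace (A ** A ** B)"
    "trace (B ** A ** A) = trace (A ** A ** B)" "trace (B ** A ** B) = trace (A ** B ** B)" "trace (B ** B ** A) = trace (A ** B ** B)"
    using trace_mul_sym[of B A] trace_mul_sym[of "A ** B" A] trace_mul_sym[of B "A ** A"]
      trace_mul_sym[of "B ** A" B] trace_mul_sym[of "B ** B" A]
    by (simp_all add: matrix_mul_assoc)
  show "trace ((A + t *\<^sub>R B) ** (A + t *\<^sub>R B)) = trace (A ** A) + 2 * t * trace (A ** B) + t\<^sup>2 * trace (B ** B)"
    by (simp add: matrix_add_ldistrib matrix_add_rdistrib sc tr trace_add cyc power2_eq_square algebra_simps)
  show "trace ((A + t *\<^sub>R B) ** (A + t *\<^sub>R B) ** (A + t *\<^sub>R B))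
      = trace (A ** A ** A) + 3 * t * trace (A ** A ** B) + 3 * t\<^sup>2 * trace (A ** B ** B) + t^3 * trace (B ** B ** B)"
    by (simp add: matrix_add_ldistrib matrix_add_rdistrib sc tr trace_add cyc power2_eq_square power3_eq_cube algebra_simps)
qed

text \<open>
  Since the cubic term is the trace of a cube, its derivative is three times the trace with one factor
  replaced, that is, a multiple of \<open>\<langle>\<Phi> \<Delta>\<^sub>2 \<Phi>, \<Psi>\<rangle>\<close>.
\<close>

lemma W_line_derivative:
  assumes "h \<in> Met" "orthonormal_basis h e" "\<Phi> \<in> forms 4" "\<Psi> \<in> forms 4" "\<Phi> \<noteq> (\<lambda>_. 0)"
  shows "((\<lambda>t. W (h, \<lambda>vs. \<Phi> vs + t * \<Psi> vs)) has_real_derivative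
     sqrt 14 * form_inner h (Delta2 h \<Phi> \<Phi>) \<Psi> + 12 * sqrt (form_inner h \<Phi> \<Phi>) * form_inner h \<Phi> \<Psi>) (at 0)"
proof -
  let ?A = "pair_matrix e \<Phi>" and ?B = "pair_matrix e \<Psi>"
  have pm: "pair_matrix e (\<lambda>vs. \<Phi> vs + t * \<Psi> vs) = ?A + t *\<^sub>R ?B" for t
    by (simp add: pair_matrix_def vec_eq_iff)
  have f: "(\<lambda>vs. \<Phi> vs + t * \<Psi> vs) \<in> forms 4" for t
    using forms_add_scale[OF assms(3,4), of 1 t] by simp
  have W: "W (h, \<lambda>vs. \<Phi> vs + t * \<Psi> vs) = trace_potential (?A + t *\<^sub>R ?B)" for t
    using W_orthonormal[OF assms(1,2) f] pm by simp
  have pos: "trace (?A ** ?A) / 24 > 0"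
    using form_inner_pos[OF assms(1,2,3,5)] form_inner_trace[OF assms(1,2,3,3)] by simp
  define p where "p t = sqrt 14 / 24 * trace ((?A + t *\<^sub>R ?B) ** (?A + t *\<^sub>R ?B) ** (?A + t *\<^sub>R ?B))" for t
  define q where "q t = trace ((?A + t *\<^sub>R ?B) ** (?A + t *\<^sub>R ?B)) / 24" for t
  have dp: "(p has_real_derivative sqrt 14 / 8 * trace (?A ** ?A ** ?B)) (at 0)"
    unfolding p_def trace_line by (auto intro!: derivative_eq_intros)
  have dq: "(q has_real_derivative trace (?A ** ?B) / 12) (at 0)"
    unfolding q_def trace_line by (auto intro!: derivative_eq_intros)
  have q0: "q 0 = trace (?A ** ?A) / 24" by (simp add: q_def)
  have "((\<lambda>t. q t powr (3/2)) has_real_derivative 3/2 * q 0 powr (1/2) * (trace (?A ** ?B) / 12)) (at 0)"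
    using DERIV_fun_powr[OF dq, of "3/2"] pos unfolding q0[symmetric] by simp
  from DERIV_add[OF dp DERIV_cmult[OF this, of 4]]
  have "((\<lambda>t. W (h, \<lambda>vs. \<Phi> vs + t * \<Psi> vs)) has_real_derivative
     sqrt 14 / 8 * trace (?A ** ?A ** ?B) + 4 * (3/2 * q 0 powr (1/2) * (trace (?A ** ?B) / 12))) (at 0)"
    unfolding W trace_potential_def p_def q_def .
  then show ?thesis
    unfolding q0 form_inner_Delta2[OF assms(1,2,3,3,4)] form_inner_trace[OF assms(1,2,3,3)] form_inner_trace[OF assms(1,2,3,4)]
    using pos by (simp add: powr_half_sqrt)
qed

section \<open>The potential in linear coordinates\<close>

text \<open>
  Cramer's rule, chosen as the definition because it makes the inverse of the Gram matrix manifestly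
  differentiable.
\<close>

definition gram_inverse :: "real^'n^'n \<Rightarrow> real^'n^'n" where
  "gram_inverse G = (\<chi> k i. det (\<chi> r c. if c = k then axis i 1 $ r else G $ r $ c) / det G)"

text \<open>
  The array of components of a four-form, arranged like \<open>pair_matrix\<close>.
\<close>

definition flatten :: "real^8^8^8^8 \<Rightarrow> real^(8 \<times> 8)^(8 \<times> 8)" where
  "flatten \<phi> = (\<chi> p q. \<phi> $ fst p $ snd p $ fst q $ snd q)"

text \<open>
  The tensor square of a matrix.
\<close>

definition pair_square :: "real^8^8 \<Rightarrow> real^(8 \<times> 8)^(8 \<times> 8)" where
  "pair_square H = (\<chi> p q. H $ fst p $ fst q * H $ snd p $ snd q)"

text \<open>
  The potential in an arbitrary basis. It is defined for all arrays, also those that are not symmetric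
  or alternating, so that it can be differentiated in the full coordinate space.
\<close>

definition coordinate_potential :: "(real^8^8) \<times> (real^8^8^8^8) \<Rightarrow> real" where
  "coordinate_potential y = trace_potential (flatten (snd y) ** pair_square (gram_inverse (fst y)))"

lemma gram_inverse_eq:
  fixes G H :: "real^'n^'n"
  assumes "G ** H = mat 1"
  shows "gram_inverse G = H" and "det G \<noteq> 0"
proof -
  have "det G * det H = 1" using assms by (simp flip: det_mul)
  then show d: "det G \<noteq> 0" by auto
  have "G *v column i H = axis i 1" for i
  proof -
    have "(G *v column i H) $ k = (G ** H) $ k $ i" for k
      by (simp add: matrix_vector_mult_def matrix_matrix_mult_def column_def)
    then show ?thesis using assms by (simp add: vec_eq_iff mat_def axis_def)
  qed
  from this[unfolded cramer[OF d]] have "column i H $ k = gram_inverse G $ k $ i" for i k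
    by (simp add: gram_inverse_def)
  then show "gram_inverse G = H" by (simp add: column_def vec_eq_iff)
qed

lemma pair_square_mult: "pair_square M ** pair_square N = pair_square (M ** N)"
  by (simp add: vec_eq_iff pair_square_def matrix_matrix_mult_def sum_pairs sum_product mult_ac)

lemma pair_square_transpose: "transpose (pair_square M) = pair_square (transpose M)"
  by (simp add: pair_square_def transpose_def)

lemma pair_matrix_basis_change:
  assumes "polyform \<alpha>" "\<And>j. e j = (\<Sum>i\<in>UNIV. (M $ i $ j) *\<^sub>R b i)"
  shows "pair_matrix e \<alpha> = transpose (pair_square M) ** pair_matrix b \<alpha> ** pair_square M"
proof -
  note ps = polyform_sum[OF assms(1), where f = b and A = UNIV]
  have slot: "\<alpha> [e i, x, y, z] = (\<Sum>a\<in>UNIV. M $ a $ i * \<alpha> [b a, x, y, z])"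
    "\<alpha> [x, e i, y, z] = (\<Sum>a\<in>UNIV. M $ a $ i * \<alpha> [x, b a, y, z])"
    "\<alpha> [x, y, e i, z] = (\<Sum>a\<in>UNIV. M $ a $ i * \<alpha> [x, y, b a, z])"
    "\<alpha> [x, y, z, e i] = (\<Sum>a\<in>UNIV. M $ a $ i * \<alpha> [x, y, z, b a])" for i x y z
    using ps[of "[]" "\<lambda>a. M $ a $ i" "[x, y, z]"] ps[of "[x]" "\<lambda>a. M $ a $ i" "[y, z]"]
      ps[of "[x, y]" "\<lambda>a. M $ a $ i" "[z]"] ps[of "[x, y, z]" "\<lambda>a. M $ a $ i" "[]"]
    by (simp_all flip: assms(2))
  have "\<alpha> [e i, e j, e k, e l] = (\<Sum>a\<in>UNIV. \<Sum>a'\<in>UNIV. \<Sum>c\<in>UNIV. \<Sum>c'\<in>UNIV.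
      M $ a $ i * M $ a' $ j * M $ c $ k * M $ c' $ l * \<alpha> [b a, b a', b c, b c'])" for i j k l
    unfolding slot(1) unfolding slot(2) unfolding slot(3) unfolding slot(4)
    by (simp add: sum_distrib_left mult.assoc)
  moreover have "(transpose (pair_square M) ** pair_matrix b \<alpha> ** pair_square M) $ (i, j) $ (k, l)
    = (\<Sum>c\<in>UNIV. \<Sum>c'\<in>UNIV. \<Sum>a\<in>UNIV. \<Sum>a'\<in>UNIV.
      M $ a $ i * M $ a' $ j * M $ c $ k * M $ c' $ l * \<alpha> [b a, b a', b c, b c'])" for i j k l
    by (simp add: matrix_matrix_mult_def pair_square_def pair_matrix_def transpose_def sum_pairs
        sum_distrib_left sum_distrib_right mult_ac)
  moreover have "(\<Sum>c\<in>UNIV. \<Sum>c'\<in>UNIV. \<Sum>a\<in>UNIV. \<Sum>a'\<in>UNIV. f a a' c c')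
      = (\<Sum>a\<in>UNIV. \<Sum>a'\<in>UNIV. \<Sum>c\<in>UNIV. \<Sum>c'\<in>UNIV. f a a' c c')" for f :: "8 \<Rightarrow> 8 \<Rightarrow> 8 \<Rightarrow> 8 \<Rightarrow> real"
  proof -
    have "(\<Sum>c\<in>UNIV. \<Sum>c'\<in>UNIV. \<Sum>a\<in>UNIV. \<Sum>a'\<in>UNIV. f a a' c c')
       = (\<Sum>p\<in>UNIV. \<Sum>q\<in>UNIV. f (fst q) (snd q) (fst p) (snd p))" by (simp add: sum_pairs)
    also have "\<dots> = (\<Sum>q\<in>UNIV. \<Sum>p\<in>UNIV. f (fst q) (snd q) (fst p) (snd p))" by (rule sum.swap)
    finally show ?thesis by (simp add: sum_pairs)
  qed
  ultimately show ?thesis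
    by (simp add: vec_eq_iff pair_matrix_def)
qed

text \<open>
  If \<open>M\<close> expresses an orthonormal basis in terms of \<open>b\<close>, then \<open>M M\<^sup>T\<close> is the inverse Gram matrix,
  and the cyclicity of the trace lets only this product appear. The two inequalities guarantee that the
  coordinate expression is differentiable: it involves a division by the determinant and a power with
  exponent \<open>3 / 2\<close> of the trace.
\<close>

lemma W_coordinates:
  assumes "h \<in> Met" "is_basis b" "\<Phi> \<in> forms 4"
  shows "W (h, \<Phi>) = coordinate_potential (components b (h, \<Phi>))"
    and "det (fst (components b (h, \<Phi>))) \<noteq> 0"
    and "\<Phi> \<noteq> (\<lambda>_. 0) \<Longrightarrow>
      trace ((flatten (snd (components b (h, \<Phi>))) ** pair_square (gram_inverse (fst (components b (h, \<Phi>)))))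
      ** (flatten (snd (components b (h, \<Phi>))) ** pair_square (gram_inverse (fst (components b (h, \<Phi>)))))) > 0"
proof -
  obtain e where e: "orthonormal_basis h e" using ex_orthonormal_basis[OF assms(1,2)] by blast
  obtain M :: "real^8^8" where M: "\<And>j. e j = (\<Sum>i\<in>UNIV. (M $ i $ j) *\<^sub>R b i)"
    using basis_change[OF assms(2), where e' = e] by blast
  define G where "G = fst (components b (h, \<Phi>))"
  have G: "G $ i $ j = h (b i) (b j)" for i j by (simp add: G_def components_def)
  define P where "P = flatten (snd (components b (h, \<Phi>)))"
  have P: "P = pair_matrix b \<Phi>" by (simp add: P_def components_def flatten_def pair_matrix_def)
  have "(transpose M ** (G ** M)) $ i $ j = h (e i) (e j)" for i j
    unfolding M bilinear_lincomb_left[OF Met_bilinear[OF assms(1)]]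
    by (simp add: bilinear_lincomb_right[OF Met_bilinear[OF assms(1)]] matrix_matrix_mult_def transpose_def G
        sum_distrib_left mult_ac)
  then have "transpose M ** (G ** M) = mat 1"
    using e by (simp add: vec_eq_iff mat_def orthonormal_basis_def)
  then have "(G ** M) ** transpose M = mat 1"
    using matrix_left_right_inverse by blast
  then have GM: "G ** (M ** transpose M) = mat 1"
    by (simp add: matrix_mul_assoc)
  note H = gram_inverse_eq[OF GM]
  show "det (fst (components b (h, \<Phi>))) \<noteq> 0" using H(2) by (simp add: G_def)
  let ?N = "pair_square M"
  have K: "pair_square (gram_inverse G) = ?N ** transpose ?N"
    by (simp add: H(1) pair_square_mult pair_square_transpose)
  have A: "pair_matrix e \<Phi> = transpose ?N ** P ** ?N"
    unfolding P by (rule pair_matrix_basis_change[OF forms_polyform[OF assms(3)] M])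
  have t2: "trace (pair_matrix e \<Phi> ** pair_matrix e \<Phi>)
      = trace ((P ** pair_square (gram_inverse G)) ** (P ** pair_square (gram_inverse G)))"
    unfolding A K using trace_mul_sym[of "transpose ?N" "P ** ?N ** transpose ?N ** P ** ?N"]
    by (simp add: matrix_mul_assoc)
  have t3: "trace (pair_matrix e \<Phi> ** pair_matrix e \<Phi> ** pair_matrix e \<Phi>)
      = trace ((P ** pair_square (gram_inverse G)) ** (P ** pair_square (gram_inverse G)) ** (P ** pair_square (gram_inverse G)))"
    unfolding A K
    using trace_mul_sym[of "transpose ?N" "P ** ?N ** transpose ?N ** P ** ?N ** transpose ?N ** P ** ?N"]
    by (simp add: matrix_mul_assoc)
  show "W (h, \<Phi>) = coordinate_potential (components b (h, \<Phi>))"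
    unfolding W_orthonormal[OF assms(1) e assms(3)] coordinate_potential_def trace_potential_def t2 t3
    by (simp add: G_def P_def)
  show "trace ((flatten (snd (components b (h, \<Phi>))) ** pair_square (gram_inverse (fst (components b (h, \<Phi>)))))
      ** (flatten (snd (components b (h, \<Phi>))) ** pair_square (gram_inverse (fst (components b (h, \<Phi>)))))) > 0"
    if "\<Phi> \<noteq> (\<lambda>_. 0)"
    using form_inner_pos[OF assms(1) e assms(3) that] form_inner_trace[OF assms(1) e assms(3,3)] t2
    by (simp add: G_def P_def)
qed

lemma differentiable_prod_family:
  assumes "finite A" "\<And>i. i \<in> A \<Longrightarrow> (\<lambda>x. f i x :: real) differentiable at x"
  shows "(\<lambda>x. \<Prod>i\<in>A. f i x) differentiable at x"
  using assms by (induction A rule: finite_induct) auto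

lemma differentiable_det:
  fixes A :: "'a::real_normed_vector \<Rightarrow> real^'n^'n"
  assumes "\<And>i j. (\<lambda>x. A x $ i $ j) differentiable at x"
  shows "(\<lambda>x. det (A x)) differentiable at x"
  unfolding det_def using assms
  by (intro differentiable_sum differentiable_mult differentiable_const ballI differentiable_prod_family) auto

lemma differentiable_matrix_mult:
  fixes A B :: "'a::real_normed_vector \<Rightarrow> real^'n^'n"
  assumes "\<And>i j. (\<lambda>x. A x $ i $ j) differentiable at x" "\<And>i j. (\<lambda>x. B x $ i $ j) differentiable at x"
  shows "(\<lambda>x. (A x ** B x) $ i $ j) differentiable at x"
  using assms by (simp add: matrix_matrix_mult_def)

lemma differentiable_trace:
  fixes A :: "'a::real_normed_vector \<Rightarrow> real^'n^'n"
  assumes "\<And>i j. (\<lambda>x. A x $ i $ j) differentiable at x"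
  shows "(\<lambda>x. trace (A x)) differentiable at x"
  using assms by (simp add: trace_def)

lemma differentiable_powr_const:
  fixes f :: "'a::real_normed_vector \<Rightarrow> real"
  assumes "f differentiable at x" "f x > 0"
  shows "(\<lambda>x. f x powr r) differentiable at x"
proof -
  obtain D where D: "(f has_derivative D) (at x)" using assms(1) by (auto simp: differentiable_def)
  show ?thesis
    using has_derivative_powr[OF D has_derivative_const assms(2), of r] by (auto simp: differentiable_def)
qed

lemma differentiable_trace_potential:
  fixes A :: "'a::real_normed_vector \<Rightarrow> real^'n^'n"
  assumes "\<And>i j. (\<lambda>x. A x $ i $ j) differentiable at x" "trace (A x ** A x) > 0"
  shows "(\<lambda>x. trace_potential (A x)) differentiable at x"
  unfolding trace_potential_def using assms
  by (intro differentiable_add differentiable_mult differentiable_const differentiable_powr_const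
      differentiable_divide differentiable_trace differentiable_matrix_mult) auto

lemma differentiable_coordinate_potential:
  assumes "det (fst x) \<noteq> 0"
    and "trace ((flatten (snd x) ** pair_square (gram_inverse (fst x))) ** (flatten (snd x) ** pair_square (gram_inverse (fst x)))) > 0"
  shows "coordinate_potential differentiable at x"
proof -
  have G: "(\<lambda>y :: (real^8^8) \<times> (real^8^8^8^8). fst y $ i $ j) differentiable at x" for i j
    by (intro bounded_linear_imp_differentiable bounded_linear_compose[OF bounded_linear_vec_nth] bounded_linear_fst)
  have \<phi>: "(\<lambda>y :: (real^8^8) \<times> (real^8^8^8^8). snd y $ i $ j $ k $ l) differentiable at x" for i j k l
    by (intro bounded_linear_imp_differentiable bounded_linear_compose[OF bounded_linear_vec_nth] bounded_linear_snd)
  have H: "(\<lambda>y :: (real^8^8) \<times> (real^8^8^8^8). gram_inverse (fst y) $ k $ i) differentiable at x" for k i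
  proof -
    have "(\<lambda>y :: (real^8^8) \<times> (real^8^8^8^8). if c = k then axis i 1 $ r else fst y $ r $ c) differentiable at x" for r c
      using G by (cases "c = k") simp_all
    then show ?thesis
      unfolding gram_inverse_def using assms(1) G by (auto intro!: differentiable_divide differentiable_det)
  qed
  show ?thesis
    unfolding coordinate_potential_def
    by (rule differentiable_trace_potential, rule differentiable_matrix_mult)
      (use H \<phi> assms(2) in \<open>auto simp: flatten_def pair_square_def\<close>)
qed

lemma components_inj:
  assumes "is_basis b"
  shows "inj_on (components b) (Met \<times> forms 4)"
proof (rule inj_onI, safe)
  fix h h' :: "'a \<Rightarrow> 'a \<Rightarrow> real" and \<Phi> \<Phi>' :: "'a list \<Rightarrow> real"
  assume *: "h \<in> Met" "h' \<in> Met" "\<Phi> \<in> forms 4" "\<Phi>' \<in> forms 4" "components b (h, \<Phi>) = components b (h', \<Phi>')"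
  have hb: "h (b i) (b j) = h' (b i) (b j)" for i j
    using *(5) by (simp add: components_def vec_eq_iff)
  show "h = h'"
  proof (intro ext)
    fix v w
    obtain c d where "v = (\<Sum>i\<in>UNIV. c i *\<^sub>R b i)" "w = (\<Sum>i\<in>UNIV. d i *\<^sub>R b i)"
      using basis_coords[OF assms] by metis
    then show "h v w = h' v w"
      by (simp add: bilinear_lincomb_left[OF Met_bilinear] bilinear_lincomb_right[OF Met_bilinear] *(1,2) hb)
  qed
  have d: "(\<lambda>vs. 1 * \<Phi> vs + (-1) * \<Phi>' vs) \<in> forms 4" by (rule forms_add_scale[OF *(3,4)])
  have \<Phi>b: "\<Phi> [b i, b j, b k, b l] = \<Phi>' [b i, b j, b k, b l]" for i j k l
    using *(5) by (simp add: components_def vec_eq_iff)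
  show "\<Phi> = \<Phi>'"
  proof
    fix vs
    have "1 * \<Phi> vs + (-1) * \<Phi>' vs = 0"
    proof (cases "length vs = 4")
      case True
      have "1 * \<Phi> (map b js) + (-1) * \<Phi>' (map b js) = 0" if "length js = 4" for js
        using that \<Phi>b by (auto simp: eval_nat_numeral length_Suc_conv)
      from polyform_eq_zero_on_basis[OF forms_polyform[OF d] assms this True] show ?thesis by simp
    qed (use forms_length[OF *(3)] forms_length[OF *(4)] in simp)
    then show "\<Phi> vs = \<Phi>' vs" by simp
  qed
qed

section \<open>Critical points\<close>

lemma components_line:
  "components b (h, \<lambda>vs. \<Phi> vs + t * \<Psi> vs)
    = components b (h, \<Phi>) + t *\<^sub>R (0, \<chi> i j k l. \<Psi> [b i, b j, b k, b l])"
  by (simp add: components_def vec_eq_iff)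

text \<open>
  Restriction of the vanishing derivative to a line of forms with the metric fixed.
\<close>

lemma critical_point_form_equation:
  assumes "h \<in> Met" "orthonormal_basis h e" "\<Phi> \<in> forms 4" "\<Psi> \<in> forms 4" "\<Phi> \<noteq> (\<lambda>_. 0)"
    and "critical_point W (h, \<Phi>)"
  shows "sqrt 14 * form_inner h (Delta2 h \<Phi> \<Phi>) \<Psi> + 12 * sqrt (form_inner h \<Phi> \<Phi>) * form_inner h \<Phi> \<Psi> = 0"
proof -
  let ?S = "components e ` (Met \<times> forms 4)" and ?x = "components e (h, \<Phi>)"
  let ?F = "W \<circ> inv_into (Met \<times> forms 4) (components e)"
  have e: "is_basis e" using assms(2) by (simp add: orthonormal_basis_def)
  define \<psi> :: "(real^8^8) \<times> (real^8^8^8^8)" where "\<psi> = (0, \<chi> i j k l. \<Psi> [e i, e j, e k, e l])"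
  have f: "(\<lambda>vs. \<Phi> vs + t * \<Psi> vs) \<in> forms 4" for t
    using forms_add_scale[OF assms(3,4), of 1 t] by simp
  have F: "?F (?x + t *\<^sub>R \<psi>) = W (h, \<lambda>vs. \<Phi> vs + t * \<Psi> vs)" for t
    using inv_into_f_f[OF components_inj[OF e], of "(h, \<lambda>vs. \<Phi> vs + t * \<Psi> vs)"] f assms(1)
    by (simp add: components_line \<psi>_def)
  have sub: "range (\<lambda>t. ?x + t *\<^sub>R \<psi>) \<subseteq> ?S"
  proof (rule image_subsetI)
    fix t :: real
    show "?x + t *\<^sub>R \<psi> \<in> ?S"
      using f assms(1) by (intro image_eqI[of _ _ "(h, \<lambda>vs. \<Phi> vs + t * \<Psi> vs)"]) (simp_all add: components_line \<psi>_def)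
  qed
  have "(?F has_derivative (\<lambda>_. 0)) (at (?x + 0 *\<^sub>R \<psi>) within ?S)"
    using assms(6) e by (simp add: critical_point_def)
  then have "(?F has_derivative (\<lambda>_. 0)) (at (?x + 0 *\<^sub>R \<psi>) within range (\<lambda>t. ?x + t *\<^sub>R \<psi>))"
    using sub by (rule has_derivative_subset)
  moreover have "((\<lambda>t. ?x + t *\<^sub>R \<psi>) has_derivative (\<lambda>t. t *\<^sub>R \<psi>)) (at 0)"
    by (auto intro!: derivative_eq_intros)
  ultimately have "((\<lambda>t. ?F (?x + t *\<^sub>R \<psi>)) has_derivative (\<lambda>t. 0)) (at 0)"
    using has_derivative_in_compose[of "\<lambda>t. ?x + t *\<^sub>R \<psi>" "\<lambda>t. t *\<^sub>R \<psi>" 0 UNIV ?F "\<lambda>_. 0"] by simp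
  then have "((\<lambda>t. W (h, \<lambda>vs. \<Phi> vs + t * \<Psi> vs)) has_real_derivative 0) (at 0)"
    unfolding F has_field_derivative_def lambda_zero .
  from DERIV_unique[OF W_line_derivative[OF assms(1-5)] this] show ?thesis .
qed

lemma polyform_pullback:
  assumes "linear f" "polyform \<alpha>"
  shows "polyform (pullback f \<alpha>)"
proof (rule polyformI)
  fix us ws
  show "linear (\<lambda>v. pullback f \<alpha> (us @ v # ws))"
    using linear_compose[OF assms(1) polyform_linear[OF assms(2), of "map f us" "map f ws"]]
    by (simp add: pullback_def comp_def)
qed (auto simp: pullback_def distinct_map intro!: polyform_repeat[OF assms(2)])

lemma forms_pullback:
  assumes "linear f" "\<alpha> \<in> forms k"
  shows "pullback f \<alpha> \<in> forms k"
  using polyform_pullback[OF assms(1) forms_polyform[OF assms(2)]] forms_length[OF assms(2)]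
  by (simp add: forms_def pullback_def)

lemma four_form_line:
  assumes "polyform \<Phi>"
  shows "\<Phi> [a + t *\<^sub>R a', b + t *\<^sub>R b', c + t *\<^sub>R c', d + t *\<^sub>R d'] = \<Phi> [a, b, c, d]
      + t * (\<Phi> [a', b, c, d] + \<Phi> [a, b', c, d] + \<Phi> [a, b, c', d] + \<Phi> [a, b, c, d'])
      + t\<^sup>2 * (\<Phi> [a', b', c, d] + \<Phi> [a', b, c', d] + \<Phi> [a', b, c, d'] + \<Phi> [a, b', c', d]
        + \<Phi> [a, b', c, d'] + \<Phi> [a, b, c', d'])
      + t^3 * (\<Phi> [a, b', c', d'] + \<Phi> [a', b, c', d'] + \<Phi> [a', b', c, d'] + \<Phi> [a', b', c', d])
      + t^4 * \<Phi> [a', b', c', d']"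
proof -
  note lin = polyform_linear[OF assms, of "[]", simplified] polyform_linear[OF assms, of "[_]", simplified]
    polyform_linear[OF assms, of "[_, _]", simplified] polyform_linear[OF assms, of "[_, _, _]", simplified]
  show ?thesis
    by (simp add: lin[THEN linear_add] lin[THEN linear_scale])
      (simp add: algebra_simps power2_eq_square power3_eq_cube power4_eq_xxxx)
qed

text \<open>
  The derivation that \<open>L\<close> induces on four-forms is the coefficient of \<open>t\<close> in the pullback of \<open>\<Phi>\<close>
  by \<open>1 + t L\<close>, a polynomial of degree four in \<open>t\<close>. Writing this coefficient as a linear combination of
  pullbacks, by interpolation at \<open>\<plusminus>1\<close> and \<open>\<plusminus>2\<close>, shows without further computation that it is
  alternating.
\<close>

lemma ex_infinitesimal_pullback:
  assumes "linear L" "\<Phi> \<in> forms 4"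
  shows "\<exists>\<Psi>\<in>forms 4. \<forall>a b c d.
    \<Psi> [a, b, c, d] = \<Phi> [L a, b, c, d] + \<Phi> [a, L b, c, d] + \<Phi> [a, b, L c, d] + \<Phi> [a, b, c, L d]"
proof -
  define P where "P t = pullback (\<lambda>v. v + t *\<^sub>R L v) \<Phi>" for t :: real
  have "linear (\<lambda>v. v + t *\<^sub>R L v)" for t
    by (intro linear_compose_add linear_id[unfolded id_def] linear_compose_scale_right assms(1))
  then have P: "P t \<in> forms 4" for t unfolding P_def by (intro forms_pullback assms(2))
  \<comment> \<open>The coefficients of the central difference formula that is exact for polynomials of degree four.\<close>
  let ?\<Psi> = "\<lambda>vs. 1 * ((2/3) * P 1 vs + (-2/3) * P (-1) vs) + 1 * ((-1/12) * P 2 vs + (1/12) * P (-2) vs)"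
  have form: "?\<Psi> \<in> forms 4" by (intro forms_add_scale P)
  note four = four_form_line[OF forms_polyform[OF assms(2)]]
  have eq: "?\<Psi> [a, b, c, d] = \<Phi> [L a, b, c, d] + \<Phi> [a, L b, c, d] + \<Phi> [a, b, L c, d] + \<Phi> [a, b, c, L d]"
    for a b c d
  proof -
    have P4: "P t [a, b, c, d] = \<Phi> [a, b, c, d]
      + t * (\<Phi> [L a, b, c, d] + \<Phi> [a, L b, c, d] + \<Phi> [a, b, L c, d] + \<Phi> [a, b, c, L d])
      + t\<^sup>2 * (\<Phi> [L a, L b, c, d] + \<Phi> [L a, b, L c, d] + \<Phi> [L a, b, c, L d] + \<Phi> [a, L b, L c, d]
        + \<Phi> [a, L b, c, L d] + \<Phi> [a, b, L c, L d])
      + t^3 * (\<Phi> [a, L b, L c, L d] + \<Phi> [L a, b, L c, L d] + \<Phi> [L a, L b, c, L d] + \<Phi> [L a, L b, L c, d])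
      + t^4 * \<Phi> [L a, L b, L c, L d]" for t
      unfolding P_def pullback_def list.map by (rule four)
    show ?thesis unfolding P4 by (simp add: field_simps)
  qed
  show ?thesis by (rule bexI[OF _ form], intro allI, rule eq)
qed

lemma is_basis_change:
  assumes "is_basis e" "\<And>j. e' j = (\<Sum>i\<in>UNIV. (M $ i $ j) *\<^sub>R e i)" "det M \<noteq> 0"
  shows "is_basis e'"
proof -
  from assms(3) obtain N where N: "M ** N = mat 1" "N ** M = mat 1"
    using invertible_det_nz[of M] unfolding invertible_def by blast
  have lc: "(\<Sum>j\<in>UNIV. c j *\<^sub>R e' j) = (\<Sum>i\<in>UNIV. (M *v (\<chi> j. c j)) $ i *\<^sub>R e i)" for c
    unfolding assms(2) real_vector.scale_sum_right
    by (subst sum.swap) (simp add: matrix_vector_mult_def real_vector.scale_sum_left mult.commute)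
  show ?thesis
  proof (rule is_basisI)
    fix c assume "(\<Sum>j\<in>UNIV. c j *\<^sub>R e' j) = 0"
    then have "(\<Sum>i\<in>UNIV. (M *v (\<chi> j. c j)) $ i *\<^sub>R e i) = (\<Sum>i\<in>UNIV. 0 *\<^sub>R e i)" using lc by simp
    from basis_coords_unique[OF assms(1) this] have "M *v (\<chi> j. c j) = 0" by (simp add: vec_eq_iff)
    then have "N *v (M *v (\<chi> j. c j)) = 0" by simp
    then have "(\<chi> j. c j) = (0 :: real^8)" by (simp add: matrix_vector_mul_assoc N)
    then show "c = (\<lambda>_. 0)" by (simp add: vec_eq_iff fun_eq_iff)
  next
    fix v
    obtain c where c: "v = (\<Sum>i\<in>UNIV. c i *\<^sub>R e i)" using basis_coords[OF assms(1)] .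
    have "M *v (N *v (\<chi> i. c i)) = (\<chi> i. c i)" by (simp add: matrix_vector_mul_assoc N)
    then have "v = (\<Sum>j\<in>UNIV. (N *v (\<chi> i. c i)) $ j *\<^sub>R e' j)"
      unfolding lc c by simp
    then show "\<exists>c. v = (\<Sum>j\<in>UNIV. c j *\<^sub>R e' j)" by blast
  qed
qed

lemma eventually_basis_deformation:
  assumes "is_basis b"
  shows "\<forall>\<^sub>F t in at 0. is_basis (\<lambda>j. b j + t *\<^sub>R L (b j))"
proof -
  obtain B :: "real^8^8" where B: "\<And>j. L (b j) = (\<Sum>i\<in>UNIV. (B $ i $ j) *\<^sub>R b i)"
    using basis_change[OF assms, where e' = "\<lambda>j. L (b j)"] by blast
  define M where "M t = mat 1 + t *\<^sub>R B" for t :: real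
  have "(\<lambda>t. det (M t)) differentiable at 0"
    by (rule differentiable_det) (auto simp: M_def)
  then have "isCont (\<lambda>t. det (M t)) 0" by (rule differentiable_imp_continuous_within)
  then have "(\<lambda>t. det (M t)) \<midarrow>0\<rightarrow> 1" by (simp add: isCont_def M_def det_I)
  then have "\<forall>\<^sub>F t in at 0. det (M t) \<noteq> 0"
    by (rule tendsto_imp_eventually_ne) simp
  then show ?thesis
  proof eventually_elim
    case (elim t)
    show ?case
    proof (rule is_basis_change[OF assms _ elim])
      fix j
      have "(\<Sum>i\<in>UNIV. M t $ i $ j *\<^sub>R b i) = (\<Sum>i\<in>UNIV. (if i = j then b i else 0) + t *\<^sub>R B $ i $ j *\<^sub>R b i)"
        by (intro sum.cong) (auto simp: M_def mat_def scaleR_add_left)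
      then show "b j + t *\<^sub>R L (b j) = (\<Sum>i\<in>UNIV. M t $ i $ j *\<^sub>R b i)"
        by (simp add: sum.distrib B real_vector.scale_sum_right)
    qed
  qed
qed

text \<open>
  A derivative within a set is tested only on differences of points of the set.
\<close>

lemma has_derivative_within_cong_zero:
  assumes "(F has_derivative D) (at x within S)" "\<And>y. y \<in> S \<Longrightarrow> D (y - x) = 0"
  shows "(F has_derivative (\<lambda>_. 0)) (at x within S)"
proof -
  have "((\<lambda>y. (1 / norm (y - x)) *\<^sub>R (F y - (F x + D (y - x)))) \<longlongrightarrow> 0) (at x within S)"
    using assms(1) by (simp add: has_derivative_within)
  then have "((\<lambda>y. (1 / norm (y - x)) *\<^sub>R (F y - (F x + 0))) \<longlongrightarrow> 0) (at x within S)"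
    by (rule Lim_transform_within[of _ _ _ _ 1]) (use assms(2) in auto)
  then show ?thesis by (simp add: has_derivative_within)
qed

lemma has_derivative_vec_lambda:
  fixes f :: "'n::finite \<Rightarrow> 'a::real_normed_vector \<Rightarrow> 'b::real_normed_vector"
  assumes "\<And>i. (f i has_derivative f' i) F"
  shows "((\<lambda>x. \<chi> i. f i x) has_derivative (\<lambda>y. \<chi> i. f' i y)) F"
proof -
  define P :: "'n \<Rightarrow> 'b \<Rightarrow> 'b^'n" where "P i y = (\<chi> j. if j = i then y else 0)" for i y
  have bl: "bounded_linear (P i)" for i
  proof (rule bounded_linear_intro[where K = 1])
    fix y :: 'b
    have "norm (P i y) \<le> (\<Sum>j\<in>UNIV. norm (P i y $ j))"
      unfolding norm_vec_def by (rule L2_set_le_sum) simp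
    also have "\<dots> = (\<Sum>j\<in>UNIV. if j = i then norm y else 0)" by (intro sum.cong) (auto simp: P_def)
    finally show "norm (P i y) \<le> norm y * 1" by simp
  qed (auto simp: P_def vec_eq_iff)
  have "((\<lambda>x. \<Sum>i\<in>UNIV. P i (f i x)) has_derivative (\<lambda>y. \<Sum>i\<in>UNIV. P i (f' i y))) F"
    by (rule has_derivative_sum) (rule bounded_linear.has_derivative[OF bl assms])
  moreover have "(\<Sum>i\<in>UNIV. P i (g i)) = (\<chi> i. g i)" for g
    by (simp add: vec_eq_iff P_def)
  ultimately show ?thesis by simp
qed

text \<open>
  The derivative \<open>D\<close> of the coordinate expression has to vanish on symmetric and alternating
  variations. On forms this is the hypothesis. For a symmetric bilinear form \<open>k\<close>, choose \<open>L\<close> with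
  \<open>h (L v) w = k v w / 2\<close> and move the basis instead of the point: the components of \<open>(h, \<Phi>)\<close> with
  respect to \<open>b + t L b\<close> trace a curve with initial velocity \<open>(k, \<Psi>)\<close>, where \<open>\<Psi>\<close> is the
  infinitesimal pullback, and the coordinate expression is constant along it. Thus
  \<open>D (k, \<Psi>) = 0\<close>, and \<open>D (k, 0) = 0\<close> follows.
\<close>

lemma critical_pointI:
  assumes "h \<in> Met" "\<Phi> \<in> forms 4" "\<Phi> \<noteq> (\<lambda>_. 0)"
    and crit: "\<And>\<Psi>. \<Psi> \<in> forms 4 \<Longrightarrow>
      sqrt 14 * form_inner h (Delta2 h \<Phi> \<Phi>) \<Psi> + 12 * sqrt (form_inner h \<Phi> \<Phi>) * form_inner h \<Phi> \<Psi> = 0"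
  shows "critical_point W (h, \<Phi>)"
  unfolding critical_point_def
proof (intro allI impI)
  fix b :: "8 \<Rightarrow> 'a" assume b: "is_basis b"
  let ?S = "components b ` (Met \<times> forms 4)" and ?x = "components b (h, \<Phi>)"
  obtain e where e: "orthonormal_basis h e" using ex_orthonormal_basis[OF assms(1) b] by blast
  note coord = W_coordinates[OF _ b]
  obtain D where D: "(coordinate_potential has_derivative D) (at ?x)"
    using differentiable_coordinate_potential[OF coord(2)[OF assms(1,2)] coord(3)[OF assms(1,2,3)]]
    by (auto simp: differentiable_def)
  have linD: "linear D" using D by (rule has_derivative_linear)
  have D_form: "D (0, \<chi> i j k l. \<Psi> [b i, b j, b k, b l]) = 0" if "\<Psi> \<in> forms 4" for \<Psi>
  proof -
    define \<psi> :: "(real^8^8) \<times> (real^8^8^8^8)" where "\<psi> = (0, \<chi> i j k l. \<Psi> [b i, b j, b k, b l])"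
    have f: "(\<lambda>vs. \<Phi> vs + t * \<Psi> vs) \<in> forms 4" for t
      using forms_add_scale[OF assms(2) that, of 1 t] by simp
    have W: "W (h, \<lambda>vs. \<Phi> vs + t * \<Psi> vs) = coordinate_potential (?x + t *\<^sub>R \<psi>)" for t
      using coord(1)[OF assms(1) f] by (simp add: components_line \<psi>_def)
    have "((\<lambda>t. ?x + t *\<^sub>R \<psi>) has_derivative (\<lambda>t. t *\<^sub>R \<psi>)) (at 0)"
      by (auto intro!: derivative_eq_intros)
    from has_derivative_compose[OF this, of coordinate_potential D] D
    have "((\<lambda>t. W (h, \<lambda>vs. \<Phi> vs + t * \<Psi> vs)) has_derivative (\<lambda>t. D (t *\<^sub>R \<psi>))) (at 0)"
      unfolding W by simp
    then have "((\<lambda>t. W (h, \<lambda>vs. \<Phi> vs + t * \<Psi> vs)) has_real_derivative D \<psi>) (at 0)"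
      unfolding has_field_derivative_def by (simp add: linear_scale[OF linD] mult_commute_abs)
    from DERIV_unique[OF this W_line_derivative[OF assms(1) e assms(2) that assms(3)]]
    show ?thesis using crit[OF that] by (simp add: \<psi>_def)
  qed
  have D_metric: "D (\<chi> i j. k (b i) (b j), 0) = 0" if k: "bilinear k" "\<And>v w. k v w = k w v" for k
  proof -
    define L where "L v = (\<Sum>i\<in>UNIV. (k v (e i) / 2) *\<^sub>R e i)" for v
    have linL: "linear L"
      unfolding L_def using k(1)
      by (intro linearI) (simp_all add: bilinear_ladd bilinear_lmul add_divide_distrib scaleR_add_left sum.distrib real_vector.scale_sum_right)
    have hL: "h (L v) w = k v w / 2" for v w
    proof -
      have "k v w = k v (\<Sum>i\<in>UNIV. h w (e i) *\<^sub>R e i)"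
        by (simp flip: orthonormal_expansion[OF assms(1) e])
      also have "\<dots> = (\<Sum>i\<in>UNIV. h w (e i) * k v (e i))"
        by (rule bilinear_lincomb_right[OF k(1)])
      finally show ?thesis
        by (simp add: L_def bilinear_lincomb_left[OF Met_bilinear[OF assms(1)]] Met_sym[OF assms(1), of "e _" w]
            sum_divide_distrib mult.commute)
    qed
    obtain \<Psi> where \<Psi>: "\<Psi> \<in> forms 4"
      "\<And>a b c d. \<Psi> [a, b, c, d] = \<Phi> [L a, b, c, d] + \<Phi> [a, L b, c, d] + \<Phi> [a, b, L c, d] + \<Phi> [a, b, c, L d]"
      using ex_infinitesimal_pullback[OF linL assms(2)] by blast
    define c where "c t = components (\<lambda>j. b j + t *\<^sub>R L (b j)) (h, \<Phi>)" for t :: real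
    let ?v = "(\<chi> i j. k (b i) (b j), \<chi> i j k l. \<Psi> [b i, b j, b k, b l]) :: (real^8^8) \<times> (real^8^8^8^8)"
    have dh: "((\<lambda>t. h (v + t *\<^sub>R L v) (w + t *\<^sub>R L w)) has_derivative (\<lambda>t. t * k v w)) (at 0)" for v w
    proof -
      have k_eq: "k v w = h (L v) w + h v (L w)"
        using hL[of v w] hL[of w v] k(2)[of v w] Met_sym[OF assms(1), of v "L w"] by simp
      have eq: "h (v + t *\<^sub>R L v) (w + t *\<^sub>R L w) = h v w + t * k v w + t\<^sup>2 * h (L v) (L w)" for t
        using Met_bilinear[OF assms(1)] unfolding k_eq
        by (simp add: bilinear_ladd bilinear_radd bilinear_lmul bilinear_rmul power2_eq_square algebra_simps)
      show ?thesis unfolding eq by (auto intro!: derivative_eq_intros)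
    qed
    have d\<Phi>: "((\<lambda>t. \<Phi> [p + t *\<^sub>R L p, q + t *\<^sub>R L q, r + t *\<^sub>R L r, s + t *\<^sub>R L s]) has_derivative
        (\<lambda>t. t * \<Psi> [p, q, r, s])) (at 0)" for p q r s
      unfolding \<Psi>(2) four_form_line[OF forms_polyform[OF assms(2)]]
      by (auto intro!: derivative_eq_intros)
    have "((\<lambda>t. (\<chi> i j. h (b i + t *\<^sub>R L (b i)) (b j + t *\<^sub>R L (b j)),
        \<chi> i j k l. \<Phi> [b i + t *\<^sub>R L (b i), b j + t *\<^sub>R L (b j), b k + t *\<^sub>R L (b k), b l + t *\<^sub>R L (b l)]))
      has_derivative (\<lambda>t. (\<chi> i j. t * k (b i) (b j), \<chi> i j k l. t * \<Psi> [b i, b j, b k, b l]))) (at 0)"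
      by (intro has_derivative_Pair has_derivative_vec_lambda dh d\<Phi>)
    moreover have "(\<chi> i j. t * k (b i) (b j), \<chi> i j k l. t * \<Psi> [b i, b j, b k, b l]) = t *\<^sub>R ?v" for t
      by (simp add: vec_eq_iff)
    ultimately have dc: "(c has_derivative (\<lambda>t. t *\<^sub>R ?v)) (at 0)"
      unfolding c_def components_def by simp
    have c0: "c 0 = ?x" by (simp add: c_def)
    have "(coordinate_potential has_derivative D) (at (c 0))" using D c0 by simp
    from has_derivative_compose[OF dc this]
    have "((\<lambda>t. W (h, \<Phi>)) has_derivative (\<lambda>t. D (t *\<^sub>R ?v))) (at 0)"
    proof (rule has_derivative_transform_eventually)
      show "\<forall>\<^sub>F t in at 0. coordinate_potential (c t) = W (h, \<Phi>)"
        using eventually_basis_deformation[OF b, of L]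
        by eventually_elim (simp add: c_def W_coordinates(1)[OF assms(1) _ assms(2)])
      show "coordinate_potential (c 0) = W (h, \<Phi>)" by (simp only: c0 coord(1)[OF assms(1,2)])
    qed simp
    from has_derivative_unique[OF this has_derivative_const]
    have "D (1 *\<^sub>R ?v) = 0" by (rule fun_cong)
    then have "D ?v = 0" by (simp only: scaleR_one)
    moreover have "D ?v = D (\<chi> i j. k (b i) (b j), 0) + D (0, \<chi> i j k l. \<Psi> [b i, b j, b k, b l])"
      by (subst linear_add[OF linD, symmetric]) (simp only: add_Pair add_0_left add_0_right)
    ultimately show ?thesis using D_form[OF \<Psi>(1)] by linarith
  qed
  have zero: "D (y - ?x) = 0" if "y \<in> ?S" for y
  proof -
    from that obtain h' \<Phi>' where y: "h' \<in> Met" "\<Phi>' \<in> forms 4" "y = components b (h', \<Phi>')" by auto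
    define k where "k = (\<lambda>v w. h' v w - h v w)"
    have "bilinear k" "\<And>v w. k v w = k w v"
      using Met_bilinear[OF y(1)] Met_bilinear[OF assms(1)] Met_sym[OF y(1)] Met_sym[OF assms(1)]
      unfolding k_def bilinear_def by (auto intro!: linear_compose_sub)
    from D_metric[OF this] have 1: "D (\<chi> i j. k (b i) (b j), 0) = 0" .
    have 2: "D (0, \<chi> i j k l. (1 * \<Phi>' [b i, b j, b k, b l] + (-1) * \<Phi> [b i, b j, b k, b l])) = 0"
      by (rule D_form[OF forms_add_scale[OF y(2) assms(2)]])
    \<comment> \<open>A difference of two points is the sum of a metric and a form variation.\<close>
    have "y - ?x = (\<chi> i j. k (b i) (b j), 0) + (0, \<chi> i j k l. (1 * \<Phi>' [b i, b j, b k, b l] + (-1) * \<Phi> [b i, b j, b k, b l]))"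
      by (simp add: y(3) components_def k_def vec_eq_iff)
    then have "D (y - ?x) = D (\<chi> i j. k (b i) (b j), 0)
        + D (0, \<chi> i j k l. (1 * \<Phi>' [b i, b j, b k, b l] + (-1) * \<Phi> [b i, b j, b k, b l]))"
      by (simp only: linear_add[OF linD])
    then show ?thesis unfolding 1 2 by simp
  qed
  have "(coordinate_potential has_derivative (\<lambda>_. 0)) (at ?x within ?S)"
    using has_derivative_within_cong_zero[OF has_derivative_at_withinI[OF D] zero] .
  then show "(W \<circ> inv_into (Met \<times> forms 4) (components b) has_derivative (\<lambda>_. 0)) (at ?x within ?S)"
  proof (rule has_derivative_transform[rotated 2])
    show "?x \<in> ?S" using assms(1,2) by auto
    fix y assume "y \<in> ?S"
    then obtain h' \<Phi>' where y: "h' \<in> Met" "\<Phi>' \<in> forms 4" "y = components b (h', \<Phi>')" by auto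
    then show "(W \<circ> inv_into (Met \<times> forms 4) (components b)) y = coordinate_potential y"
      using coord(1)[OF y(1,2)] inv_into_f_f[OF components_inj[OF b], of "(h', \<Phi>')"] by simp
  qed
qed

section \<open>The volume form and the Hodge operator\<close>

text \<open>
  The place of an index in the list that defines \<open>frame\<close>; it orders the index type with \<open>8 = 0\<close> in the
  last place.
\<close>

definition position :: "8 \<Rightarrow> nat" where
  "position i = (if i = 1 then 0 else if i = 2 then 1 else if i = 3 then 2 else if i = 4 then 3
    else if i = 5 then 4 else if i = 6 then 5 else if i = 7 then 6 else 7)"

lemma frame_position: "frame e ! position i = e i"
proof -
  have "\<forall>i. frame e ! position i = e i"
    unfolding forall_8 by (simp add: position_def frame_def)
  then show ?thesis by blast
qed

lemma position_bij: "bij_betw position UNIV {..<8}"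
proof -
  have inj: "inj position"
  proof (rule injI)
    fix i j assume "position i = position j"
    then have "frame (\<lambda>i. i) ! position i = frame (\<lambda>i. i) ! position j" by simp
    then show "i = j" by (simp only: frame_position)
  qed
  moreover have "position ` UNIV \<subseteq> {..<8}" by (auto simp: position_def)
  moreover from this have "position ` UNIV = {..<8}"
    using inj by (intro card_subset_eq) (simp_all add: card_image)
  ultimately show ?thesis by (simp add: bij_betw_def)
qed

text \<open>
  Existence of the volume form: the determinant of the coordinates with respect to an oriented
  orthonormal basis.
\<close>

lemma Gram_det_form:
  assumes "h \<in> Met"
  shows "(\<lambda>vs. if length vs = 8 then det (\<chi> r c. h (vs ! position r) (e c)) else 0) \<in> forms 8"
    (is "?\<nu> \<in> _")
proof -
  have "polyform ?\<nu>"
  proof (rule polyformI)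
    fix us ws :: "'a list"
    show "linear (\<lambda>v. ?\<nu> (us @ v # ws))"
    proof (cases "length us + Suc (length ws) = 8")
      case True
      then have "length us \<in> position ` UNIV" using position_bij by (auto simp: bij_betw_def)
      then obtain k where k: "position k = length us" by auto
      have pk: "position r = length us \<longleftrightarrow> r = k" for r
        using position_bij unfolding k[symmetric] bij_betw_def by (simp add: inj_eq)
      define C where "C r = (\<chi> c. h ((us @ undefined # ws) ! position r) (e c))" for r
      have nth: "(us @ v # ws) ! position r = (us @ undefined # ws) ! position r" if "r \<noteq> k" for r v
      proof -
        have "position r < length us \<or> position r > length us" using pk[of r] that by linarith
        then show ?thesis by (elim disjE) (simp_all add: nth_append nth_Cons')
      qed
      have rows: "(\<chi> r c. h ((us @ v # ws) ! position r) (e c)) = (\<chi> r. if r = k then (\<chi> c. h v (e c)) else C r)" for v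
      proof -
        have "(\<chi> c. h ((us @ v # ws) ! position r) (e c)) = (if r = k then (\<chi> c. h v (e c)) else C r)" for r
          using k nth[of r v] by (cases "r = k") (simp_all add: C_def)
        then show ?thesis by simp
      qed
      have "linear (\<lambda>v. det (\<chi> r. if r = k then (\<chi> c. h v (e c)) else C r))"
      proof (rule linearI)
        have bl: "bilinear h" using assms by (rule Met_bilinear)
        fix x y
        have eq: "(\<chi> c. h (x + y) (e c)) = (\<chi> c. h x (e c)) + (\<chi> c. h y (e c))"
          by (simp add: vec_eq_iff bilinear_ladd[OF bl])
        show "det (\<chi> r. if r = k then (\<chi> c. h (x + y) (e c)) else C r)
            = det (\<chi> r. if r = k then (\<chi> c. h x (e c)) else C r) + det (\<chi> r. if r = k then (\<chi> c. h y (e c)) else C r)"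
          unfolding eq by (rule det_row_add)
      next
        have bl: "bilinear h" using assms by (rule Met_bilinear)
        fix a x
        have eq: "(\<chi> c. h (a *\<^sub>R x) (e c)) = a *s (\<chi> c. h x (e c))"
          by (simp add: vec_eq_iff bilinear_lmul[OF bl])
        show "det (\<chi> r. if r = k then (\<chi> c. h (a *\<^sub>R x) (e c)) else C r)
            = a *\<^sub>R det (\<chi> r. if r = k then (\<chi> c. h x (e c)) else C r)"
          unfolding eq real_scaleR_def by (rule det_row_mul)
      qed
      then show ?thesis using True unfolding rows by simp
    next
      case False
      then have "(\<lambda>v. ?\<nu> (us @ v # ws)) = (\<lambda>_. 0)" by (auto simp del: add_Suc_right)
      then show ?thesis using module_hom_zero by (simp add: linear_0 linear_zero)
    qed
  next
    fix vs :: "'a list"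
    assume "\<not> distinct vs"
    then obtain p q where pq: "p < length vs" "q < length vs" "p \<noteq> q" "vs ! p = vs ! q"
      by (auto simp: distinct_conv_nth)
    show "?\<nu> vs = 0"
    proof (cases "length vs = 8")
      case True
      then have "p \<in> position ` UNIV" "q \<in> position ` UNIV" using pq position_bij by (auto simp: bij_betw_def)
      then obtain i j where ij: "p = position i" "q = position j" by auto
      then have "i \<noteq> j" using pq by auto
      then have "det (\<chi> r c. h (vs ! position r) (e c)) = 0"
        using pq(4) ij by (intro det_identical_rows[of i j]) (simp_all add: row_def vec_eq_iff)
      then show ?thesis by simp
    qed simp
  qed
  then show ?thesis by (simp add: forms_def)
qed

lemma orthonormal_change_det:
  assumes "h \<in> Met" "orthonormal_basis h e" "orthonormal_basis h f" "same_orientation e f"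
  shows "det (\<chi> r c. h (f r) (e c)) = 1"
proof -
  obtain M :: "real^8^8" where M: "\<And>j. f j = (\<Sum>i\<in>UNIV. (M $ i $ j) *\<^sub>R e i)" "det M > 0"
    using assms(4) unfolding same_orientation_def by blast
  have "h (f j) (e i) = M $ i $ j" for i j
    unfolding M(1) using assms(2)
    by (intro orthonormal_coord[of h e "\<lambda>i. M $ i $ j"] Met_bilinear[OF assms(1)]) (simp add: orthonormal_basis_def)
  then have N: "(\<chi> r c. h (f r) (e c)) = transpose M" by (simp add: transpose_def)
  have "(transpose M ** M) $ r $ s = h (f r) (f s)" for r s
    using orthonormal_inner[OF assms(1,2), of "f r" "f s"] N
    by (simp add: matrix_matrix_mult_def transpose_def vec_eq_iff)
  then have "transpose M ** M = mat 1"
    using assms(3) by (simp add: vec_eq_iff mat_def orthonormal_basis_def)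
  then have "det M * det M = 1" by (metis det_I det_mul det_transpose)
  then have "det M = 1" using M(2) by (metis abs_of_pos abs_square_eq_1 power2_eq_square)
  then show ?thesis unfolding N by simp
qed

lemma volume_form:
  assumes "orientation Or" "h \<in> Met"
  shows "volume_form Or h \<in> forms 8"
    and "\<And>e. e \<in> Or \<Longrightarrow> orthonormal_basis h e \<Longrightarrow> volume_form Or h (frame e) = 1"
proof -
  obtain e where e: "e \<in> Or" "orthonormal_basis h e" using ex_oriented_orthonormal_basis[OF assms] by blast
  define \<nu> where "\<nu> = (\<lambda>vs. if length vs = 8 then det (\<chi> r c. h (vs ! position r) (e c)) else 0)"
  have \<nu>: "\<nu> \<in> forms 8" unfolding \<nu>_def by (rule Gram_det_form[OF assms(2)])
  have \<nu>1: "\<nu> (frame f) = 1" if "f \<in> Or" "orthonormal_basis h f" for f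
  proof -
    have "same_orientation e f" using orientation_class(2)[OF assms(1) e(1)] that(1) by blast
    from orthonormal_change_det[OF assms(2) e(2) that(2) this] show ?thesis
      by (simp add: \<nu>_def frame_position)
  qed
  have ex1: "\<exists>!\<nu>. \<nu> \<in> forms 8 \<and> (\<forall>e\<in>Or. orthonormal_basis h e \<longrightarrow> \<nu> (frame e) = 1)"
  proof (rule ex1I[of _ \<nu>])
    fix \<mu> assume \<mu>: "\<mu> \<in> forms 8 \<and> (\<forall>e\<in>Or. orthonormal_basis h e \<longrightarrow> \<mu> (frame e) = 1)"
    have d: "(\<lambda>vs. 1 * \<mu> vs + (-1) * \<nu> vs) \<in> forms 8" using \<mu> \<nu> by (intro forms_add_scale) auto
    have "is_basis e" using e(2) by (simp add: orthonormal_basis_def)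
    moreover have "\<mu> (frame e) = 1" using \<mu> e by blast
    ultimately have "1 * \<mu> vs + (-1) * \<nu> vs = 0" for vs
      using top_form_eq_zero[OF d, of e vs] by (simp add: \<nu>1[OF e])
    then show "\<mu> = \<nu>" by (simp add: fun_eq_iff)
  qed (use \<nu> \<nu>1 in blast)
  note vol = theI'[OF ex1, folded volume_form_def]
  show "volume_form Or h \<in> forms 8" using vol by (rule conjunct1)
  show "volume_form Or h (frame e) = 1" if "e \<in> Or" "orthonormal_basis h e" for e
    using conjunct2[OF vol] that by blast
qed

lemma graded_sign_forms: "\<alpha> \<in> forms k \<Longrightarrow> graded_sign \<alpha> = (\<lambda>vs. (-1) ^ k * \<alpha> vs)"
  unfolding graded_sign_def using forms_length[of \<alpha> k] by force

lemma wedge_scale_left: "((\<lambda>vs. c * \<alpha> vs) \<and>\<^sub>w \<beta>) vs = c * (\<alpha> \<and>\<^sub>w \<beta>) vs"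
  by (simp add: wedge_def sum_distrib_left mult_ac)

lemma wedge_zero: "((\<lambda>_. 0) \<and>\<^sub>w \<beta>) vs = 0" "(\<alpha> \<and>\<^sub>w (\<lambda>_. 0)) vs = 0"
  by (simp_all add: wedge_def)

lemma interior_zero_form: "f \<in> forms 0 \<Longrightarrow> interior v f = (\<lambda>_. 0)"
  using forms_length[of f 0] by (auto simp: interior_def)

lemma wedge_zero_form:
  assumes "f \<in> forms 0"
  shows "(f \<and>\<^sub>w \<beta>) vs = f [] * \<beta> vs" "(\<beta> \<and>\<^sub>w f) vs = \<beta> vs * f []"
proof -
  show "(f \<and>\<^sub>w \<beta>) vs = f [] * \<beta> vs"
    by (induction vs arbitrary: \<beta>)
      (simp_all add: wedge_Nil wedge_Cons interior_zero_form[OF assms] graded_sign_forms[OF assms] wedge_zero, simp add: interior_def)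
  show "(\<beta> \<and>\<^sub>w f) vs = \<beta> vs * f []"
    by (induction vs arbitrary: \<beta>)
      (simp_all add: wedge_Nil wedge_Cons interior_zero_form[OF assms] wedge_zero, simp add: interior_def)
qed

text \<open>
  Forms of degree greater than eight vanish; the contraction of \<open>\<alpha> \<and> \<beta> = 0\<close> by \<open>v\<close> gives the rule.
\<close>

lemma wedge_interior_transfer:
  fixes e :: "8 \<Rightarrow> 'v::real_vector" and \<alpha> \<beta> :: "'v list \<Rightarrow> real"
  assumes "is_basis e" "\<alpha> \<in> forms k" "\<beta> \<in> forms l" "k + l > 8"
  shows "(interior v \<alpha> \<and>\<^sub>w \<beta>) vs = - ((-1) ^ k) * (\<alpha> \<and>\<^sub>w interior v \<beta>) vs"
proof -
  have "(\<alpha> \<and>\<^sub>w \<beta>) (v # vs) = 0"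
  proof (cases "length (v # vs) = k + l")
    case True
    then show ?thesis
      using polyform_high_degree[OF polyform_wedge[OF assms(2,3)[THEN forms_polyform]] assms(1)] assms(4) by simp
  qed (use forms_length[OF wedge_forms[OF assms(2,3)]] in blast)
  then show ?thesis
    unfolding wedge_Cons graded_sign_forms[OF assms(2)] wedge_scale_left by simp
qed

lemma four_form_reverse: "polyform \<alpha> \<Longrightarrow> \<alpha> [d, c, b, a] = \<alpha> [a, b, c, d]"
  using four_form_permutes(4)[of \<alpha> c d a b] four_form_swaps(1)[of \<alpha> d c b a] four_form_swaps(3)[of \<alpha> c d b a]
    four_form_permutes(4)[of \<alpha> a b c d]
  by simp

text \<open>
  Four applications of the transfer rule move the contracting vectors from \<open>\<nu>\<close> to \<open>\<alpha>\<close>, in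
  reverse order, which for four vectors is an even permutation. The signs, which depend on the degrees
  \<open>4, 3, 2, 1\<close> on one side and \<open>5, 6, 7, 8\<close> on the other, cancel in both orders of the factors.
\<close>

lemma wedge_contracted_top_form:
  fixes e :: "8 \<Rightarrow> 'v::real_vector" and \<alpha> \<nu> :: "'v list \<Rightarrow> real"
  assumes "is_basis e" "\<alpha> \<in> forms 4" "\<nu> \<in> forms 8"
  shows "(\<alpha> \<and>\<^sub>w (\<lambda>us. \<nu> ([a, b, c, d] @ us))) vs = \<alpha> [a, b, c, d] * \<nu> vs"
    and "((\<lambda>us. \<nu> ([a, b, c, d] @ us)) \<and>\<^sub>w \<alpha>) vs = \<alpha> [a, b, c, d] * \<nu> vs"
proof -
  define \<nu>1 \<nu>2 \<nu>3 where "\<nu>1 = interior a \<nu>" and "\<nu>2 = interior b \<nu>1" and "\<nu>3 = interior c \<nu>2"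
  define \<alpha>3 \<alpha>2 \<alpha>1 \<alpha>0 where "\<alpha>3 = interior d \<alpha>" and "\<alpha>2 = interior c \<alpha>3" and "\<alpha>1 = interior b \<alpha>2" and "\<alpha>0 = interior a \<alpha>1"
  have \<nu>: "\<nu>1 \<in> forms 7" "\<nu>2 \<in> forms 6" "\<nu>3 \<in> forms 5"
    unfolding \<nu>1_def \<nu>2_def \<nu>3_def using assms(3) by (auto intro!: interior_forms simp: eval_nat_numeral)
  have \<alpha>: "\<alpha>3 \<in> forms 3" "\<alpha>2 \<in> forms 2" "\<alpha>1 \<in> forms 1" "\<alpha>0 \<in> forms 0"
    unfolding \<alpha>3_def \<alpha>2_def \<alpha>1_def \<alpha>0_def using assms(2) by (auto intro!: interior_forms simp: eval_nat_numeral)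
  have eq: "(\<lambda>us. \<nu> ([a, b, c, d] @ us)) = interior d \<nu>3"
    by (simp add: \<nu>3_def \<nu>2_def \<nu>1_def interior_def)
  have val: "\<alpha>0 [] = \<alpha> [a, b, c, d]"
    by (simp add: \<alpha>0_def \<alpha>1_def \<alpha>2_def \<alpha>3_def interior_def four_form_reverse[OF forms_polyform[OF assms(2)]])
  note tr = wedge_interior_transfer[OF assms(1)]
  have "(\<alpha> \<and>\<^sub>w interior d \<nu>3) vs = - (\<alpha>3 \<and>\<^sub>w interior c \<nu>2) vs"
    using tr[OF assms(2) \<nu>(3), of d vs] by (simp add: \<alpha>3_def \<nu>3_def)
  also have "\<dots> = - (\<alpha>2 \<and>\<^sub>w interior b \<nu>1) vs"
    using tr[OF \<alpha>(1) \<nu>(2), of c vs] by (simp add: \<alpha>2_def \<nu>2_def)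
  also have "\<dots> = (\<alpha>1 \<and>\<^sub>w interior a \<nu>) vs"
    using tr[OF \<alpha>(2) \<nu>(1), of b vs] by (simp add: \<alpha>1_def \<nu>1_def)
  also have "\<dots> = (\<alpha>0 \<and>\<^sub>w \<nu>) vs"
    using tr[OF \<alpha>(3) assms(3), of a vs] by (simp add: \<alpha>0_def)
  finally show "(\<alpha> \<and>\<^sub>w (\<lambda>us. \<nu> ([a, b, c, d] @ us))) vs = \<alpha> [a, b, c, d] * \<nu> vs"
    unfolding eq wedge_zero_form(1)[OF \<alpha>(4)] val .
  have "(interior d \<nu>3 \<and>\<^sub>w \<alpha>) vs = (interior c \<nu>2 \<and>\<^sub>w \<alpha>3) vs"
    using tr[OF \<nu>(3) assms(2), of d vs] by (simp add: \<alpha>3_def \<nu>3_def)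
  also have "\<dots> = - (interior b \<nu>1 \<and>\<^sub>w \<alpha>2) vs"
    using tr[OF \<nu>(2) \<alpha>(1), of c vs] by (simp add: \<alpha>2_def \<nu>2_def)
  also have "\<dots> = - (interior a \<nu> \<and>\<^sub>w \<alpha>1) vs"
    using tr[OF \<nu>(1) \<alpha>(2), of b vs] by (simp add: \<alpha>1_def \<nu>1_def)
  also have "\<dots> = (\<nu> \<and>\<^sub>w \<alpha>0) vs"
    using tr[OF assms(3) \<alpha>(3), of a vs] by (simp add: \<alpha>0_def)
  finally show "((\<lambda>us. \<nu> ([a, b, c, d] @ us)) \<and>\<^sub>w \<alpha>) vs = \<alpha> [a, b, c, d] * \<nu> vs"
    unfolding eq wedge_zero_form(2)[OF \<alpha>(4)] val by simp
qed

lemma contracted_form: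
  assumes "\<nu> \<in> forms 8"
  shows "(\<lambda>us. \<nu> ([a, b, c, d] @ us)) \<in> forms 4"
proof -
  have "interior d (interior c (interior b (interior a \<nu>))) \<in> forms 4"
    using assms by (auto intro!: interior_forms simp: eval_nat_numeral)
  then show ?thesis by (simp add: interior_def)
qed

text \<open>
  The dual is the contraction of the volume form with \<open>\<Phi>\<close>. It has the required wedge products by
  \<open>wedge_contracted_top_form\<close>. It is the only such form, since any value of a four-form \<open>\<delta>\<close> can
  be recovered from the wedge product of \<open>\<delta>\<close> with a contraction of the volume form.
\<close>

lemma hodge_4:
  assumes "orientation Or" "h \<in> Met" "e \<in> Or" "orthonormal_basis h e" "\<Phi> \<in> forms 4"
  shows "hodge Or h 4 \<Phi> \<in> forms 4"
    and "hodge Or h 4 \<Phi> us = subset_sum 4 (frame e) (\<lambda>ws. \<Phi> ws * volume_form Or h (ws @ us))"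
proof -
  define \<nu> where "\<nu> = volume_form Or h"
  have \<nu>: "\<nu> \<in> forms 8" "\<nu> (frame e) = 1" using volume_form[OF assms(1,2)] assms(3,4) by (auto simp: \<nu>_def)
  have b: "is_basis e" using assms(4) by (simp add: orthonormal_basis_def)
  define L where "L = (\<lambda>(i, j, k, l). [e i, e j, e k, e l])"
  \<comment> \<open>Each index set occurs in \<open>4! = 24\<close> orders.\<close>
  define \<gamma> where "\<gamma> = (\<lambda>us. \<Sum>p\<in>UNIV. (\<Phi> (L p) / 24) * \<nu> (L p @ us))"
  have cf: "(\<lambda>us. \<nu> (L p @ us)) \<in> forms 4" for p
    unfolding L_def using contracted_form[OF \<nu>(1)] by (cases p) simp
  have \<gamma>: "\<gamma> \<in> forms 4"
  proof -
    have "polyform \<gamma>" unfolding \<gamma>_def by (intro polyform_lincomb forms_polyform[OF cf])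
    moreover have "\<gamma> us = 0" if "length us \<noteq> 4" for us
      unfolding \<gamma>_def using forms_length[OF cf that] by simp
    ultimately show ?thesis by (simp add: forms_def)
  qed
  have char: "\<alpha> \<and>\<^sub>w \<gamma> = (\<lambda>vs. form_inner h \<alpha> \<Phi> * \<nu> vs)" if \<alpha>: "\<alpha> \<in> forms 4" for \<alpha>
  proof
    fix vs
    have "(\<alpha> \<and>\<^sub>w \<gamma>) vs = (\<Sum>I\<in>Pow {..<length vs}. \<Sum>p\<in>UNIV. shuffle_sign (length vs) I * \<alpha> (nths vs I)
        * (\<Phi> (L p) / 24 * \<nu> (L p @ nths vs ({..<length vs} - I))))"
      unfolding wedge_def \<gamma>_def by (simp add: sum_distrib_left)
    also have "\<dots> = (\<Sum>p\<in>UNIV. \<Phi> (L p) / 24 * (\<alpha> \<and>\<^sub>w (\<lambda>us. \<nu> (L p @ us))) vs)"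
      by (subst sum.swap) (simp add: wedge_def sum_distrib_left mult_ac)
    also have "\<dots> = (\<Sum>p\<in>UNIV. \<Phi> (L p) / 24 * (\<alpha> (L p) * \<nu> vs))"
    proof (rule sum.cong[OF refl])
      fix p :: "8 \<times> 8 \<times> 8 \<times> 8"
      show "\<Phi> (L p) / 24 * (\<alpha> \<and>\<^sub>w (\<lambda>us. \<nu> (L p @ us))) vs = \<Phi> (L p) / 24 * (\<alpha> (L p) * \<nu> vs)"
        using wedge_contracted_top_form(1)[OF b \<alpha> \<nu>(1)] by (cases p) (simp add: L_def)
    qed
    also have "\<dots> = (\<Sum>p\<in>UNIV. \<alpha> (L p) * \<Phi> (L p)) / 24 * \<nu> vs"
      by (simp add: sum_distrib_left sum_distrib_right sum_divide_distrib mult_ac)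
    also have "(\<Sum>p\<in>UNIV. \<alpha> (L p) * \<Phi> (L p)) / 24 = form_inner h \<alpha> \<Phi>"
      unfolding form_inner_orthonormal[OF assms(2,4) \<alpha> forms_polyform[OF assms(5)]] by (simp add: sum_pairs L_def)
    finally show "(\<alpha> \<and>\<^sub>w \<gamma>) vs = form_inner h \<alpha> \<Phi> * \<nu> vs" .
  qed
  have hodge: "hodge Or h 4 \<Phi> = \<gamma>"
    unfolding hodge_def \<nu>_def[symmetric]
  proof (rule the_equality)
    show "\<gamma> \<in> forms (8 - 4) \<and> (\<forall>\<alpha>\<in>forms 4. \<alpha> \<and>\<^sub>w \<gamma> = (\<lambda>vs. form_inner h \<alpha> \<Phi> * \<nu> vs))"
      using \<gamma> char by simp
    fix \<delta> assume "\<delta> \<in> forms (8 - 4) \<and> (\<forall>\<alpha>\<in>forms 4. \<alpha> \<and>\<^sub>w \<delta> = (\<lambda>vs. form_inner h \<alpha> \<Phi> * \<nu> vs))"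
    then have \<delta>: "\<delta> \<in> forms 4" "\<And>\<alpha>. \<alpha> \<in> forms 4 \<Longrightarrow> \<alpha> \<and>\<^sub>w \<delta> = \<alpha> \<and>\<^sub>w \<gamma>" using char by simp_all
    \<comment> \<open>Wedging with the contraction of the volume form by \<open>p, q, r, s\<close> isolates one value.\<close>
    have "\<delta> [p, q, r, s] = \<gamma> [p, q, r, s]" for p q r s
    proof -
      have "((\<lambda>us. \<nu> ([p, q, r, s] @ us)) \<and>\<^sub>w \<delta>) (frame e) = ((\<lambda>us. \<nu> ([p, q, r, s] @ us)) \<and>\<^sub>w \<gamma>) (frame e)"
        using \<delta>(2)[OF contracted_form[OF \<nu>(1)]] by simp
      then show ?thesis
        unfolding wedge_contracted_top_form(2)[OF b \<delta>(1) \<nu>(1)] wedge_contracted_top_form(2)[OF b \<gamma> \<nu>(1)]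
        by (simp add: \<nu>(2))
    qed
    moreover have "length vs = 4 \<Longrightarrow> \<exists>p q r s. vs = [p, q, r, s]" for vs :: "'a list"
      by (auto simp: eval_nat_numeral length_Suc_conv)
    ultimately show "\<delta> = \<gamma>"
      using forms_length[OF \<delta>(1)] forms_length[OF \<gamma>] by (metis ext)
  qed
  show "hodge Or h 4 \<Phi> \<in> forms 4" unfolding hodge by (rule \<gamma>)
  have "\<gamma> us = subset_sum 4 (frame e) (\<lambda>ws. \<Phi> ws * \<nu> (ws @ us))"
  proof -
    have "polyform (\<lambda>ws. \<nu> (ws @ us))"
      using polyform_linear[OF forms_polyform[OF \<nu>(1)], of _ "_ @ us"] polyform_repeat[OF forms_polyform[OF \<nu>(1)]]
      by (intro polyformI) auto
    from frame_subset_sum(2)[OF assms(5) this, of e] show ?thesis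
      by (simp add: \<gamma>_def sum_pairs L_def sum_divide_distrib[symmetric])
  qed
  then show "hodge Or h 4 \<Phi> us = subset_sum 4 (frame e) (\<lambda>ws. \<Phi> ws * volume_form Or h (ws @ us))"
    unfolding hodge \<nu>_def .
qed

lemma four_forms_eqI:
  assumes "\<alpha> \<in> forms 4" "\<beta> \<in> forms 4" "is_basis e"
    and "subset_sum 4 (frame e) (\<lambda>vs. (\<alpha> vs - \<beta> vs)\<^sup>2) = 0"
  shows "\<alpha> = \<beta>"
proof -
  define \<delta> where "\<delta> = (\<lambda>vs. 1 * \<alpha> vs + (-1) * \<beta> vs)"
  have \<delta>: "\<delta> \<in> forms 4" unfolding \<delta>_def by (intro forms_add_scale assms)
  have "(\<Sum>i\<in>UNIV. \<Sum>j\<in>UNIV. \<Sum>k\<in>UNIV. \<Sum>l\<in>UNIV. \<delta> [e i, e j, e k, e l] * \<delta> [e i, e j, e k, e l]) = 0"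
    using frame_subset_sum(2)[OF \<delta> forms_polyform[OF \<delta>], of e] assms(4)
    by (simp add: \<delta>_def power2_eq_square)
  then have z: "\<delta> [e i, e j, e k, e l] = 0" for i j k l
    by (simp add: sum_nonneg_eq_0_iff sum_nonneg)
  have "\<delta> vs = 0" for vs
  proof (cases "length vs = 4")
    case True
    show ?thesis
      by (rule polyform_eq_zero_on_basis[OF forms_polyform[OF \<delta>] assms(3) _ True])
        (auto simp: z eval_nat_numeral length_Suc_conv)
  qed (use forms_length[OF \<delta>] in blast)
  then show ?thesis by (auto simp: \<delta>_def fun_eq_iff)
qed

section \<open>Octonion multiplication from the model form\<close>

lemma forms_add: "\<alpha> \<in> forms k \<Longrightarrow> \<beta> \<in> forms k \<Longrightarrow> (\<lambda>vs. \<alpha> vs + \<beta> vs) \<in> forms k"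
  and forms_diff: "\<alpha> \<in> forms k \<Longrightarrow> \<beta> \<in> forms k \<Longrightarrow> (\<lambda>vs. \<alpha> vs - \<beta> vs) \<in> forms k"
  and forms_minus: "\<alpha> \<in> forms k \<Longrightarrow> (\<lambda>vs. - \<alpha> vs) \<in> forms k"
  using forms_add_scale[of \<alpha> k \<beta> 1 1] forms_add_scale[of \<alpha> k \<beta> 1 "-1"] forms_add_scale[of \<alpha> k \<alpha> "-1" 0]
  by simp_all

lemma coord_form_forms: "coord_form i \<in> forms 1"
proof -
  have "polyform (coord_form i)"
  proof (rule polyformI)
    fix us ws :: "(real^8) list"
    show "linear (\<lambda>v. coord_form i (us @ v # ws))"
      by (cases us; cases ws) (auto simp: coord_form_def intro!: linearI split: list.splits)
  next
    fix vs :: "(real^8) list"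
    assume "\<not> distinct vs"
    then show "coord_form i vs = 0" by (auto simp: coord_form_def split: list.splits)
  qed
  then show ?thesis by (auto simp: forms_def coord_form_def split: list.splits)
qed

lemma e4_forms: "e4 i j k l \<in> forms 4"
  unfolding e4_def
  using wedge_forms[OF coord_form_forms wedge_forms[OF coord_form_forms wedge_forms[OF coord_form_forms coord_form_forms]],
      of i j k l] by (simp add: numeral_eq_Suc)

lemma model_form_forms: "model_form \<in> forms 4"
  unfolding model_form_def[abs_def] Phi0_def
  by (intro forms_minus forms_add forms_diff e4_forms)

lemma e4_eval: "e4 i j k l [a, b, c, d] =
    a $ i * (b $ j * (c $ k * d $ l - d $ k * c $ l) - c $ j * (b $ k * d $ l - d $ k * b $ l) + d $ j * (b $ k * c $ l - c $ k * b $ l))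
  - b $ i * (a $ j * (c $ k * d $ l - d $ k * c $ l) - c $ j * (a $ k * d $ l - d $ k * a $ l) + d $ j * (a $ k * c $ l - c $ k * a $ l))
  + c $ i * (a $ j * (b $ k * d $ l - d $ k * b $ l) - b $ j * (a $ k * d $ l - d $ k * a $ l) + d $ j * (a $ k * b $ l - b $ k * a $ l))
  - d $ i * (a $ j * (b $ k * c $ l - c $ k * b $ l) - b $ j * (a $ k * c $ l - c $ k * a $ l) + c $ j * (a $ k * b $ l - b $ k * a $ l))"
  by (simp add: e4_def wedge_Cons wedge_Nil interior_def graded_sign_def coord_form_def algebra_simps)

text \<open>
  The octonion product with unit \<open>e\<^sub>1\<close>: on imaginary octonions, its imaginary part is the cross product
  that the three-form \<open>\<iota>\<^bsub>e\<^sub>1\<^esub> \<Phi>\<close> of the model form defines. As \<open>v\<close> varies, \<open>omul v\<close> and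
  \<open>omul (oconj v)\<close> are the two halves of Clifford multiplication by the vector \<open>v\<close>, between spinors of
  opposite chirality; both spaces of spinors are identified with \<open>\<real>\<^sup>8\<close>.
\<close>

definition omul :: "real^8 \<Rightarrow> real^8 \<Rightarrow> real^8" where
  "omul v s = v $ 1 *\<^sub>R s + s $ 1 *\<^sub>R v - (v \<bullet> s) *\<^sub>R axis 1 1 + (\<chi> k. model_form [axis 1 1, v, s, axis k 1])"

definition oconj :: "real^8 \<Rightarrow> real^8" where
  "oconj v = (2 * v $ 1) *\<^sub>R axis 1 1 - v"

lemma oconj_nth: "oconj v $ 1 = v $ 1" "i \<noteq> 1 \<Longrightarrow> oconj v $ i = - v $ i"
  by (simp_all add: oconj_def axis_def)

lemma omul_nth:
  "omul v s $ 1 = v $ 1 * s $ 1 - v $ 2 * s $ 2 - v $ 3 * s $ 3 - v $ 4 * s $ 4 - v $ 5 * s $ 5 - v $ 6 * s $ 6 - v $ 7 * s $ 7 - v $ 8 * s $ 8"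
  "omul v s $ 2 = v $ 1 * s $ 2 + v $ 2 * s $ 1 - v $ 3 * s $ 4 + v $ 4 * s $ 3 - v $ 5 * s $ 6 + v $ 6 * s $ 5 - v $ 7 * s $ 8 + v $ 8 * s $ 7"
  "omul v s $ 3 = v $ 1 * s $ 3 + v $ 2 * s $ 4 + v $ 3 * s $ 1 - v $ 4 * s $ 2 - v $ 5 * s $ 7 + v $ 6 * s $ 8 + v $ 7 * s $ 5 - v $ 8 * s $ 6"
  "omul v s $ 4 = v $ 1 * s $ 4 - v $ 2 * s $ 3 + v $ 3 * s $ 2 + v $ 4 * s $ 1 + v $ 5 * s $ 8 + v $ 6 * s $ 7 - v $ 7 * s $ 6 - v $ 8 * s $ 5"
  "omul v s $ 5 = v $ 1 * s $ 5 + v $ 2 * s $ 6 + v $ 3 * s $ 7 - v $ 4 * s $ 8 + v $ 5 * s $ 1 - v $ 6 * s $ 2 - v $ 7 * s $ 3 + v $ 8 * s $ 4"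
  "omul v s $ 6 = v $ 1 * s $ 6 - v $ 2 * s $ 5 - v $ 3 * s $ 8 - v $ 4 * s $ 7 + v $ 5 * s $ 2 + v $ 6 * s $ 1 + v $ 7 * s $ 4 + v $ 8 * s $ 3"
  "omul v s $ 7 = v $ 1 * s $ 7 + v $ 2 * s $ 8 - v $ 3 * s $ 5 + v $ 4 * s $ 6 + v $ 5 * s $ 3 - v $ 6 * s $ 4 + v $ 7 * s $ 1 - v $ 8 * s $ 2"
  "omul v s $ 8 = v $ 1 * s $ 8 - v $ 2 * s $ 7 + v $ 3 * s $ 6 + v $ 4 * s $ 5 - v $ 5 * s $ 4 - v $ 6 * s $ 3 + v $ 7 * s $ 2 + v $ 8 * s $ 1"
  by (simp_all add: omul_def model_form_def Phi0_def e4_eval axis_def inner_vec_def sum_8)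

lemma omul_add_left: "omul (v + w) s = omul v s + omul w s"
  and omul_add_right: "omul v (s + t) = omul v s + omul v t"
  and omul_scale_left: "omul (c *\<^sub>R v) s = c *\<^sub>R omul v s"
  and omul_scale_right: "omul v (c *\<^sub>R s) = c *\<^sub>R omul v s"
  by (simp_all add: vec_eq_iff forall_8 omul_nth algebra_simps)

text \<open>
  The octonions are a composition algebra; everything below rests on this eight squares identity.
\<close>

lemma omul_norm: "omul v s \<bullet> omul v s = (v \<bullet> v) * (s \<bullet> s)"
  unfolding inner_vec_def sum_8 omul_nth inner_real_def by algebra

lemma omul_adjoint: "omul v s \<bullet> t = s \<bullet> omul (oconj v) t"
  unfolding inner_vec_def sum_8 omul_nth inner_real_def by (simp add: oconj_nth algebra_simps)

lemma oconj_oconj [simp]: "oconj (oconj v) = v"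
  by (simp add: oconj_def axis_def)

lemma oconj_add: "oconj (v + w) = oconj v + oconj w"
  and oconj_scale: "oconj (c *\<^sub>R v) = c *\<^sub>R oconj v"
  by (simp_all add: oconj_def algebra_simps)

lemma oconj_inner: "oconj v \<bullet> oconj w = v \<bullet> w"
  by (simp add: inner_vec_def sum_8 oconj_nth)

lemma omul_inner: "omul v s \<bullet> omul v t = (v \<bullet> v) * (s \<bullet> t)"
proof -
  have "omul v (s + t) \<bullet> omul v (s + t) = (v \<bullet> v) * ((s + t) \<bullet> (s + t))" by (rule omul_norm)
  then show ?thesis
    using omul_norm[of v s] omul_norm[of v t]
    by (simp add: omul_add_right inner_add_left inner_add_right inner_commute algebra_simps)
qed

text \<open>
  Multiplications by \<open>v\<close> and by its conjugate are adjoint, and the norm is multiplicative.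
\<close>

lemma omul_cancel: "omul (oconj v) (omul v s) = (v \<bullet> v) *\<^sub>R s" "omul v (omul (oconj v) s) = (v \<bullet> v) *\<^sub>R s"
proof -
  have *: "omul (oconj v) (omul v s) = (v \<bullet> v) *\<^sub>R s" for v
  proof (rule vector_eq_rdot[THEN iffD1, rule_format])
    fix t
    have "omul (oconj v) (omul v s) \<bullet> t = omul v s \<bullet> omul v t"
      using omul_adjoint[of "oconj v" "omul v s" t] by simp
    then show "omul (oconj v) (omul v s) \<bullet> t = ((v \<bullet> v) *\<^sub>R s) \<bullet> t" by (simp add: omul_inner)
  qed
  show "omul (oconj v) (omul v s) = (v \<bullet> v) *\<^sub>R s" by (rule *)
  show "omul v (omul (oconj v) s) = (v \<bullet> v) *\<^sub>R s" using *[of "oconj v"] by (simp add: oconj_inner)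
qed

text \<open>
  The Clifford relations, by polarisation of \<open>omul_cancel\<close>.
\<close>

lemma omul_clifford:
  "omul (oconj v) (omul w s) + omul (oconj w) (omul v s) = (2 * (v \<bullet> w)) *\<^sub>R s"
  "omul v (omul (oconj w) s) + omul w (omul (oconj v) s) = (2 * (v \<bullet> w)) *\<^sub>R s"
proof -
  have "omul (oconj (v + w)) (omul (v + w) s) = ((v + w) \<bullet> (v + w)) *\<^sub>R s" by (rule omul_cancel)
  then show "omul (oconj v) (omul w s) + omul (oconj w) (omul v s) = (2 * (v \<bullet> w)) *\<^sub>R s"
    using omul_cancel(1)[of v s] omul_cancel(1)[of w s]
    by (simp add: oconj_add omul_add_left omul_add_right inner_add_left inner_add_right inner_commute[of w v]
        scaleR_add_left algebra_simps)
  have "omul (v + w) (omul (oconj (v + w)) s) = ((v + w) \<bullet> (v + w)) *\<^sub>R s" by (rule omul_cancel)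
  then show "omul v (omul (oconj w) s) + omul w (omul (oconj v) s) = (2 * (v \<bullet> w)) *\<^sub>R s"
    using omul_cancel(2)[of v s] omul_cancel(2)[of w s]
    by (simp add: oconj_add omul_add_left omul_add_right inner_add_left inner_add_right inner_commute[of w v]
        scaleR_add_left algebra_simps)
qed

section \<open>The four-form of a spinor\<close>

text \<open>
  The matrix coefficient, with respect to the spinors \<open>s\<close> and \<open>t\<close>, of the Clifford product of the
  vectors \<open>a, b, c, d\<close>, with two of the four factors moved to the other side of the inner product.
\<close>

definition spinor_pairing :: "real^8 \<Rightarrow> real^8 \<Rightarrow> real^8 \<Rightarrow> real^8 \<Rightarrow> real^8 \<Rightarrow> real^8 \<Rightarrow> real" where
  "spinor_pairing s t a b c d = omul (oconj b) (omul a s) \<bullet> omul (oconj c) (omul d t)"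

text \<open>
  The alternating part of \<open>spinor_pairing s s\<close>: by the Clifford relations, the inner products that are
  subtracted are exactly what keeps it from being alternating.
\<close>

definition spinor_form :: "real^8 \<Rightarrow> (real^8) list \<Rightarrow> real" where
  "spinor_form s vs = (case vs of [a, b, c, d] \<Rightarrow> spinor_pairing s s a b c d
     - (s \<bullet> s) * ((a \<bullet> b) * (c \<bullet> d) - (a \<bullet> c) * (b \<bullet> d) + (a \<bullet> d) * (b \<bullet> c)) | _ \<Rightarrow> 0)"

lemma spinor_form_eval: "spinor_form s [a, b, c, d] = spinor_pairing s s a b c d
     - (s \<bullet> s) * ((a \<bullet> b) * (c \<bullet> d) - (a \<bullet> c) * (b \<bullet> d) + (a \<bullet> d) * (b \<bullet> c))"
  by (simp add: spinor_form_def)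

lemma spinor_form_length: "length vs \<noteq> 4 \<Longrightarrow> spinor_form s vs = 0"
  by (auto simp: spinor_form_def split: list.splits)

lemma spinor_form_linear: "linear (\<lambda>v. spinor_form s (us @ v # ws))"
proof (cases "length us + length ws = 3")
  case True
  then have "length us = 0 \<and> length ws = 3 \<or> length us = 1 \<and> length ws = 2
    \<or> length us = 2 \<and> length ws = 1 \<or> length us = 3 \<and> length ws = 0" by arith
  then consider a b c where "us = []" "ws = [a, b, c]" | a b c where "us = [a]" "ws = [b, c]"
    | a b c where "us = [a, b]" "ws = [c]" | a b c where "us = [a, b, c]" "ws = []"
    by (auto simp: length_Suc_conv eval_nat_numeral)
  then show ?thesis
    by cases (auto intro!: linearI simp: spinor_form_eval spinor_pairing_def oconj_add oconj_scale
        omul_add_left omul_add_right omul_scale_left omul_scale_right inner_add_left inner_add_right algebra_simps)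
next
  case False
  then have "(\<lambda>v. spinor_form s (us @ v # ws)) = (\<lambda>_. 0)"
    by (intro ext spinor_form_length) simp
  then show ?thesis by (simp add: linear_zero)
qed

lemma spinor_form_adjacent:
  "spinor_form s [a, a, c, d] = 0" "spinor_form s [a, b, b, d] = 0" "spinor_form s [a, b, c, c] = 0"
proof -
  have "s \<bullet> omul (oconj c) (omul d s) = (c \<bullet> d) * (s \<bullet> s)" for c d
  proof -
    have "s \<bullet> (omul (oconj c) (omul d s) + omul (oconj d) (omul c s)) = (2 * (c \<bullet> d)) * (s \<bullet> s)"
      unfolding omul_clifford(1) by simp
    moreover have "s \<bullet> omul (oconj c) (omul d s) = s \<bullet> omul (oconj d) (omul c s)"
      by (metis inner_commute omul_adjoint)
    ultimately show ?thesis by (simp add: inner_add_right)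
  qed
  then show "spinor_form s [a, a, c, d] = 0" "spinor_form s [a, b, c, c] = 0"
    by (simp_all add: spinor_form_eval spinor_pairing_def omul_cancel inner_commute)
  have "omul a s \<bullet> omul d s = (a \<bullet> d) * (s \<bullet> s)"
    using \<open>\<And>c d. s \<bullet> omul (oconj c) (omul d s) = (c \<bullet> d) * (s \<bullet> s)\<close>[of a d] omul_adjoint by simp
  then show "spinor_form s [a, b, b, d] = 0"
    by (simp add: spinor_form_eval spinor_pairing_def omul_inner oconj_inner inner_commute algebra_simps)
qed

text \<open>
  Vanishing on equal neighbours gives the antisymmetry under adjacent transpositions, which brings
  equal arguments next to each other.
\<close>

lemma spinor_form_forms: "spinor_form s \<in> forms 4"
proof -
  have add: "spinor_form s (us @ (v + w) # ws) = spinor_form s (us @ v # ws) + spinor_form s (us @ w # ws)" for us v w ws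
    using linear_add[OF spinor_form_linear] .
  have swap1: "spinor_form s [b, a, c, d] = - spinor_form s [a, b, c, d]" for a b c d
    using spinor_form_adjacent(1)[of s "a + b" c d] add[of "[]" a b "[a + b, c, d]"] add[of "[a]" a b "[c, d]"] add[of "[b]" a b "[c, d]"]
      spinor_form_adjacent(1)[of s a c d] spinor_form_adjacent(1)[of s b c d] by simp
  have swap2: "spinor_form s [a, c, b, d] = - spinor_form s [a, b, c, d]" for a b c d
    using spinor_form_adjacent(2)[of s a "b + c" d] add[of "[a]" b c "[b + c, d]"] add[of "[a, b]" b c "[d]"] add[of "[a, c]" b c "[d]"]
      spinor_form_adjacent(2)[of s a b d] spinor_form_adjacent(2)[of s a c d] by simp
  have "spinor_form s vs = 0" if nd: "\<not> distinct vs" for vs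
  proof (cases "length vs = 4")
    case True
    then obtain a b c d where vs: "vs = [a, b, c, d]" by (auto simp: length_Suc_conv eval_nat_numeral)
    have "spinor_form s [a, b, a, d] = 0" "spinor_form s [a, b, c, b] = 0" for a b c d
      using swap2[of a a b d] spinor_form_adjacent(1)[of s a b d] swap2[of a b b c] swap2[of a c b b] spinor_form_adjacent(3)[of s a c b] by simp_all
    moreover from this have "spinor_form s [a, b, c, a] = 0" for a b c
      using swap1[of a b c a] by simp
    ultimately show ?thesis using nd spinor_form_adjacent[of s] unfolding vs by auto
  qed (rule spinor_form_length)
  then have "polyform (spinor_form s)" using spinor_form_linear by (intro polyformI)
  then show ?thesis using spinor_form_length by (simp add: forms_def)
qed

section \<open>Components with respect to the standard basis\<close>

lemma std_basis: "is_basis (\<lambda>i :: 8. axis i 1 :: real^8)"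
proof (rule is_basisI)
  have *: "(\<Sum>i\<in>UNIV. c i *\<^sub>R axis i 1) = (\<chi> i. c i)" for c :: "8 \<Rightarrow> real"
    by (simp add: vec_eq_iff axis_def if_distrib cong: if_cong)
  show "c = (\<lambda>_. 0)" if "(\<Sum>i\<in>UNIV. c i *\<^sub>R axis i 1) = (0 :: real^8)" for c
    using that unfolding * by (simp add: vec_eq_iff fun_eq_iff)
  show "\<exists>c. v = (\<Sum>i\<in>UNIV. c i *\<^sub>R axis i 1)" for v :: "real^8"
    unfolding * by (intro exI[of _ "\<lambda>i. v $ i"]) simp
qed

lemma axis_nth: "axis i 1 $ j = (if j = i then 1 else 0 :: real)"
  by (simp add: axis_def)

lemma oconj_axis: "oconj (axis 1 1) = axis 1 1" "i \<noteq> 1 \<Longrightarrow> oconj (axis i 1) = - axis i 1"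
  by (simp_all add: vec_eq_iff oconj_def axis_def)

lemma omul_minus_left: "omul (- v) s = - omul v s"
  using omul_scale_left[of "-1" v s] by simp

lemma omul_axis_nth:
  "omul (axis 1 1) s $ 1 = s $ 1"
  "omul (axis 1 1) s $ 2 = s $ 2"
  "omul (axis 1 1) s $ 3 = s $ 3"
  "omul (axis 1 1) s $ 4 = s $ 4"
  "omul (axis 1 1) s $ 5 = s $ 5"
  "omul (axis 1 1) s $ 6 = s $ 6"
  "omul (axis 1 1) s $ 7 = s $ 7"
  "omul (axis 1 1) s $ 8 = s $ 8"
  "omul (axis 2 1) s $ 1 = - s $ 2"
  "omul (axis 2 1) s $ 2 = s $ 1"
  "omul (axis 2 1) s $ 3 = s $ 4"
  "omul (axis 2 1) s $ 4 = - s $ 3"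
  "omul (axis 2 1) s $ 5 = s $ 6"
  "omul (axis 2 1) s $ 6 = - s $ 5"
  "omul (axis 2 1) s $ 7 = s $ 8"
  "omul (axis 2 1) s $ 8 = - s $ 7"
  "omul (axis 3 1) s $ 1 = - s $ 3"
  "omul (axis 3 1) s $ 2 = - s $ 4"
  "omul (axis 3 1) s $ 3 = s $ 1"
  "omul (axis 3 1) s $ 4 = s $ 2"
  "omul (axis 3 1) s $ 5 = s $ 7"
  "omul (axis 3 1) s $ 6 = - s $ 8"
  "omul (axis 3 1) s $ 7 = - s $ 5"
  "omul (axis 3 1) s $ 8 = s $ 6"
  "omul (axis 4 1) s $ 1 = - s $ 4"
  "omul (axis 4 1) s $ 2 = s $ 3"
  "omul (axis 4 1) s $ 3 = - s $ 2"
  "omul (axis 4 1) s $ 4 = s $ 1"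
  "omul (axis 4 1) s $ 5 = - s $ 8"
  "omul (axis 4 1) s $ 6 = - s $ 7"
  "omul (axis 4 1) s $ 7 = s $ 6"
  "omul (axis 4 1) s $ 8 = s $ 5"
  "omul (axis 5 1) s $ 1 = - s $ 5"
  "omul (axis 5 1) s $ 2 = - s $ 6"
  "omul (axis 5 1) s $ 3 = - s $ 7"
  "omul (axis 5 1) s $ 4 = s $ 8"
  "omul (axis 5 1) s $ 5 = s $ 1"
  "omul (axis 5 1) s $ 6 = s $ 2"
  "omul (axis 5 1) s $ 7 = s $ 3"
  "omul (axis 5 1) s $ 8 = - s $ 4"
  "omul (axis 6 1) s $ 1 = - s $ 6"
  "omul (axis 6 1) s $ 2 = s $ 5"
  "omul (axis 6 1) s $ 3 = s $ 8"
  "omul (axis 6 1) s $ 4 = s $ 7"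
  "omul (axis 6 1) s $ 5 = - s $ 2"
  "omul (axis 6 1) s $ 6 = s $ 1"
  "omul (axis 6 1) s $ 7 = - s $ 4"
  "omul (axis 6 1) s $ 8 = - s $ 3"
  "omul (axis 7 1) s $ 1 = - s $ 7"
  "omul (axis 7 1) s $ 2 = - s $ 8"
  "omul (axis 7 1) s $ 3 = s $ 5"
  "omul (axis 7 1) s $ 4 = - s $ 6"
  "omul (axis 7 1) s $ 5 = - s $ 3"
  "omul (axis 7 1) s $ 6 = s $ 4"
  "omul (axis 7 1) s $ 7 = s $ 1"
  "omul (axis 7 1) s $ 8 = s $ 2"
  "omul (axis 8 1) s $ 1 = - s $ 8"
  "omul (axis 8 1) s $ 2 = s $ 7"
  "omul (axis 8 1) s $ 3 = - s $ 6"
  "omul (axis 8 1) s $ 4 = - s $ 5"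
  "omul (axis 8 1) s $ 5 = s $ 4"
  "omul (axis 8 1) s $ 6 = s $ 3"
  "omul (axis 8 1) s $ 7 = - s $ 2"
  "omul (axis 8 1) s $ 8 = s $ 1"
  by (simp_all add: omul_nth axis_def)

text \<open>
  Multiplication by a basis vector is a signed permutation of the components, hence so is the product of
  four of them, and only eight products survive.
\<close>

lemma spinor_pairing_axis:
  "spinor_pairing s t (axis 1 1) (axis 2 1) (axis 3 1) (axis 4 1) = - s $ 1 * t $ 1 - s $ 2 * t $ 2 - s $ 3 * t $ 3 - s $ 4 * t $ 4 + s $ 5 * t $ 5 + s $ 6 * t $ 6 + s $ 7 * t $ 7 + s $ 8 * t $ 8"
  "spinor_pairing s t (axis 1 1) (axis 2 1) (axis 3 1) (axis 5 1) = - s $ 1 * t $ 8 - s $ 2 * t $ 7 + s $ 3 * t $ 6 - s $ 4 * t $ 5 - s $ 5 * t $ 4 + s $ 6 * t $ 3 - s $ 7 * t $ 2 - s $ 8 * t $ 1"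
  "spinor_pairing s t (axis 1 1) (axis 2 1) (axis 3 1) (axis 6 1) = - s $ 1 * t $ 7 + s $ 2 * t $ 8 - s $ 3 * t $ 5 - s $ 4 * t $ 6 - s $ 5 * t $ 3 - s $ 6 * t $ 4 - s $ 7 * t $ 1 + s $ 8 * t $ 2"
  "spinor_pairing s t (axis 1 1) (axis 2 1) (axis 3 1) (axis 7 1) = s $ 1 * t $ 6 + s $ 2 * t $ 5 + s $ 3 * t $ 8 - s $ 4 * t $ 7 + s $ 5 * t $ 2 + s $ 6 * t $ 1 - s $ 7 * t $ 4 + s $ 8 * t $ 3"
  "spinor_pairing s t (axis 1 1) (axis 2 1) (axis 3 1) (axis 8 1) = s $ 1 * t $ 5 - s $ 2 * t $ 6 - s $ 3 * t $ 7 - s $ 4 * t $ 8 + s $ 5 * t $ 1 - s $ 6 * t $ 2 - s $ 7 * t $ 3 - s $ 8 * t $ 4"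
  "spinor_pairing s t (axis 1 1) (axis 2 1) (axis 4 1) (axis 5 1) = - s $ 1 * t $ 7 + s $ 2 * t $ 8 + s $ 3 * t $ 5 + s $ 4 * t $ 6 + s $ 5 * t $ 3 + s $ 6 * t $ 4 - s $ 7 * t $ 1 + s $ 8 * t $ 2"
  "spinor_pairing s t (axis 1 1) (axis 2 1) (axis 4 1) (axis 6 1) = s $ 1 * t $ 8 + s $ 2 * t $ 7 + s $ 3 * t $ 6 - s $ 4 * t $ 5 - s $ 5 * t $ 4 + s $ 6 * t $ 3 + s $ 7 * t $ 2 + s $ 8 * t $ 1"
  "spinor_pairing s t (axis 1 1) (axis 2 1) (axis 4 1) (axis 7 1) = s $ 1 * t $ 5 - s $ 2 * t $ 6 + s $ 3 * t $ 7 + s $ 4 * t $ 8 + s $ 5 * t $ 1 - s $ 6 * t $ 2 + s $ 7 * t $ 3 + s $ 8 * t $ 4"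
  "spinor_pairing s t (axis 1 1) (axis 2 1) (axis 4 1) (axis 8 1) = - s $ 1 * t $ 6 - s $ 2 * t $ 5 + s $ 3 * t $ 8 - s $ 4 * t $ 7 - s $ 5 * t $ 2 - s $ 6 * t $ 1 - s $ 7 * t $ 4 + s $ 8 * t $ 3"
  "spinor_pairing s t (axis 1 1) (axis 2 1) (axis 5 1) (axis 6 1) = - s $ 1 * t $ 1 - s $ 2 * t $ 2 + s $ 3 * t $ 3 + s $ 4 * t $ 4 - s $ 5 * t $ 5 - s $ 6 * t $ 6 + s $ 7 * t $ 7 + s $ 8 * t $ 8"
  "spinor_pairing s t (axis 1 1) (axis 2 1) (axis 5 1) (axis 7 1) = - s $ 1 * t $ 4 - s $ 2 * t $ 3 - s $ 3 * t $ 2 - s $ 4 * t $ 1 + s $ 5 * t $ 8 - s $ 6 * t $ 7 - s $ 7 * t $ 6 + s $ 8 * t $ 5"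
  "spinor_pairing s t (axis 1 1) (axis 2 1) (axis 5 1) (axis 8 1) = - s $ 1 * t $ 3 + s $ 2 * t $ 4 - s $ 3 * t $ 1 + s $ 4 * t $ 2 - s $ 5 * t $ 7 - s $ 6 * t $ 8 - s $ 7 * t $ 5 - s $ 8 * t $ 6"
  "spinor_pairing s t (axis 1 1) (axis 2 1) (axis 6 1) (axis 7 1) = - s $ 1 * t $ 3 + s $ 2 * t $ 4 - s $ 3 * t $ 1 + s $ 4 * t $ 2 + s $ 5 * t $ 7 + s $ 6 * t $ 8 + s $ 7 * t $ 5 + s $ 8 * t $ 6"
  "spinor_pairing s t (axis 1 1) (axis 2 1) (axis 6 1) (axis 8 1) = s $ 1 * t $ 4 + s $ 2 * t $ 3 + s $ 3 * t $ 2 + s $ 4 * t $ 1 + s $ 5 * t $ 8 - s $ 6 * t $ 7 - s $ 7 * t $ 6 + s $ 8 * t $ 5"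
  "spinor_pairing s t (axis 1 1) (axis 2 1) (axis 7 1) (axis 8 1) = - s $ 1 * t $ 1 - s $ 2 * t $ 2 + s $ 3 * t $ 3 + s $ 4 * t $ 4 + s $ 5 * t $ 5 + s $ 6 * t $ 6 - s $ 7 * t $ 7 - s $ 8 * t $ 8"
  "spinor_pairing s t (axis 1 1) (axis 3 1) (axis 4 1) (axis 5 1) = s $ 1 * t $ 6 - s $ 2 * t $ 5 + s $ 3 * t $ 8 + s $ 4 * t $ 7 - s $ 5 * t $ 2 + s $ 6 * t $ 1 + s $ 7 * t $ 4 + s $ 8 * t $ 3"
  "spinor_pairing s t (axis 1 1) (axis 3 1) (axis 4 1) (axis 6 1) = - s $ 1 * t $ 5 - s $ 2 * t $ 6 + s $ 3 * t $ 7 - s $ 4 * t $ 8 - s $ 5 * t $ 1 - s $ 6 * t $ 2 + s $ 7 * t $ 3 - s $ 8 * t $ 4"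
  "spinor_pairing s t (axis 1 1) (axis 3 1) (axis 4 1) (axis 7 1) = s $ 1 * t $ 8 - s $ 2 * t $ 7 - s $ 3 * t $ 6 - s $ 4 * t $ 5 - s $ 5 * t $ 4 - s $ 6 * t $ 3 - s $ 7 * t $ 2 + s $ 8 * t $ 1"
  "spinor_pairing s t (axis 1 1) (axis 3 1) (axis 4 1) (axis 8 1) = - s $ 1 * t $ 7 - s $ 2 * t $ 8 - s $ 3 * t $ 5 + s $ 4 * t $ 6 - s $ 5 * t $ 3 + s $ 6 * t $ 4 - s $ 7 * t $ 1 - s $ 8 * t $ 2"
  "spinor_pairing s t (axis 1 1) (axis 3 1) (axis 5 1) (axis 6 1) = s $ 1 * t $ 4 - s $ 2 * t $ 3 - s $ 3 * t $ 2 + s $ 4 * t $ 1 - s $ 5 * t $ 8 - s $ 6 * t $ 7 - s $ 7 * t $ 6 - s $ 8 * t $ 5"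
  "spinor_pairing s t (axis 1 1) (axis 3 1) (axis 5 1) (axis 7 1) = - s $ 1 * t $ 1 + s $ 2 * t $ 2 - s $ 3 * t $ 3 + s $ 4 * t $ 4 - s $ 5 * t $ 5 + s $ 6 * t $ 6 - s $ 7 * t $ 7 + s $ 8 * t $ 8"
  "spinor_pairing s t (axis 1 1) (axis 3 1) (axis 5 1) (axis 8 1) = s $ 1 * t $ 2 + s $ 2 * t $ 1 + s $ 3 * t $ 4 + s $ 4 * t $ 3 + s $ 5 * t $ 6 + s $ 6 * t $ 5 - s $ 7 * t $ 8 - s $ 8 * t $ 7"
  "spinor_pairing s t (axis 1 1) (axis 3 1) (axis 6 1) (axis 7 1) = s $ 1 * t $ 2 + s $ 2 * t $ 1 + s $ 3 * t $ 4 + s $ 4 * t $ 3 - s $ 5 * t $ 6 - s $ 6 * t $ 5 + s $ 7 * t $ 8 + s $ 8 * t $ 7"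
  "spinor_pairing s t (axis 1 1) (axis 3 1) (axis 6 1) (axis 8 1) = s $ 1 * t $ 1 - s $ 2 * t $ 2 + s $ 3 * t $ 3 - s $ 4 * t $ 4 - s $ 5 * t $ 5 + s $ 6 * t $ 6 - s $ 7 * t $ 7 + s $ 8 * t $ 8"
  "spinor_pairing s t (axis 1 1) (axis 3 1) (axis 7 1) (axis 8 1) = s $ 1 * t $ 4 - s $ 2 * t $ 3 - s $ 3 * t $ 2 + s $ 4 * t $ 1 + s $ 5 * t $ 8 + s $ 6 * t $ 7 + s $ 7 * t $ 6 + s $ 8 * t $ 5"
  "spinor_pairing s t (axis 1 1) (axis 4 1) (axis 5 1) (axis 6 1) = - s $ 1 * t $ 3 - s $ 2 * t $ 4 - s $ 3 * t $ 1 - s $ 4 * t $ 2 - s $ 5 * t $ 7 + s $ 6 * t $ 8 - s $ 7 * t $ 5 + s $ 8 * t $ 6"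
  "spinor_pairing s t (axis 1 1) (axis 4 1) (axis 5 1) (axis 7 1) = s $ 1 * t $ 2 + s $ 2 * t $ 1 - s $ 3 * t $ 4 - s $ 4 * t $ 3 + s $ 5 * t $ 6 + s $ 6 * t $ 5 + s $ 7 * t $ 8 + s $ 8 * t $ 7"
  "spinor_pairing s t (axis 1 1) (axis 4 1) (axis 5 1) (axis 8 1) = s $ 1 * t $ 1 - s $ 2 * t $ 2 - s $ 3 * t $ 3 + s $ 4 * t $ 4 + s $ 5 * t $ 5 - s $ 6 * t $ 6 - s $ 7 * t $ 7 + s $ 8 * t $ 8"
  "spinor_pairing s t (axis 1 1) (axis 4 1) (axis 6 1) (axis 7 1) = s $ 1 * t $ 1 - s $ 2 * t $ 2 - s $ 3 * t $ 3 + s $ 4 * t $ 4 - s $ 5 * t $ 5 + s $ 6 * t $ 6 + s $ 7 * t $ 7 - s $ 8 * t $ 8"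
  "spinor_pairing s t (axis 1 1) (axis 4 1) (axis 6 1) (axis 8 1) = - s $ 1 * t $ 2 - s $ 2 * t $ 1 + s $ 3 * t $ 4 + s $ 4 * t $ 3 + s $ 5 * t $ 6 + s $ 6 * t $ 5 + s $ 7 * t $ 8 + s $ 8 * t $ 7"
  "spinor_pairing s t (axis 1 1) (axis 4 1) (axis 7 1) (axis 8 1) = - s $ 1 * t $ 3 - s $ 2 * t $ 4 - s $ 3 * t $ 1 - s $ 4 * t $ 2 + s $ 5 * t $ 7 - s $ 6 * t $ 8 + s $ 7 * t $ 5 - s $ 8 * t $ 6"
  "spinor_pairing s t (axis 1 1) (axis 5 1) (axis 6 1) (axis 7 1) = s $ 1 * t $ 8 - s $ 2 * t $ 7 + s $ 3 * t $ 6 + s $ 4 * t $ 5 + s $ 5 * t $ 4 + s $ 6 * t $ 3 - s $ 7 * t $ 2 + s $ 8 * t $ 1"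
  "spinor_pairing s t (axis 1 1) (axis 5 1) (axis 6 1) (axis 8 1) = - s $ 1 * t $ 7 - s $ 2 * t $ 8 + s $ 3 * t $ 5 - s $ 4 * t $ 6 + s $ 5 * t $ 3 - s $ 6 * t $ 4 - s $ 7 * t $ 1 - s $ 8 * t $ 2"
  "spinor_pairing s t (axis 1 1) (axis 5 1) (axis 7 1) (axis 8 1) = s $ 1 * t $ 6 - s $ 2 * t $ 5 - s $ 3 * t $ 8 - s $ 4 * t $ 7 - s $ 5 * t $ 2 + s $ 6 * t $ 1 - s $ 7 * t $ 4 - s $ 8 * t $ 3"
  "spinor_pairing s t (axis 1 1) (axis 6 1) (axis 7 1) (axis 8 1) = - s $ 1 * t $ 5 - s $ 2 * t $ 6 - s $ 3 * t $ 7 + s $ 4 * t $ 8 - s $ 5 * t $ 1 - s $ 6 * t $ 2 - s $ 7 * t $ 3 + s $ 8 * t $ 4"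
  "spinor_pairing s t (axis 2 1) (axis 3 1) (axis 4 1) (axis 5 1) = - s $ 1 * t $ 5 - s $ 2 * t $ 6 - s $ 3 * t $ 7 + s $ 4 * t $ 8 - s $ 5 * t $ 1 - s $ 6 * t $ 2 - s $ 7 * t $ 3 + s $ 8 * t $ 4"
  "spinor_pairing s t (axis 2 1) (axis 3 1) (axis 4 1) (axis 6 1) = - s $ 1 * t $ 6 + s $ 2 * t $ 5 + s $ 3 * t $ 8 + s $ 4 * t $ 7 + s $ 5 * t $ 2 - s $ 6 * t $ 1 + s $ 7 * t $ 4 + s $ 8 * t $ 3"
  "spinor_pairing s t (axis 2 1) (axis 3 1) (axis 4 1) (axis 7 1) = - s $ 1 * t $ 7 - s $ 2 * t $ 8 + s $ 3 * t $ 5 - s $ 4 * t $ 6 + s $ 5 * t $ 3 - s $ 6 * t $ 4 - s $ 7 * t $ 1 - s $ 8 * t $ 2"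
  "spinor_pairing s t (axis 2 1) (axis 3 1) (axis 4 1) (axis 8 1) = - s $ 1 * t $ 8 + s $ 2 * t $ 7 - s $ 3 * t $ 6 - s $ 4 * t $ 5 - s $ 5 * t $ 4 - s $ 6 * t $ 3 + s $ 7 * t $ 2 - s $ 8 * t $ 1"
  "spinor_pairing s t (axis 2 1) (axis 3 1) (axis 5 1) (axis 6 1) = - s $ 1 * t $ 3 - s $ 2 * t $ 4 - s $ 3 * t $ 1 - s $ 4 * t $ 2 + s $ 5 * t $ 7 - s $ 6 * t $ 8 + s $ 7 * t $ 5 - s $ 8 * t $ 6"
  "spinor_pairing s t (axis 2 1) (axis 3 1) (axis 5 1) (axis 7 1) = s $ 1 * t $ 2 + s $ 2 * t $ 1 - s $ 3 * t $ 4 - s $ 4 * t $ 3 - s $ 5 * t $ 6 - s $ 6 * t $ 5 - s $ 7 * t $ 8 - s $ 8 * t $ 7"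
  "spinor_pairing s t (axis 2 1) (axis 3 1) (axis 5 1) (axis 8 1) = s $ 1 * t $ 1 - s $ 2 * t $ 2 - s $ 3 * t $ 3 + s $ 4 * t $ 4 - s $ 5 * t $ 5 + s $ 6 * t $ 6 + s $ 7 * t $ 7 - s $ 8 * t $ 8"
  "spinor_pairing s t (axis 2 1) (axis 3 1) (axis 6 1) (axis 7 1) = s $ 1 * t $ 1 - s $ 2 * t $ 2 - s $ 3 * t $ 3 + s $ 4 * t $ 4 + s $ 5 * t $ 5 - s $ 6 * t $ 6 - s $ 7 * t $ 7 + s $ 8 * t $ 8"
  "spinor_pairing s t (axis 2 1) (axis 3 1) (axis 6 1) (axis 8 1) = - s $ 1 * t $ 2 - s $ 2 * t $ 1 + s $ 3 * t $ 4 + s $ 4 * t $ 3 - s $ 5 * t $ 6 - s $ 6 * t $ 5 - s $ 7 * t $ 8 - s $ 8 * t $ 7"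
  "spinor_pairing s t (axis 2 1) (axis 3 1) (axis 7 1) (axis 8 1) = - s $ 1 * t $ 3 - s $ 2 * t $ 4 - s $ 3 * t $ 1 - s $ 4 * t $ 2 - s $ 5 * t $ 7 + s $ 6 * t $ 8 - s $ 7 * t $ 5 + s $ 8 * t $ 6"
  "spinor_pairing s t (axis 2 1) (axis 4 1) (axis 5 1) (axis 6 1) = - s $ 1 * t $ 4 + s $ 2 * t $ 3 + s $ 3 * t $ 2 - s $ 4 * t $ 1 - s $ 5 * t $ 8 - s $ 6 * t $ 7 - s $ 7 * t $ 6 - s $ 8 * t $ 5"
  "spinor_pairing s t (axis 2 1) (axis 4 1) (axis 5 1) (axis 7 1) = s $ 1 * t $ 1 - s $ 2 * t $ 2 + s $ 3 * t $ 3 - s $ 4 * t $ 4 - s $ 5 * t $ 5 + s $ 6 * t $ 6 - s $ 7 * t $ 7 + s $ 8 * t $ 8"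
  "spinor_pairing s t (axis 2 1) (axis 4 1) (axis 5 1) (axis 8 1) = - s $ 1 * t $ 2 - s $ 2 * t $ 1 - s $ 3 * t $ 4 - s $ 4 * t $ 3 + s $ 5 * t $ 6 + s $ 6 * t $ 5 - s $ 7 * t $ 8 - s $ 8 * t $ 7"
  "spinor_pairing s t (axis 2 1) (axis 4 1) (axis 6 1) (axis 7 1) = - s $ 1 * t $ 2 - s $ 2 * t $ 1 - s $ 3 * t $ 4 - s $ 4 * t $ 3 - s $ 5 * t $ 6 - s $ 6 * t $ 5 + s $ 7 * t $ 8 + s $ 8 * t $ 7"
  "spinor_pairing s t (axis 2 1) (axis 4 1) (axis 6 1) (axis 8 1) = - s $ 1 * t $ 1 + s $ 2 * t $ 2 - s $ 3 * t $ 3 + s $ 4 * t $ 4 - s $ 5 * t $ 5 + s $ 6 * t $ 6 - s $ 7 * t $ 7 + s $ 8 * t $ 8"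
  "spinor_pairing s t (axis 2 1) (axis 4 1) (axis 7 1) (axis 8 1) = - s $ 1 * t $ 4 + s $ 2 * t $ 3 + s $ 3 * t $ 2 - s $ 4 * t $ 1 + s $ 5 * t $ 8 + s $ 6 * t $ 7 + s $ 7 * t $ 6 + s $ 8 * t $ 5"
  "spinor_pairing s t (axis 2 1) (axis 5 1) (axis 6 1) (axis 7 1) = - s $ 1 * t $ 7 - s $ 2 * t $ 8 - s $ 3 * t $ 5 + s $ 4 * t $ 6 - s $ 5 * t $ 3 + s $ 6 * t $ 4 - s $ 7 * t $ 1 - s $ 8 * t $ 2"
  "spinor_pairing s t (axis 2 1) (axis 5 1) (axis 6 1) (axis 8 1) = - s $ 1 * t $ 8 + s $ 2 * t $ 7 + s $ 3 * t $ 6 + s $ 4 * t $ 5 + s $ 5 * t $ 4 + s $ 6 * t $ 3 + s $ 7 * t $ 2 - s $ 8 * t $ 1"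
  "spinor_pairing s t (axis 2 1) (axis 5 1) (axis 7 1) (axis 8 1) = - s $ 1 * t $ 5 - s $ 2 * t $ 6 + s $ 3 * t $ 7 - s $ 4 * t $ 8 - s $ 5 * t $ 1 - s $ 6 * t $ 2 + s $ 7 * t $ 3 - s $ 8 * t $ 4"
  "spinor_pairing s t (axis 2 1) (axis 6 1) (axis 7 1) (axis 8 1) = - s $ 1 * t $ 6 + s $ 2 * t $ 5 - s $ 3 * t $ 8 - s $ 4 * t $ 7 + s $ 5 * t $ 2 - s $ 6 * t $ 1 - s $ 7 * t $ 4 - s $ 8 * t $ 3"
  "spinor_pairing s t (axis 3 1) (axis 4 1) (axis 5 1) (axis 6 1) = - s $ 1 * t $ 1 - s $ 2 * t $ 2 + s $ 3 * t $ 3 + s $ 4 * t $ 4 + s $ 5 * t $ 5 + s $ 6 * t $ 6 - s $ 7 * t $ 7 - s $ 8 * t $ 8"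
  "spinor_pairing s t (axis 3 1) (axis 4 1) (axis 5 1) (axis 7 1) = - s $ 1 * t $ 4 - s $ 2 * t $ 3 - s $ 3 * t $ 2 - s $ 4 * t $ 1 - s $ 5 * t $ 8 + s $ 6 * t $ 7 + s $ 7 * t $ 6 - s $ 8 * t $ 5"
  "spinor_pairing s t (axis 3 1) (axis 4 1) (axis 5 1) (axis 8 1) = - s $ 1 * t $ 3 + s $ 2 * t $ 4 - s $ 3 * t $ 1 + s $ 4 * t $ 2 + s $ 5 * t $ 7 + s $ 6 * t $ 8 + s $ 7 * t $ 5 + s $ 8 * t $ 6"
  "spinor_pairing s t (axis 3 1) (axis 4 1) (axis 6 1) (axis 7 1) = - s $ 1 * t $ 3 + s $ 2 * t $ 4 - s $ 3 * t $ 1 + s $ 4 * t $ 2 - s $ 5 * t $ 7 - s $ 6 * t $ 8 - s $ 7 * t $ 5 - s $ 8 * t $ 6"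
  "spinor_pairing s t (axis 3 1) (axis 4 1) (axis 6 1) (axis 8 1) = s $ 1 * t $ 4 + s $ 2 * t $ 3 + s $ 3 * t $ 2 + s $ 4 * t $ 1 - s $ 5 * t $ 8 + s $ 6 * t $ 7 + s $ 7 * t $ 6 - s $ 8 * t $ 5"
  "spinor_pairing s t (axis 3 1) (axis 4 1) (axis 7 1) (axis 8 1) = - s $ 1 * t $ 1 - s $ 2 * t $ 2 + s $ 3 * t $ 3 + s $ 4 * t $ 4 - s $ 5 * t $ 5 - s $ 6 * t $ 6 + s $ 7 * t $ 7 + s $ 8 * t $ 8"
  "spinor_pairing s t (axis 3 1) (axis 5 1) (axis 6 1) (axis 7 1) = s $ 1 * t $ 6 + s $ 2 * t $ 5 - s $ 3 * t $ 8 + s $ 4 * t $ 7 + s $ 5 * t $ 2 + s $ 6 * t $ 1 + s $ 7 * t $ 4 - s $ 8 * t $ 3"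
  "spinor_pairing s t (axis 3 1) (axis 5 1) (axis 6 1) (axis 8 1) = s $ 1 * t $ 5 - s $ 2 * t $ 6 + s $ 3 * t $ 7 + s $ 4 * t $ 8 + s $ 5 * t $ 1 - s $ 6 * t $ 2 + s $ 7 * t $ 3 + s $ 8 * t $ 4"
  "spinor_pairing s t (axis 3 1) (axis 5 1) (axis 7 1) (axis 8 1) = - s $ 1 * t $ 8 - s $ 2 * t $ 7 - s $ 3 * t $ 6 + s $ 4 * t $ 5 + s $ 5 * t $ 4 - s $ 6 * t $ 3 - s $ 7 * t $ 2 - s $ 8 * t $ 1"
  "spinor_pairing s t (axis 3 1) (axis 6 1) (axis 7 1) (axis 8 1) = - s $ 1 * t $ 7 + s $ 2 * t $ 8 + s $ 3 * t $ 5 + s $ 4 * t $ 6 + s $ 5 * t $ 3 + s $ 6 * t $ 4 - s $ 7 * t $ 1 + s $ 8 * t $ 2"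
  "spinor_pairing s t (axis 4 1) (axis 5 1) (axis 6 1) (axis 7 1) = s $ 1 * t $ 5 - s $ 2 * t $ 6 - s $ 3 * t $ 7 - s $ 4 * t $ 8 + s $ 5 * t $ 1 - s $ 6 * t $ 2 - s $ 7 * t $ 3 - s $ 8 * t $ 4"
  "spinor_pairing s t (axis 4 1) (axis 5 1) (axis 6 1) (axis 8 1) = - s $ 1 * t $ 6 - s $ 2 * t $ 5 - s $ 3 * t $ 8 + s $ 4 * t $ 7 - s $ 5 * t $ 2 - s $ 6 * t $ 1 + s $ 7 * t $ 4 - s $ 8 * t $ 3"
  "spinor_pairing s t (axis 4 1) (axis 5 1) (axis 7 1) (axis 8 1) = - s $ 1 * t $ 7 + s $ 2 * t $ 8 - s $ 3 * t $ 5 - s $ 4 * t $ 6 - s $ 5 * t $ 3 - s $ 6 * t $ 4 - s $ 7 * t $ 1 + s $ 8 * t $ 2"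
  "spinor_pairing s t (axis 4 1) (axis 6 1) (axis 7 1) (axis 8 1) = s $ 1 * t $ 8 + s $ 2 * t $ 7 - s $ 3 * t $ 6 + s $ 4 * t $ 5 + s $ 5 * t $ 4 - s $ 6 * t $ 3 + s $ 7 * t $ 2 + s $ 8 * t $ 1"
  "spinor_pairing s t (axis 5 1) (axis 6 1) (axis 7 1) (axis 8 1) = - s $ 1 * t $ 1 - s $ 2 * t $ 2 - s $ 3 * t $ 3 - s $ 4 * t $ 4 + s $ 5 * t $ 5 + s $ 6 * t $ 6 + s $ 7 * t $ 7 + s $ 8 * t $ 8"
  by (simp_all add: spinor_pairing_def oconj_axis omul_minus_left inner_vec_def sum_8 omul_axis_nth)

lemma spinor_form_axis:
  "a \<noteq> b \<Longrightarrow> a \<noteq> c \<Longrightarrow> a \<noteq> d \<Longrightarrow>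
    spinor_form s [axis a 1, axis b 1, axis c 1, axis d 1] = spinor_pairing s s (axis a 1) (axis b 1) (axis c 1) (axis d 1)"
  by (simp add: spinor_form_eval inner_axis_axis)

lemma e4_axis_zero:
  "a \<noteq> i \<Longrightarrow> a \<noteq> j \<Longrightarrow> a \<noteq> k \<Longrightarrow> a \<noteq> l \<Longrightarrow> e4 i j k l [axis a 1, v, w, x] = 0"
  "a \<noteq> i \<Longrightarrow> a \<noteq> j \<Longrightarrow> a \<noteq> k \<Longrightarrow> a \<noteq> l \<Longrightarrow> e4 i j k l [v, axis a 1, w, x] = 0"
  "a \<noteq> i \<Longrightarrow> a \<noteq> j \<Longrightarrow> a \<noteq> k \<Longrightarrow> a \<noteq> l \<Longrightarrow> e4 i j k l [v, w, axis a 1, x] = 0"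
  "a \<noteq> i \<Longrightarrow> a \<noteq> j \<Longrightarrow> a \<noteq> k \<Longrightarrow> a \<noteq> l \<Longrightarrow> e4 i j k l [v, w, x, axis a 1] = 0"
  by (simp_all add: e4_eval axis_def)

lemma e4_axis_one:
  "distinct [i, j, k, l] \<Longrightarrow> e4 i j k l [axis i 1, axis j 1, axis k 1, axis l 1] = 1"
  by (simp add: e4_eval axis_def)

text \<open>
  The index sets with four elements, increasing, in the order in which \<open>subset_sum\<close> runs through them.
\<close>

definition quadruples :: "(8 \<times> 8 \<times> 8 \<times> 8) list" where
  "quadruples = [
(1, 2, 3, 4), (1, 2, 3, 5), (1, 2, 3, 6), (1, 2, 3, 7), (1, 2, 3, 8), (1, 2, 4, 5), (1, 2, 4, 6),
    (1, 2, 4, 7), (1, 2, 4, 8), (1, 2, 5, 6), (1, 2, 5, 7), (1, 2, 5, 8), (1, 2, 6, 7), (1, 2, 6, 8),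
    (1, 2, 7, 8), (1, 3, 4, 5), (1, 3, 4, 6), (1, 3, 4, 7), (1, 3, 4, 8), (1, 3, 5, 6), (1, 3, 5, 7),
    (1, 3, 5, 8), (1, 3, 6, 7), (1, 3, 6, 8), (1, 3, 7, 8), (1, 4, 5, 6), (1, 4, 5, 7), (1, 4, 5, 8),
    (1, 4, 6, 7), (1, 4, 6, 8), (1, 4, 7, 8), (1, 5, 6, 7), (1, 5, 6, 8), (1, 5, 7, 8), (1, 6, 7, 8),
    (2, 3, 4, 5), (2, 3, 4, 6), (2, 3, 4, 7), (2, 3, 4, 8), (2, 3, 5, 6), (2, 3, 5, 7), (2, 3, 5, 8),
    (2, 3, 6, 7), (2, 3, 6, 8), (2, 3, 7, 8), (2, 4, 5, 6), (2, 4, 5, 7), (2, 4, 5, 8), (2, 4, 6, 7),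
    (2, 4, 6, 8), (2, 4, 7, 8), (2, 5, 6, 7), (2, 5, 6, 8), (2, 5, 7, 8), (2, 6, 7, 8), (3, 4, 5, 6),
    (3, 4, 5, 7), (3, 4, 5, 8), (3, 4, 6, 7), (3, 4, 6, 8), (3, 4, 7, 8), (3, 5, 6, 7), (3, 5, 6, 8),
    (3, 5, 7, 8), (3, 6, 7, 8), (4, 5, 6, 7), (4, 5, 6, 8), (4, 5, 7, 8), (4, 6, 7, 8), (5, 6, 7, 8)]"

lemma four_forms_eq_on_quadruples:
  assumes "\<alpha> \<in> forms 4" "\<beta> \<in> forms 4" "is_basis e"
    and "\<forall>(i, j, k, l)\<in>set quadruples. \<alpha> [e i, e j, e k, e l] = \<beta> [e i, e j, e k, e l]"
  shows "\<alpha> = \<beta>"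
proof (rule four_forms_eqI[OF assms(1-3)])
  have four: "4 = Suc (Suc (Suc (Suc 0)))" by simp
  show "subset_sum 4 (frame e) (\<lambda>vs. (\<alpha> vs - \<beta> vs)\<^sup>2) = 0"
    unfolding four frame_def using assms(4)[unfolded quadruples_def] by simp
qed

lemma spinor_form_model: "spinor_form (axis 1 1) = model_form"
proof (rule four_forms_eq_on_quadruples[OF spinor_form_forms model_form_forms std_basis])
  show "\<forall>(i, j, k, l)\<in>set quadruples.
      spinor_form (axis 1 1) [axis i 1, axis j 1, axis k 1, axis l 1] = model_form [axis i 1, axis j 1, axis k 1, axis l 1]"
    by (simp add: quadruples_def spinor_form_axis spinor_pairing_axis
       model_form_def Phi0_def e4_axis_zero e4_axis_one axis_nth)
qed

section \<open>The Hodge operator in components\<close>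

lemma position_simps [simp]: "position 1 = 0" "position 2 = 1" "position 3 = 2" "position 4 = 3"
  "position 5 = 4" "position 6 = 5" "position 7 = 6" "position 8 = 7"
  by (simp_all add: position_def)

text \<open>
  A name for the values on basis vectors that keeps the index list visible to the simplifier, which can
  then sort it with \<open>frame_value_sort\<close>.
\<close>

definition frame_value :: "('v list \<Rightarrow> real) \<Rightarrow> (8 \<Rightarrow> 'v) \<Rightarrow> 8 list \<Rightarrow> real" where
  "frame_value \<nu> e js = \<nu> (map e js)"

lemma frame_value_repeat: "\<nu> \<in> forms 8 \<Longrightarrow> \<not> distinct js \<Longrightarrow> frame_value \<nu> e js = 0"
  unfolding frame_value_def by (intro polyform_repeat[OF forms_polyform]) (auto simp: distinct_map)

lemma frame_value_sort:
  assumes "\<nu> \<in> forms 8"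
  shows
    "position b < position a \<Longrightarrow> frame_value \<nu> e [a, b, c, d, f, g, h, i] = - frame_value \<nu> e [b, a, c, d, f, g, h, i]"
    "position c < position b \<Longrightarrow> frame_value \<nu> e [a, b, c, d, f, g, h, i] = - frame_value \<nu> e [a, c, b, d, f, g, h, i]"
    "position d < position c \<Longrightarrow> frame_value \<nu> e [a, b, c, d, f, g, h, i] = - frame_value \<nu> e [a, b, d, c, f, g, h, i]"
    "position f < position d \<Longrightarrow> frame_value \<nu> e [a, b, c, d, f, g, h, i] = - frame_value \<nu> e [a, b, c, f, d, g, h, i]"
    "position g < position f \<Longrightarrow> frame_value \<nu> e [a, b, c, d, f, g, h, i] = - frame_value \<nu> e [a, b, c, d, g, f, h, i]"
    "position h < position g \<Longrightarrow> frame_value \<nu> e [a, b, c, d, f, g, h, i] = - frame_value \<nu> e [a, b, c, d, f, h, g, i]"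
    "position i < position h \<Longrightarrow> frame_value \<nu> e [a, b, c, d, f, g, h, i] = - frame_value \<nu> e [a, b, c, d, f, g, i, h]"
proof -
  note alt = polyform_swap[OF forms_polyform[OF assms]]
  show
    "position b < position a \<Longrightarrow> frame_value \<nu> e [a, b, c, d, f, g, h, i] = - frame_value \<nu> e [b, a, c, d, f, g, h, i]"
    "position c < position b \<Longrightarrow> frame_value \<nu> e [a, b, c, d, f, g, h, i] = - frame_value \<nu> e [a, c, b, d, f, g, h, i]"
    "position d < position c \<Longrightarrow> frame_value \<nu> e [a, b, c, d, f, g, h, i] = - frame_value \<nu> e [a, b, d, c, f, g, h, i]"
    "position f < position d \<Longrightarrow> frame_value \<nu> e [a, b, c, d, f, g, h, i] = - frame_value \<nu> e [a, b, c, f, d, g, h, i]"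
    "position g < position f \<Longrightarrow> frame_value \<nu> e [a, b, c, d, f, g, h, i] = - frame_value \<nu> e [a, b, c, d, g, f, h, i]"
    "position h < position g \<Longrightarrow> frame_value \<nu> e [a, b, c, d, f, g, h, i] = - frame_value \<nu> e [a, b, c, d, f, h, g, i]"
    "position i < position h \<Longrightarrow> frame_value \<nu> e [a, b, c, d, f, g, h, i] = - frame_value \<nu> e [a, b, c, d, f, g, i, h]"
    unfolding frame_value_def list.map
    using alt[of "[]" "e a" "e b"] alt[of "[e a]" "e b" "e c"] alt[of "[e a, e b]" "e c" "e d"]
      alt[of "[e a, e b, e c]" "e d" "e f"] alt[of "[e a, e b, e c, e d]" "e f" "e g"]
      alt[of "[e a, e b, e c, e d, e f]" "e g" "e h"] alt[of "[e a, e b, e c, e d, e f, e g]" "e h" "e i"]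
    by simp_all
qed

lemma subset_sum_4: "subset_sum 4 L g = subset_sum (Suc (Suc (Suc (Suc 0)))) L g"
  by (simp add: numeral_eq_Suc)

lemma hodge_expansion:
  assumes "orientation Or" "h \<in> Met" "e \<in> Or" "orthonormal_basis h e" "\<Phi> \<in> forms 4"
  shows "hodge Or h 4 \<Phi> [e m, e n, e p, e q] = subset_sum (Suc (Suc (Suc (Suc 0)))) [1, 2, 3, 4, 5, 6, 7, 8]
    (\<lambda>js. \<Phi> (map e js) * frame_value (volume_form Or h) e (js @ [m, n, p, q]))"
  unfolding hodge_4(2)[OF assms] frame_def frame_value_def by (simp add: subset_sum_4)

lemma frame_value_volume:
  "orientation Or \<Longrightarrow> h \<in> Met \<Longrightarrow> e \<in> Or \<Longrightarrow> orthonormal_basis h e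
    \<Longrightarrow> frame_value (volume_form Or h) e [1, 2, 3, 4, 5, 6, 7, 8] = 1"
  using volume_form(2)[of Or h e] by (simp add: frame_value_def frame_def)

text \<open>
  In the sum over index sets of \<open>hodge_4\<close> only the complementary one contributes, with the sign of the
  permutation that sorts the eight indices.
\<close>

lemma hodge_components:
  assumes "orientation Or" "h \<in> Met" "e \<in> Or" "orthonormal_basis h e" "\<Phi> \<in> forms 4"
  shows
    "hodge Or h 4 \<Phi> [e 1, e 2, e 3, e 4] = \<Phi> [e 5, e 6, e 7, e 8]"
    "hodge Or h 4 \<Phi> [e 1, e 2, e 3, e 5] = - \<Phi> [e 4, e 6, e 7, e 8]"
    "hodge Or h 4 \<Phi> [e 1, e 2, e 3, e 6] = \<Phi> [e 4, e 5, e 7, e 8]"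
    "hodge Or h 4 \<Phi> [e 1, e 2, e 3, e 7] = - \<Phi> [e 4, e 5, e 6, e 8]"
    "hodge Or h 4 \<Phi> [e 1, e 2, e 3, e 8] = \<Phi> [e 4, e 5, e 6, e 7]"
    "hodge Or h 4 \<Phi> [e 1, e 2, e 4, e 5] = \<Phi> [e 3, e 6, e 7, e 8]"
    "hodge Or h 4 \<Phi> [e 1, e 2, e 4, e 6] = - \<Phi> [e 3, e 5, e 7, e 8]"
    "hodge Or h 4 \<Phi> [e 1, e 2, e 4, e 7] = \<Phi> [e 3, e 5, e 6, e 8]"
    "hodge Or h 4 \<Phi> [e 1, e 2, e 4, e 8] = - \<Phi> [e 3, e 5, e 6, e 7]"
    "hodge Or h 4 \<Phi> [e 1, e 2, e 5, e 6] = \<Phi> [e 3, e 4, e 7, e 8]"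
    "hodge Or h 4 \<Phi> [e 1, e 2, e 5, e 7] = - \<Phi> [e 3, e 4, e 6, e 8]"
    "hodge Or h 4 \<Phi> [e 1, e 2, e 5, e 8] = \<Phi> [e 3, e 4, e 6, e 7]"
    "hodge Or h 4 \<Phi> [e 1, e 2, e 6, e 7] = \<Phi> [e 3, e 4, e 5, e 8]"
    "hodge Or h 4 \<Phi> [e 1, e 2, e 6, e 8] = - \<Phi> [e 3, e 4, e 5, e 7]"
    "hodge Or h 4 \<Phi> [e 1, e 2, e 7, e 8] = \<Phi> [e 3, e 4, e 5, e 6]"
    "hodge Or h 4 \<Phi> [e 1, e 3, e 4, e 5] = - \<Phi> [e 2, e 6, e 7, e 8]"
    "hodge Or h 4 \<Phi> [e 1, e 3, e 4, e 6] = \<Phi> [e 2, e 5, e 7, e 8]"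
    "hodge Or h 4 \<Phi> [e 1, e 3, e 4, e 7] = - \<Phi> [e 2, e 5, e 6, e 8]"
    "hodge Or h 4 \<Phi> [e 1, e 3, e 4, e 8] = \<Phi> [e 2, e 5, e 6, e 7]"
    "hodge Or h 4 \<Phi> [e 1, e 3, e 5, e 6] = - \<Phi> [e 2, e 4, e 7, e 8]"
    "hodge Or h 4 \<Phi> [e 1, e 3, e 5, e 7] = \<Phi> [e 2, e 4, e 6, e 8]"
    "hodge Or h 4 \<Phi> [e 1, e 3, e 5, e 8] = - \<Phi> [e 2, e 4, e 6, e 7]"
    "hodge Or h 4 \<Phi> [e 1, e 3, e 6, e 7] = - \<Phi> [e 2, e 4, e 5, e 8]"
    "hodge Or h 4 \<Phi> [e 1, e 3, e 6, e 8] = \<Phi> [e 2, e 4, e 5, e 7]"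
    "hodge Or h 4 \<Phi> [e 1, e 3, e 7, e 8] = - \<Phi> [e 2, e 4, e 5, e 6]"
    "hodge Or h 4 \<Phi> [e 1, e 4, e 5, e 6] = \<Phi> [e 2, e 3, e 7, e 8]"
    "hodge Or h 4 \<Phi> [e 1, e 4, e 5, e 7] = - \<Phi> [e 2, e 3, e 6, e 8]"
    "hodge Or h 4 \<Phi> [e 1, e 4, e 5, e 8] = \<Phi> [e 2, e 3, e 6, e 7]"
    "hodge Or h 4 \<Phi> [e 1, e 4, e 6, e 7] = \<Phi> [e 2, e 3, e 5, e 8]"
    "hodge Or h 4 \<Phi> [e 1, e 4, e 6, e 8] = - \<Phi> [e 2, e 3, e 5, e 7]"
    "hodge Or h 4 \<Phi> [e 1, e 4, e 7, e 8] = \<Phi> [e 2, e 3, e 5, e 6]"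
    "hodge Or h 4 \<Phi> [e 1, e 5, e 6, e 7] = - \<Phi> [e 2, e 3, e 4, e 8]"
    "hodge Or h 4 \<Phi> [e 1, e 5, e 6, e 8] = \<Phi> [e 2, e 3, e 4, e 7]"
    "hodge Or h 4 \<Phi> [e 1, e 5, e 7, e 8] = - \<Phi> [e 2, e 3, e 4, e 6]"
    "hodge Or h 4 \<Phi> [e 1, e 6, e 7, e 8] = \<Phi> [e 2, e 3, e 4, e 5]"
    "hodge Or h 4 \<Phi> [e 2, e 3, e 4, e 5] = \<Phi> [e 1, e 6, e 7, e 8]"
    "hodge Or h 4 \<Phi> [e 2, e 3, e 4, e 6] = - \<Phi> [e 1, e 5, e 7, e 8]"
    "hodge Or h 4 \<Phi> [e 2, e 3, e 4, e 7] = \<Phi> [e 1, e 5, e 6, e 8]"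
    "hodge Or h 4 \<Phi> [e 2, e 3, e 4, e 8] = - \<Phi> [e 1, e 5, e 6, e 7]"
    "hodge Or h 4 \<Phi> [e 2, e 3, e 5, e 6] = \<Phi> [e 1, e 4, e 7, e 8]"
    "hodge Or h 4 \<Phi> [e 2, e 3, e 5, e 7] = - \<Phi> [e 1, e 4, e 6, e 8]"
    "hodge Or h 4 \<Phi> [e 2, e 3, e 5, e 8] = \<Phi> [e 1, e 4, e 6, e 7]"
    "hodge Or h 4 \<Phi> [e 2, e 3, e 6, e 7] = \<Phi> [e 1, e 4, e 5, e 8]"
    "hodge Or h 4 \<Phi> [e 2, e 3, e 6, e 8] = - \<Phi> [e 1, e 4, e 5, e 7]"
    "hodge Or h 4 \<Phi> [e 2, e 3, e 7, e 8] = \<Phi> [e 1, e 4, e 5, e 6]"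
    "hodge Or h 4 \<Phi> [e 2, e 4, e 5, e 6] = - \<Phi> [e 1, e 3, e 7, e 8]"
    "hodge Or h 4 \<Phi> [e 2, e 4, e 5, e 7] = \<Phi> [e 1, e 3, e 6, e 8]"
    "hodge Or h 4 \<Phi> [e 2, e 4, e 5, e 8] = - \<Phi> [e 1, e 3, e 6, e 7]"
    "hodge Or h 4 \<Phi> [e 2, e 4, e 6, e 7] = - \<Phi> [e 1, e 3, e 5, e 8]"
    "hodge Or h 4 \<Phi> [e 2, e 4, e 6, e 8] = \<Phi> [e 1, e 3, e 5, e 7]"
    "hodge Or h 4 \<Phi> [e 2, e 4, e 7, e 8] = - \<Phi> [e 1, e 3, e 5, e 6]"
    "hodge Or h 4 \<Phi> [e 2, e 5, e 6, e 7] = \<Phi> [e 1, e 3, e 4, e 8]"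
    "hodge Or h 4 \<Phi> [e 2, e 5, e 6, e 8] = - \<Phi> [e 1, e 3, e 4, e 7]"
    "hodge Or h 4 \<Phi> [e 2, e 5, e 7, e 8] = \<Phi> [e 1, e 3, e 4, e 6]"
    "hodge Or h 4 \<Phi> [e 2, e 6, e 7, e 8] = - \<Phi> [e 1, e 3, e 4, e 5]"
    "hodge Or h 4 \<Phi> [e 3, e 4, e 5, e 6] = \<Phi> [e 1, e 2, e 7, e 8]"
    "hodge Or h 4 \<Phi> [e 3, e 4, e 5, e 7] = - \<Phi> [e 1, e 2, e 6, e 8]"
    "hodge Or h 4 \<Phi> [e 3, e 4, e 5, e 8] = \<Phi> [e 1, e 2, e 6, e 7]"
    "hodge Or h 4 \<Phi> [e 3, e 4, e 6, e 7] = \<Phi> [e 1, e 2, e 5, e 8]"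
    "hodge Or h 4 \<Phi> [e 3, e 4, e 6, e 8] = - \<Phi> [e 1, e 2, e 5, e 7]"
    "hodge Or h 4 \<Phi> [e 3, e 4, e 7, e 8] = \<Phi> [e 1, e 2, e 5, e 6]"
    "hodge Or h 4 \<Phi> [e 3, e 5, e 6, e 7] = - \<Phi> [e 1, e 2, e 4, e 8]"
    "hodge Or h 4 \<Phi> [e 3, e 5, e 6, e 8] = \<Phi> [e 1, e 2, e 4, e 7]"
    "hodge Or h 4 \<Phi> [e 3, e 5, e 7, e 8] = - \<Phi> [e 1, e 2, e 4, e 6]"
    "hodge Or h 4 \<Phi> [e 3, e 6, e 7, e 8] = \<Phi> [e 1, e 2, e 4, e 5]"
    "hodge Or h 4 \<Phi> [e 4, e 5, e 6, e 7] = \<Phi> [e 1, e 2, e 3, e 8]"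
    "hodge Or h 4 \<Phi> [e 4, e 5, e 6, e 8] = - \<Phi> [e 1, e 2, e 3, e 7]"
    "hodge Or h 4 \<Phi> [e 4, e 5, e 7, e 8] = \<Phi> [e 1, e 2, e 3, e 6]"
    "hodge Or h 4 \<Phi> [e 4, e 6, e 7, e 8] = - \<Phi> [e 1, e 2, e 3, e 5]"
    "hodge Or h 4 \<Phi> [e 5, e 6, e 7, e 8] = \<Phi> [e 1, e 2, e 3, e 4]"
  \<comment> \<open>In the first pass only complementary index sets survive; the second pass sorts them to find the sign.\<close>
  by (simp_all add: hodge_expansion[OF assms] frame_value_repeat[OF volume_form(1)[OF assms(1,2)]],
      simp_all add: frame_value_sort[OF volume_form(1)[OF assms(1,2)]] frame_value_volume[OF assms(1-4)])

section \<open>The quadratic equation in components\<close>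

definition alternating_array :: "(8 \<Rightarrow> 8 \<Rightarrow> 8 \<Rightarrow> 8 \<Rightarrow> real) \<Rightarrow> bool" where
  "alternating_array c \<longleftrightarrow>
     (\<forall>i j k l. c j i k l = - c i j k l \<and> c i k j l = - c i j k l \<and> c i j l k = - c i j k l)"

lemma alternating_array_swap:
  assumes "alternating_array c"
  shows "c j i k l = - c i j k l" "c i k j l = - c i j k l" "c i j l k = - c i j k l"
  using assms unfolding alternating_array_def by blast+

lemma alternating_array_repeat:
  assumes "alternating_array c"
  shows "c i i k l = 0" "c i j j l = 0" "c i j k k = 0"
  using alternating_array_swap(1)[OF assms, of i i k l] alternating_array_swap(2)[OF assms, of i j j l]
    alternating_array_swap(3)[OF assms, of i j k k] by simp_all

text \<open>
  As conditional rewrite rules, these sort the indices and terminate.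
\<close>

lemma alternating_array_sort:
  assumes "alternating_array c"
  shows "position j < position i \<Longrightarrow> c i j k l = - c j i k l"
    "position k < position j \<Longrightarrow> c i j k l = - c i k j l"
    "position l < position k \<Longrightarrow> c i j k l = - c i j l k"
  by (rule alternating_array_swap[OF assms])+

text \<open>
  Self-duality expresses the components without an index \<open>1\<close> by the thirty-five others.
\<close>

definition self_dual_components :: "(8 \<Rightarrow> 8 \<Rightarrow> 8 \<Rightarrow> 8 \<Rightarrow> real) \<Rightarrow> bool" where
  "self_dual_components c \<longleftrightarrow>
     c 2 3 4 5 = c 1 6 7 8 \<and> c 2 3 4 6 = - c 1 5 7 8 \<and> c 2 3 4 7 = c 1 5 6 8 \<and> c 2 3 4 8 = - c 1 5 6 7 \<and>
     c 2 3 5 6 = c 1 4 7 8 \<and> c 2 3 5 7 = - c 1 4 6 8 \<and> c 2 3 5 8 = c 1 4 6 7 \<and> c 2 3 6 7 = c 1 4 5 8 \<and>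
     c 2 3 6 8 = - c 1 4 5 7 \<and> c 2 3 7 8 = c 1 4 5 6 \<and> c 2 4 5 6 = - c 1 3 7 8 \<and> c 2 4 5 7 = c 1 3 6 8 \<and>
     c 2 4 5 8 = - c 1 3 6 7 \<and> c 2 4 6 7 = - c 1 3 5 8 \<and> c 2 4 6 8 = c 1 3 5 7 \<and> c 2 4 7 8 = - c 1 3 5 6 \<and>
     c 2 5 6 7 = c 1 3 4 8 \<and> c 2 5 6 8 = - c 1 3 4 7 \<and> c 2 5 7 8 = c 1 3 4 6 \<and> c 2 6 7 8 = - c 1 3 4 5 \<and>
     c 3 4 5 6 = c 1 2 7 8 \<and> c 3 4 5 7 = - c 1 2 6 8 \<and> c 3 4 5 8 = c 1 2 6 7 \<and> c 3 4 6 7 = c 1 2 5 8 \<and>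
     c 3 4 6 8 = - c 1 2 5 7 \<and> c 3 4 7 8 = c 1 2 5 6 \<and> c 3 5 6 7 = - c 1 2 4 8 \<and> c 3 5 6 8 = c 1 2 4 7 \<and>
     c 3 5 7 8 = - c 1 2 4 6 \<and> c 3 6 7 8 = c 1 2 4 5 \<and> c 4 5 6 7 = c 1 2 3 8 \<and> c 4 5 6 8 = - c 1 2 3 7 \<and>
     c 4 5 7 8 = c 1 2 3 6 \<and> c 4 6 7 8 = - c 1 2 3 5 \<and> c 5 6 7 8 = c 1 2 3 4"

lemma sum_off_diagonal:
  fixes f :: "8 \<Rightarrow> 8 \<Rightarrow> real"
  assumes "\<And>a b. f a b = f b a" "\<And>a. f a a = 0"
  shows "(\<Sum>a\<in>UNIV. \<Sum>b\<in>UNIV. f a b) = 2 * (f 1 2 + f 1 3 + f 1 4 + f 1 5 + f 1 6 + f 1 7 + f 1 8 + f 2 3 + f 2 4 + f 2 5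
      + f 2 6 + f 2 7 + f 2 8 + f 3 4 + f 3 5 + f 3 6 + f 3 7 + f 3 8 + f 4 5 + f 4 6
      + f 4 7 + f 4 8 + f 5 6 + f 5 7 + f 5 8 + f 6 7 + f 6 8 + f 7 8)"
  unfolding sum_8 by (simp add: assms)

text \<open>The components of \<open>\<Phi> \<Delta>\<^sub>2 \<Phi>\<close> in an orthonormal basis; see the lemma \<open>Delta2_delta_array\<close>.\<close>

definition delta_summand :: "(8 \<Rightarrow> 8 \<Rightarrow> 8 \<Rightarrow> 8 \<Rightarrow> real) \<Rightarrow> 8 \<Rightarrow> 8 \<Rightarrow> 8 \<Rightarrow> 8 \<Rightarrow> 8 \<Rightarrow> 8 \<Rightarrow> real" where
  "delta_summand c i j k l a b = c i j a b * c a b k l - c i k a b * c a b j l + c i l a b * c a b j k"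

definition delta_array :: "(8 \<Rightarrow> 8 \<Rightarrow> 8 \<Rightarrow> 8 \<Rightarrow> real) \<Rightarrow> 8 \<Rightarrow> 8 \<Rightarrow> 8 \<Rightarrow> 8 \<Rightarrow> real" where
  "delta_array c i j k l = (\<Sum>a\<in>UNIV. \<Sum>b\<in>UNIV. delta_summand c i j k l a b)"

text \<open>
  Each unordered pair of contracted indices is counted twice.
\<close>

lemma delta_array_expansion:
  assumes "alternating_array c"
  shows "delta_array c i j k l = (let f = delta_summand c i j k l in 2 * (f 1 2 + f 1 3 + f 1 4 + f 1 5 + f 1 6 + f 1 7 + f 1 8 + f 2 3 + f 2 4 + f 2 5
      + f 2 6 + f 2 7 + f 2 8 + f 3 4 + f 3 5 + f 3 6 + f 3 7 + f 3 8 + f 4 5 + f 4 6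
      + f 4 7 + f 4 8 + f 5 6 + f 5 7 + f 5 8 + f 6 7 + f 6 8 + f 7 8))"
  unfolding delta_array_def Let_def
proof (rule sum_off_diagonal)
  fix a b
  note sw = alternating_array_swap[OF assms]
  show "delta_summand c i j k l a b = delta_summand c i j k l b a"
    unfolding delta_summand_def
    using sw(3)[of i j a b] sw(3)[of i k a b] sw(3)[of i l a b] sw(1)[of a b k l] sw(1)[of a b j l] sw(1)[of a b j k]
    by simp
qed (simp add: delta_summand_def alternating_array_repeat[OF assms])

text \<open>
  Thirty-five quadratic polynomials in as many unknowns: the components that contain the index \<open>1\<close>,
  with the others eliminated by self-duality.
\<close>

lemma delta_array_self_dual:
  assumes "alternating_array c" "self_dual_components c"
  shows
    "delta_array c 1 2 3 4 = 4 * (c 1 2 5 6 * c 1 2 7 8 - c 1 2 5 7 * c 1 2 6 8 + c 1 2 5 8 * c 1 2 6 7 + c 1 3 5 6 * c 1 3 7 8 - c 1 3 5 7 * c 1 3 6 8 + c 1 3 5 8 * c 1 3 6 7 + c 1 4 5 6 * c 1 4 7 8 - c 1 4 5 7 * c 1 4 6 8 + c 1 4 5 8 * c 1 4 6 7)"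
    "delta_array c 1 2 3 5 = 4 * (- c 1 2 4 6 * c 1 2 7 8 + c 1 2 4 7 * c 1 2 6 8 - c 1 2 4 8 * c 1 2 6 7 - c 1 3 4 6 * c 1 3 7 8 + c 1 3 4 7 * c 1 3 6 8 - c 1 3 4 8 * c 1 3 6 7 + c 1 4 5 6 * c 1 5 7 8 - c 1 4 5 7 * c 1 5 6 8 + c 1 4 5 8 * c 1 5 6 7)"
    "delta_array c 1 2 3 6 = 4 * (c 1 2 4 5 * c 1 2 7 8 - c 1 2 4 7 * c 1 2 5 8 + c 1 2 4 8 * c 1 2 5 7 + c 1 3 4 5 * c 1 3 7 8 - c 1 3 4 7 * c 1 3 5 8 + c 1 3 4 8 * c 1 3 5 7 + c 1 4 5 6 * c 1 6 7 8 - c 1 4 6 7 * c 1 5 6 8 + c 1 4 6 8 * c 1 5 6 7)"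
    "delta_array c 1 2 3 7 = 4 * (- c 1 2 4 5 * c 1 2 6 8 + c 1 2 4 6 * c 1 2 5 8 - c 1 2 4 8 * c 1 2 5 6 - c 1 3 4 5 * c 1 3 6 8 + c 1 3 4 6 * c 1 3 5 8 - c 1 3 4 8 * c 1 3 5 6 + c 1 4 5 7 * c 1 6 7 8 - c 1 4 6 7 * c 1 5 7 8 + c 1 4 7 8 * c 1 5 6 7)"
    "delta_array c 1 2 3 8 = 4 * (c 1 2 4 5 * c 1 2 6 7 - c 1 2 4 6 * c 1 2 5 7 + c 1 2 4 7 * c 1 2 5 6 + c 1 3 4 5 * c 1 3 6 7 - c 1 3 4 6 * c 1 3 5 7 + c 1 3 4 7 * c 1 3 5 6 + c 1 4 5 8 * c 1 6 7 8 - c 1 4 6 8 * c 1 5 7 8 + c 1 4 7 8 * c 1 5 6 8)"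
    "delta_array c 1 2 4 5 = 4 * (c 1 2 3 6 * c 1 2 7 8 - c 1 2 3 7 * c 1 2 6 8 + c 1 2 3 8 * c 1 2 6 7 - c 1 3 4 6 * c 1 4 7 8 + c 1 3 4 7 * c 1 4 6 8 - c 1 3 4 8 * c 1 4 6 7 - c 1 3 5 6 * c 1 5 7 8 + c 1 3 5 7 * c 1 5 6 8 - c 1 3 5 8 * c 1 5 6 7)"
    "delta_array c 1 2 4 6 = 4 * (- c 1 2 3 5 * c 1 2 7 8 + c 1 2 3 7 * c 1 2 5 8 - c 1 2 3 8 * c 1 2 5 7 + c 1 3 4 5 * c 1 4 7 8 - c 1 3 4 7 * c 1 4 5 8 + c 1 3 4 8 * c 1 4 5 7 - c 1 3 5 6 * c 1 6 7 8 + c 1 3 6 7 * c 1 5 6 8 - c 1 3 6 8 * c 1 5 6 7)"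
    "delta_array c 1 2 4 7 = 4 * (c 1 2 3 5 * c 1 2 6 8 - c 1 2 3 6 * c 1 2 5 8 + c 1 2 3 8 * c 1 2 5 6 - c 1 3 4 5 * c 1 4 6 8 + c 1 3 4 6 * c 1 4 5 8 - c 1 3 4 8 * c 1 4 5 6 - c 1 3 5 7 * c 1 6 7 8 + c 1 3 6 7 * c 1 5 7 8 - c 1 3 7 8 * c 1 5 6 7)"
    "delta_array c 1 2 4 8 = 4 * (- c 1 2 3 5 * c 1 2 6 7 + c 1 2 3 6 * c 1 2 5 7 - c 1 2 3 7 * c 1 2 5 6 + c 1 3 4 5 * c 1 4 6 7 - c 1 3 4 6 * c 1 4 5 7 + c 1 3 4 7 * c 1 4 5 6 - c 1 3 5 8 * c 1 6 7 8 + c 1 3 6 8 * c 1 5 7 8 - c 1 3 7 8 * c 1 5 6 8)"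
    "delta_array c 1 2 5 6 = 4 * (c 1 2 3 4 * c 1 2 7 8 - c 1 2 3 7 * c 1 2 4 8 + c 1 2 3 8 * c 1 2 4 7 + c 1 3 4 5 * c 1 5 7 8 + c 1 3 4 6 * c 1 6 7 8 - c 1 3 5 7 * c 1 4 5 8 + c 1 3 5 8 * c 1 4 5 7 - c 1 3 6 7 * c 1 4 6 8 + c 1 3 6 8 * c 1 4 6 7)"
    "delta_array c 1 2 5 7 = 4 * (- c 1 2 3 4 * c 1 2 6 8 + c 1 2 3 6 * c 1 2 4 8 - c 1 2 3 8 * c 1 2 4 6 - c 1 3 4 5 * c 1 5 6 8 + c 1 3 4 7 * c 1 6 7 8 + c 1 3 5 6 * c 1 4 5 8 - c 1 3 5 8 * c 1 4 5 6 - c 1 3 6 7 * c 1 4 7 8 + c 1 3 7 8 * c 1 4 6 7)"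
    "delta_array c 1 2 5 8 = 4 * (c 1 2 3 4 * c 1 2 6 7 - c 1 2 3 6 * c 1 2 4 7 + c 1 2 3 7 * c 1 2 4 6 + c 1 3 4 5 * c 1 5 6 7 + c 1 3 4 8 * c 1 6 7 8 - c 1 3 5 6 * c 1 4 5 7 + c 1 3 5 7 * c 1 4 5 6 - c 1 3 6 8 * c 1 4 7 8 + c 1 3 7 8 * c 1 4 6 8)"
    "delta_array c 1 2 6 7 = 4 * (c 1 2 3 4 * c 1 2 5 8 - c 1 2 3 5 * c 1 2 4 8 + c 1 2 3 8 * c 1 2 4 5 - c 1 3 4 6 * c 1 5 6 8 - c 1 3 4 7 * c 1 5 7 8 + c 1 3 5 6 * c 1 4 6 8 + c 1 3 5 7 * c 1 4 7 8 - c 1 3 6 8 * c 1 4 5 6 - c 1 3 7 8 * c 1 4 5 7)"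
    "delta_array c 1 2 6 8 = 4 * (- c 1 2 3 4 * c 1 2 5 7 + c 1 2 3 5 * c 1 2 4 7 - c 1 2 3 7 * c 1 2 4 5 + c 1 3 4 6 * c 1 5 6 7 - c 1 3 4 8 * c 1 5 7 8 - c 1 3 5 6 * c 1 4 6 7 + c 1 3 5 8 * c 1 4 7 8 + c 1 3 6 7 * c 1 4 5 6 - c 1 3 7 8 * c 1 4 5 8)"
    "delta_array c 1 2 7 8 = 4 * (c 1 2 3 4 * c 1 2 5 6 - c 1 2 3 5 * c 1 2 4 6 + c 1 2 3 6 * c 1 2 4 5 + c 1 3 4 7 * c 1 5 6 7 + c 1 3 4 8 * c 1 5 6 8 - c 1 3 5 7 * c 1 4 6 7 - c 1 3 5 8 * c 1 4 6 8 + c 1 3 6 7 * c 1 4 5 7 + c 1 3 6 8 * c 1 4 5 8)"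
    "delta_array c 1 3 4 5 = 4 * (c 1 2 3 6 * c 1 3 7 8 - c 1 2 3 7 * c 1 3 6 8 + c 1 2 3 8 * c 1 3 6 7 + c 1 2 4 6 * c 1 4 7 8 - c 1 2 4 7 * c 1 4 6 8 + c 1 2 4 8 * c 1 4 6 7 + c 1 2 5 6 * c 1 5 7 8 - c 1 2 5 7 * c 1 5 6 8 + c 1 2 5 8 * c 1 5 6 7)"
    "delta_array c 1 3 4 6 = 4 * (- c 1 2 3 5 * c 1 3 7 8 + c 1 2 3 7 * c 1 3 5 8 - c 1 2 3 8 * c 1 3 5 7 - c 1 2 4 5 * c 1 4 7 8 + c 1 2 4 7 * c 1 4 5 8 - c 1 2 4 8 * c 1 4 5 7 + c 1 2 5 6 * c 1 6 7 8 - c 1 2 6 7 * c 1 5 6 8 + c 1 2 6 8 * c 1 5 6 7)"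
    "delta_array c 1 3 4 7 = 4 * (c 1 2 3 5 * c 1 3 6 8 - c 1 2 3 6 * c 1 3 5 8 + c 1 2 3 8 * c 1 3 5 6 + c 1 2 4 5 * c 1 4 6 8 - c 1 2 4 6 * c 1 4 5 8 + c 1 2 4 8 * c 1 4 5 6 + c 1 2 5 7 * c 1 6 7 8 - c 1 2 6 7 * c 1 5 7 8 + c 1 2 7 8 * c 1 5 6 7)"
    "delta_array c 1 3 4 8 = 4 * (- c 1 2 3 5 * c 1 3 6 7 + c 1 2 3 6 * c 1 3 5 7 - c 1 2 3 7 * c 1 3 5 6 - c 1 2 4 5 * c 1 4 6 7 + c 1 2 4 6 * c 1 4 5 7 - c 1 2 4 7 * c 1 4 5 6 + c 1 2 5 8 * c 1 6 7 8 - c 1 2 6 8 * c 1 5 7 8 + c 1 2 7 8 * c 1 5 6 8)"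
    "delta_array c 1 3 5 6 = 4 * (c 1 2 3 4 * c 1 3 7 8 - c 1 2 3 7 * c 1 3 4 8 + c 1 2 3 8 * c 1 3 4 7 - c 1 2 4 5 * c 1 5 7 8 - c 1 2 4 6 * c 1 6 7 8 + c 1 2 5 7 * c 1 4 5 8 - c 1 2 5 8 * c 1 4 5 7 + c 1 2 6 7 * c 1 4 6 8 - c 1 2 6 8 * c 1 4 6 7)"
    "delta_array c 1 3 5 7 = 4 * (- c 1 2 3 4 * c 1 3 6 8 + c 1 2 3 6 * c 1 3 4 8 - c 1 2 3 8 * c 1 3 4 6 + c 1 2 4 5 * c 1 5 6 8 - c 1 2 4 7 * c 1 6 7 8 - c 1 2 5 6 * c 1 4 5 8 + c 1 2 5 8 * c 1 4 5 6 + c 1 2 6 7 * c 1 4 7 8 - c 1 2 7 8 * c 1 4 6 7)"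
    "delta_array c 1 3 5 8 = 4 * (c 1 2 3 4 * c 1 3 6 7 - c 1 2 3 6 * c 1 3 4 7 + c 1 2 3 7 * c 1 3 4 6 - c 1 2 4 5 * c 1 5 6 7 - c 1 2 4 8 * c 1 6 7 8 + c 1 2 5 6 * c 1 4 5 7 - c 1 2 5 7 * c 1 4 5 6 + c 1 2 6 8 * c 1 4 7 8 - c 1 2 7 8 * c 1 4 6 8)"
    "delta_array c 1 3 6 7 = 4 * (c 1 2 3 4 * c 1 3 5 8 - c 1 2 3 5 * c 1 3 4 8 + c 1 2 3 8 * c 1 3 4 5 + c 1 2 4 6 * c 1 5 6 8 + c 1 2 4 7 * c 1 5 7 8 - c 1 2 5 6 * c 1 4 6 8 - c 1 2 5 7 * c 1 4 7 8 + c 1 2 6 8 * c 1 4 5 6 + c 1 2 7 8 * c 1 4 5 7)"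
    "delta_array c 1 3 6 8 = 4 * (- c 1 2 3 4 * c 1 3 5 7 + c 1 2 3 5 * c 1 3 4 7 - c 1 2 3 7 * c 1 3 4 5 - c 1 2 4 6 * c 1 5 6 7 + c 1 2 4 8 * c 1 5 7 8 + c 1 2 5 6 * c 1 4 6 7 - c 1 2 5 8 * c 1 4 7 8 - c 1 2 6 7 * c 1 4 5 6 + c 1 2 7 8 * c 1 4 5 8)"
    "delta_array c 1 3 7 8 = 4 * (c 1 2 3 4 * c 1 3 5 6 - c 1 2 3 5 * c 1 3 4 6 + c 1 2 3 6 * c 1 3 4 5 - c 1 2 4 7 * c 1 5 6 7 - c 1 2 4 8 * c 1 5 6 8 + c 1 2 5 7 * c 1 4 6 7 + c 1 2 5 8 * c 1 4 6 8 - c 1 2 6 7 * c 1 4 5 7 - c 1 2 6 8 * c 1 4 5 8)"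
    "delta_array c 1 4 5 6 = 4 * (c 1 2 3 4 * c 1 4 7 8 + c 1 2 3 5 * c 1 5 7 8 + c 1 2 3 6 * c 1 6 7 8 - c 1 2 4 7 * c 1 3 4 8 + c 1 2 4 8 * c 1 3 4 7 - c 1 2 5 7 * c 1 3 5 8 + c 1 2 5 8 * c 1 3 5 7 - c 1 2 6 7 * c 1 3 6 8 + c 1 2 6 8 * c 1 3 6 7)"
    "delta_array c 1 4 5 7 = 4 * (- c 1 2 3 4 * c 1 4 6 8 - c 1 2 3 5 * c 1 5 6 8 + c 1 2 3 7 * c 1 6 7 8 + c 1 2 4 6 * c 1 3 4 8 - c 1 2 4 8 * c 1 3 4 6 + c 1 2 5 6 * c 1 3 5 8 - c 1 2 5 8 * c 1 3 5 6 - c 1 2 6 7 * c 1 3 7 8 + c 1 2 7 8 * c 1 3 6 7)"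
    "delta_array c 1 4 5 8 = 4 * (c 1 2 3 4 * c 1 4 6 7 + c 1 2 3 5 * c 1 5 6 7 + c 1 2 3 8 * c 1 6 7 8 - c 1 2 4 6 * c 1 3 4 7 + c 1 2 4 7 * c 1 3 4 6 - c 1 2 5 6 * c 1 3 5 7 + c 1 2 5 7 * c 1 3 5 6 - c 1 2 6 8 * c 1 3 7 8 + c 1 2 7 8 * c 1 3 6 8)"
    "delta_array c 1 4 6 7 = 4 * (c 1 2 3 4 * c 1 4 5 8 - c 1 2 3 6 * c 1 5 6 8 - c 1 2 3 7 * c 1 5 7 8 - c 1 2 4 5 * c 1 3 4 8 + c 1 2 4 8 * c 1 3 4 5 + c 1 2 5 6 * c 1 3 6 8 + c 1 2 5 7 * c 1 3 7 8 - c 1 2 6 8 * c 1 3 5 6 - c 1 2 7 8 * c 1 3 5 7)"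
    "delta_array c 1 4 6 8 = 4 * (- c 1 2 3 4 * c 1 4 5 7 + c 1 2 3 6 * c 1 5 6 7 - c 1 2 3 8 * c 1 5 7 8 + c 1 2 4 5 * c 1 3 4 7 - c 1 2 4 7 * c 1 3 4 5 - c 1 2 5 6 * c 1 3 6 7 + c 1 2 5 8 * c 1 3 7 8 + c 1 2 6 7 * c 1 3 5 6 - c 1 2 7 8 * c 1 3 5 8)"
    "delta_array c 1 4 7 8 = 4 * (c 1 2 3 4 * c 1 4 5 6 + c 1 2 3 7 * c 1 5 6 7 + c 1 2 3 8 * c 1 5 6 8 - c 1 2 4 5 * c 1 3 4 6 + c 1 2 4 6 * c 1 3 4 5 - c 1 2 5 7 * c 1 3 6 7 - c 1 2 5 8 * c 1 3 6 8 + c 1 2 6 7 * c 1 3 5 7 + c 1 2 6 8 * c 1 3 5 8)"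
    "delta_array c 1 5 6 7 = 4 * (c 1 2 3 5 * c 1 4 5 8 + c 1 2 3 6 * c 1 4 6 8 + c 1 2 3 7 * c 1 4 7 8 - c 1 2 4 5 * c 1 3 5 8 - c 1 2 4 6 * c 1 3 6 8 - c 1 2 4 7 * c 1 3 7 8 + c 1 2 5 8 * c 1 3 4 5 + c 1 2 6 8 * c 1 3 4 6 + c 1 2 7 8 * c 1 3 4 7)"
    "delta_array c 1 5 6 8 = 4 * (- c 1 2 3 5 * c 1 4 5 7 - c 1 2 3 6 * c 1 4 6 7 + c 1 2 3 8 * c 1 4 7 8 + c 1 2 4 5 * c 1 3 5 7 + c 1 2 4 6 * c 1 3 6 7 - c 1 2 4 8 * c 1 3 7 8 - c 1 2 5 7 * c 1 3 4 5 - c 1 2 6 7 * c 1 3 4 6 + c 1 2 7 8 * c 1 3 4 8)"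
    "delta_array c 1 5 7 8 = 4 * (c 1 2 3 5 * c 1 4 5 6 - c 1 2 3 7 * c 1 4 6 7 - c 1 2 3 8 * c 1 4 6 8 - c 1 2 4 5 * c 1 3 5 6 + c 1 2 4 7 * c 1 3 6 7 + c 1 2 4 8 * c 1 3 6 8 + c 1 2 5 6 * c 1 3 4 5 - c 1 2 6 7 * c 1 3 4 7 - c 1 2 6 8 * c 1 3 4 8)"
    "delta_array c 1 6 7 8 = 4 * (c 1 2 3 6 * c 1 4 5 6 + c 1 2 3 7 * c 1 4 5 7 + c 1 2 3 8 * c 1 4 5 8 - c 1 2 4 6 * c 1 3 5 6 - c 1 2 4 7 * c 1 3 5 7 - c 1 2 4 8 * c 1 3 5 8 + c 1 2 5 6 * c 1 3 4 6 + c 1 2 5 7 * c 1 3 4 7 + c 1 2 5 8 * c 1 3 4 8)"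
  by (simp_all add: delta_array_expansion[OF assms(1)] Let_def delta_summand_def alternating_array_repeat[OF assms(1)]
        alternating_array_sort[OF assms(1)] assms(2)[unfolded self_dual_components_def], (simp_all add: algebra_simps)?)

text \<open>
  On a self-dual array \<open>\<Delta>\<^sub>2\<close> takes self-dual values, so the remaining thirty-five components repeat
  the ones above.
\<close>

lemma delta_array_complement:
  assumes "alternating_array c" "self_dual_components c"
  shows
    "delta_array c 2 3 4 5 = delta_array c 1 6 7 8"
    "delta_array c 2 3 4 6 = - delta_array c 1 5 7 8"
    "delta_array c 2 3 4 7 = delta_array c 1 5 6 8"
    "delta_array c 2 3 4 8 = - delta_array c 1 5 6 7"
    "delta_array c 2 3 5 6 = delta_array c 1 4 7 8"
    "delta_array c 2 3 5 7 = - delta_array c 1 4 6 8"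
    "delta_array c 2 3 5 8 = delta_array c 1 4 6 7"
    "delta_array c 2 3 6 7 = delta_array c 1 4 5 8"
    "delta_array c 2 3 6 8 = - delta_array c 1 4 5 7"
    "delta_array c 2 3 7 8 = delta_array c 1 4 5 6"
    "delta_array c 2 4 5 6 = - delta_array c 1 3 7 8"
    "delta_array c 2 4 5 7 = delta_array c 1 3 6 8"
    "delta_array c 2 4 5 8 = - delta_array c 1 3 6 7"
    "delta_array c 2 4 6 7 = - delta_array c 1 3 5 8"
    "delta_array c 2 4 6 8 = delta_array c 1 3 5 7"
    "delta_array c 2 4 7 8 = - delta_array c 1 3 5 6"
    "delta_array c 2 5 6 7 = delta_array c 1 3 4 8"
    "delta_array c 2 5 6 8 = - delta_array c 1 3 4 7"
    "delta_array c 2 5 7 8 = delta_array c 1 3 4 6"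
    "delta_array c 2 6 7 8 = - delta_array c 1 3 4 5"
    "delta_array c 3 4 5 6 = delta_array c 1 2 7 8"
    "delta_array c 3 4 5 7 = - delta_array c 1 2 6 8"
    "delta_array c 3 4 5 8 = delta_array c 1 2 6 7"
    "delta_array c 3 4 6 7 = delta_array c 1 2 5 8"
    "delta_array c 3 4 6 8 = - delta_array c 1 2 5 7"
    "delta_array c 3 4 7 8 = delta_array c 1 2 5 6"
    "delta_array c 3 5 6 7 = - delta_array c 1 2 4 8"
    "delta_array c 3 5 6 8 = delta_array c 1 2 4 7"
    "delta_array c 3 5 7 8 = - delta_array c 1 2 4 6"
    "delta_array c 3 6 7 8 = delta_array c 1 2 4 5"
    "delta_array c 4 5 6 7 = delta_array c 1 2 3 8"
    "delta_array c 4 5 6 8 = - delta_array c 1 2 3 7"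
    "delta_array c 4 5 7 8 = delta_array c 1 2 3 6"
    "delta_array c 4 6 7 8 = - delta_array c 1 2 3 5"
    "delta_array c 5 6 7 8 = delta_array c 1 2 3 4"
  by (simp_all add: delta_array_expansion[OF assms(1)] Let_def delta_summand_def alternating_array_repeat[OF assms(1)]
        alternating_array_sort[OF assms(1)] assms(2)[unfolded self_dual_components_def], (simp_all add: algebra_simps)?)

section \<open>The symmetric operator on spinors\<close>

text \<open>
  Any nonzero vector in the image, normalised, serves as \<open>s\<close>. The matrix \<open>R = P - s s\<^sup>T\<close> is symmetric and
  idempotent with trace zero, and the trace of \<open>R R = R\<close> is the sum of the squares of its entries.
\<close>

lemma rank_one_projection:
  fixes P :: "real^'n^'n"
  assumes sym: "transpose P = P" and idem: "P ** P = P" and tr: "trace P = 1"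
  shows "\<exists>s. s \<bullet> s = 1 \<and> (\<forall>i j. P $ i $ j = s $ i * s $ j)"
proof -
  have "P \<noteq> 0" using tr by (auto simp: trace_def)
  then obtain v where v: "P *v v \<noteq> 0" by (metis matrix_eq matrix_vector_mult_0)
  define s where "s = (1 / norm (P *v v)) *\<^sub>R (P *v v)"
  have ss: "s \<bullet> s = 1" using v by (simp add: s_def dot_square_norm power2_eq_square)
  have Ps: "P *v s = s"
    using idem by (simp add: s_def matrix_vector_mult_scaleR matrix_vector_mul_assoc)
  define R where "R = (\<chi> i j. P $ i $ j - s $ i * s $ j)"
  have Psym: "P $ i $ j = P $ j $ i" for i j
    using arg_cong[OF sym, of "\<lambda>M. M $ j $ i"] by (simp add: transpose_def)
  have Pidem: "(\<Sum>k\<in>UNIV. P $ i $ k * P $ k $ j) = P $ i $ j" for i j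
    using arg_cong[OF idem, of "\<lambda>M. M $ i $ j"] by (simp add: matrix_matrix_mult_def)
  have Pss: "(\<Sum>k\<in>UNIV. P $ i $ k * s $ k) = s $ i" for i
    using arg_cong[OF Ps, of "\<lambda>v. v $ i"] by (simp add: matrix_vector_mult_def)
  have sss: "(\<Sum>k\<in>UNIV. s $ k * s $ k) = 1" using ss by (simp add: inner_vec_def)
  have "(\<Sum>j\<in>UNIV. R $ i $ j * R $ i $ j) = R $ i $ i" for i
  proof -
    have "(\<Sum>j\<in>UNIV. R $ i $ j * R $ i $ j) = (\<Sum>j\<in>UNIV. P $ i $ j * P $ j $ i)
        - 2 * s $ i * (\<Sum>j\<in>UNIV. P $ i $ j * s $ j) + s $ i * s $ i * (\<Sum>j\<in>UNIV. s $ j * s $ j)"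
      by (simp add: R_def Psym[of _ i] sum.distrib[symmetric] sum_subtractf[symmetric] sum_distrib_left algebra_simps)
    then show ?thesis by (simp add: Pidem Pss sss R_def)
  qed
  then have "(\<Sum>i\<in>UNIV. \<Sum>j\<in>UNIV. R $ i $ j * R $ i $ j) = trace R"
    by (simp add: trace_def)
  also have "\<dots> = 0" using tr sss by (simp add: R_def trace_def sum_subtractf)
  finally have "R $ i $ j = 0" for i j
    by (simp add: sum_nonneg_eq_0_iff sum_nonneg)
  then have "P $ i $ j = s $ i * s $ j" for i j by (simp add: R_def)
  with ss show ?thesis by blast
qed

text \<open>
  Clifford multiplication by a self-dual four-form with components \<open>c\<close>, as a matrix on spinors. The
  index sets without \<open>1\<close> would contribute the same as their complements; leaving them out means that
  this is half of the Clifford multiplication.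
\<close>

definition spinor_matrix :: "(8 \<Rightarrow> 8 \<Rightarrow> 8 \<Rightarrow> 8 \<Rightarrow> real) \<Rightarrow> real^8^8" where
  "spinor_matrix c = (\<chi> x y. \<Sum>(i, j, k, l)\<leftarrow>filter (\<lambda>q. fst q = 1) quadruples.
     c i j k l * spinor_pairing (axis x 1) (axis y 1) (axis i 1) (axis j 1) (axis k 1) (axis l 1))"

lemma unit_quadruples: "filter (\<lambda>q. fst q = 1) quadruples = [
(1, 2, 3, 4), (1, 2, 3, 5), (1, 2, 3, 6), (1, 2, 3, 7), (1, 2, 3, 8), (1, 2, 4, 5), (1, 2, 4, 6), (1, 2, 4, 7), (1, 2, 4, 8), (1, 2, 5, 6), (1, 2, 5, 7), (1, 2, 5, 8), (1, 2, 6, 7), (1, 2, 6, 8), (1, 2, 7, 8), (1, 3, 4, 5), (1, 3, 4, 6), (1, 3, 4, 7), (1, 3, 4, 8), (1, 3, 5, 6), (1, 3, 5, 7), (1, 3, 5, 8), (1, 3, 6, 7), (1, 3, 6, 8), (1, 3, 7, 8), (1, 4, 5, 6), (1, 4, 5, 7), (1, 4, 5, 8), (1, 4, 6, 7), (1, 4, 6, 8), (1, 4, 7, 8), (1, 5, 6, 7), (1, 5, 6, 8), (1, 5, 7, 8), (1, 6, 7, 8)]"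
  by (simp add: quadruples_def)

lemma spinor_matrix_nth:
  "spinor_matrix c $ 1 $ 1 = - c 1 2 3 4 - c 1 2 5 6 - c 1 2 7 8 - c 1 3 5 7 + c 1 3 6 8 + c 1 4 5 8 + c 1 4 6 7"
  "spinor_matrix c $ 1 $ 2 = c 1 3 5 8 + c 1 3 6 7 + c 1 4 5 7 - c 1 4 6 8"
  "spinor_matrix c $ 1 $ 3 = - c 1 2 5 8 - c 1 2 6 7 - c 1 4 5 6 - c 1 4 7 8"
  "spinor_matrix c $ 1 $ 4 = - c 1 2 5 7 + c 1 2 6 8 + c 1 3 5 6 + c 1 3 7 8"
  "spinor_matrix c $ 1 $ 5 = c 1 2 3 8 + c 1 2 4 7 - c 1 3 4 6 - c 1 6 7 8"
  "spinor_matrix c $ 1 $ 6 = c 1 2 3 7 - c 1 2 4 8 + c 1 3 4 5 + c 1 5 7 8"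
  "spinor_matrix c $ 1 $ 7 = - c 1 2 3 6 - c 1 2 4 5 - c 1 3 4 8 - c 1 5 6 8"
  "spinor_matrix c $ 1 $ 8 = - c 1 2 3 5 + c 1 2 4 6 + c 1 3 4 7 + c 1 5 6 7"
  "spinor_matrix c $ 2 $ 1 = c 1 3 5 8 + c 1 3 6 7 + c 1 4 5 7 - c 1 4 6 8"
  "spinor_matrix c $ 2 $ 2 = - c 1 2 3 4 - c 1 2 5 6 - c 1 2 7 8 + c 1 3 5 7 - c 1 3 6 8 - c 1 4 5 8 - c 1 4 6 7"
  "spinor_matrix c $ 2 $ 3 = - c 1 2 5 7 + c 1 2 6 8 - c 1 3 5 6 - c 1 3 7 8"
  "spinor_matrix c $ 2 $ 4 = c 1 2 5 8 + c 1 2 6 7 - c 1 4 5 6 - c 1 4 7 8"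
  "spinor_matrix c $ 2 $ 5 = c 1 2 3 7 - c 1 2 4 8 - c 1 3 4 5 - c 1 5 7 8"
  "spinor_matrix c $ 2 $ 6 = - c 1 2 3 8 - c 1 2 4 7 - c 1 3 4 6 - c 1 6 7 8"
  "spinor_matrix c $ 2 $ 7 = - c 1 2 3 5 + c 1 2 4 6 - c 1 3 4 7 - c 1 5 6 7"
  "spinor_matrix c $ 2 $ 8 = c 1 2 3 6 + c 1 2 4 5 - c 1 3 4 8 - c 1 5 6 8"
  "spinor_matrix c $ 3 $ 1 = - c 1 2 5 8 - c 1 2 6 7 - c 1 4 5 6 - c 1 4 7 8"
  "spinor_matrix c $ 3 $ 2 = - c 1 2 5 7 + c 1 2 6 8 - c 1 3 5 6 - c 1 3 7 8"
  "spinor_matrix c $ 3 $ 3 = - c 1 2 3 4 + c 1 2 5 6 + c 1 2 7 8 - c 1 3 5 7 + c 1 3 6 8 - c 1 4 5 8 - c 1 4 6 7"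
  "spinor_matrix c $ 3 $ 4 = c 1 3 5 8 + c 1 3 6 7 - c 1 4 5 7 + c 1 4 6 8"
  "spinor_matrix c $ 3 $ 5 = - c 1 2 3 6 + c 1 2 4 5 - c 1 3 4 8 + c 1 5 6 8"
  "spinor_matrix c $ 3 $ 6 = c 1 2 3 5 + c 1 2 4 6 - c 1 3 4 7 + c 1 5 6 7"
  "spinor_matrix c $ 3 $ 7 = - c 1 2 3 8 + c 1 2 4 7 + c 1 3 4 6 - c 1 6 7 8"
  "spinor_matrix c $ 3 $ 8 = c 1 2 3 7 + c 1 2 4 8 + c 1 3 4 5 - c 1 5 7 8"
  "spinor_matrix c $ 4 $ 1 = - c 1 2 5 7 + c 1 2 6 8 + c 1 3 5 6 + c 1 3 7 8"
  "spinor_matrix c $ 4 $ 2 = c 1 2 5 8 + c 1 2 6 7 - c 1 4 5 6 - c 1 4 7 8"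
  "spinor_matrix c $ 4 $ 3 = c 1 3 5 8 + c 1 3 6 7 - c 1 4 5 7 + c 1 4 6 8"
  "spinor_matrix c $ 4 $ 4 = - c 1 2 3 4 + c 1 2 5 6 + c 1 2 7 8 + c 1 3 5 7 - c 1 3 6 8 + c 1 4 5 8 + c 1 4 6 7"
  "spinor_matrix c $ 4 $ 5 = - c 1 2 3 5 - c 1 2 4 6 - c 1 3 4 7 + c 1 5 6 7"
  "spinor_matrix c $ 4 $ 6 = - c 1 2 3 6 + c 1 2 4 5 + c 1 3 4 8 - c 1 5 6 8"
  "spinor_matrix c $ 4 $ 7 = - c 1 2 3 7 - c 1 2 4 8 + c 1 3 4 5 - c 1 5 7 8"
  "spinor_matrix c $ 4 $ 8 = - c 1 2 3 8 + c 1 2 4 7 - c 1 3 4 6 + c 1 6 7 8"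
  "spinor_matrix c $ 5 $ 1 = c 1 2 3 8 + c 1 2 4 7 - c 1 3 4 6 - c 1 6 7 8"
  "spinor_matrix c $ 5 $ 2 = c 1 2 3 7 - c 1 2 4 8 - c 1 3 4 5 - c 1 5 7 8"
  "spinor_matrix c $ 5 $ 3 = - c 1 2 3 6 + c 1 2 4 5 - c 1 3 4 8 + c 1 5 6 8"
  "spinor_matrix c $ 5 $ 4 = - c 1 2 3 5 - c 1 2 4 6 - c 1 3 4 7 + c 1 5 6 7"
  "spinor_matrix c $ 5 $ 5 = c 1 2 3 4 - c 1 2 5 6 + c 1 2 7 8 - c 1 3 5 7 - c 1 3 6 8 + c 1 4 5 8 - c 1 4 6 7"
  "spinor_matrix c $ 5 $ 6 = c 1 3 5 8 - c 1 3 6 7 + c 1 4 5 7 + c 1 4 6 8"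
  "spinor_matrix c $ 5 $ 7 = - c 1 2 5 8 + c 1 2 6 7 - c 1 4 5 6 + c 1 4 7 8"
  "spinor_matrix c $ 5 $ 8 = c 1 2 5 7 + c 1 2 6 8 - c 1 3 5 6 + c 1 3 7 8"
  "spinor_matrix c $ 6 $ 1 = c 1 2 3 7 - c 1 2 4 8 + c 1 3 4 5 + c 1 5 7 8"
  "spinor_matrix c $ 6 $ 2 = - c 1 2 3 8 - c 1 2 4 7 - c 1 3 4 6 - c 1 6 7 8"
  "spinor_matrix c $ 6 $ 3 = c 1 2 3 5 + c 1 2 4 6 - c 1 3 4 7 + c 1 5 6 7"
  "spinor_matrix c $ 6 $ 4 = - c 1 2 3 6 + c 1 2 4 5 + c 1 3 4 8 - c 1 5 6 8"
  "spinor_matrix c $ 6 $ 5 = c 1 3 5 8 - c 1 3 6 7 + c 1 4 5 7 + c 1 4 6 8"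
  "spinor_matrix c $ 6 $ 6 = c 1 2 3 4 - c 1 2 5 6 + c 1 2 7 8 + c 1 3 5 7 + c 1 3 6 8 - c 1 4 5 8 + c 1 4 6 7"
  "spinor_matrix c $ 6 $ 7 = - c 1 2 5 7 - c 1 2 6 8 - c 1 3 5 6 + c 1 3 7 8"
  "spinor_matrix c $ 6 $ 8 = - c 1 2 5 8 + c 1 2 6 7 + c 1 4 5 6 - c 1 4 7 8"
  "spinor_matrix c $ 7 $ 1 = - c 1 2 3 6 - c 1 2 4 5 - c 1 3 4 8 - c 1 5 6 8"
  "spinor_matrix c $ 7 $ 2 = - c 1 2 3 5 + c 1 2 4 6 - c 1 3 4 7 - c 1 5 6 7"
  "spinor_matrix c $ 7 $ 3 = - c 1 2 3 8 + c 1 2 4 7 + c 1 3 4 6 - c 1 6 7 8"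
  "spinor_matrix c $ 7 $ 4 = - c 1 2 3 7 - c 1 2 4 8 + c 1 3 4 5 - c 1 5 7 8"
  "spinor_matrix c $ 7 $ 5 = - c 1 2 5 8 + c 1 2 6 7 - c 1 4 5 6 + c 1 4 7 8"
  "spinor_matrix c $ 7 $ 6 = - c 1 2 5 7 - c 1 2 6 8 - c 1 3 5 6 + c 1 3 7 8"
  "spinor_matrix c $ 7 $ 7 = c 1 2 3 4 + c 1 2 5 6 - c 1 2 7 8 - c 1 3 5 7 - c 1 3 6 8 - c 1 4 5 8 + c 1 4 6 7"
  "spinor_matrix c $ 7 $ 8 = - c 1 3 5 8 + c 1 3 6 7 + c 1 4 5 7 + c 1 4 6 8"
  "spinor_matrix c $ 8 $ 1 = - c 1 2 3 5 + c 1 2 4 6 + c 1 3 4 7 + c 1 5 6 7"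
  "spinor_matrix c $ 8 $ 2 = c 1 2 3 6 + c 1 2 4 5 - c 1 3 4 8 - c 1 5 6 8"
  "spinor_matrix c $ 8 $ 3 = c 1 2 3 7 + c 1 2 4 8 + c 1 3 4 5 - c 1 5 7 8"
  "spinor_matrix c $ 8 $ 4 = - c 1 2 3 8 + c 1 2 4 7 - c 1 3 4 6 + c 1 6 7 8"
  "spinor_matrix c $ 8 $ 5 = c 1 2 5 7 + c 1 2 6 8 - c 1 3 5 6 + c 1 3 7 8"
  "spinor_matrix c $ 8 $ 6 = - c 1 2 5 8 + c 1 2 6 7 + c 1 4 5 6 - c 1 4 7 8"
  "spinor_matrix c $ 8 $ 7 = - c 1 3 5 8 + c 1 3 6 7 + c 1 4 5 7 + c 1 4 6 8"
  "spinor_matrix c $ 8 $ 8 = c 1 2 3 4 + c 1 2 5 6 - c 1 2 7 8 + c 1 3 5 7 + c 1 3 6 8 + c 1 4 5 8 - c 1 4 6 7"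
  by (simp_all add: spinor_matrix_def unit_quadruples spinor_pairing_axis axis_nth)

lemma scaled_equation: "- (12 * \<kappa> * x) = 4 * y \<Longrightarrow> \<kappa> * x = - (1/3) * (y :: real)"
  by simp

text \<open>
  The decomposition of a Clifford square into its parts of degree zero and four: the coefficient of the
  identity is the norm (again of one half of the components), and the part of degree four is a multiple of
  \<open>\<Phi> \<Delta>\<^sub>2 \<Phi>\<close>, hence by the quadratic equation of \<open>\<Phi>\<close> itself.
\<close>

lemma spinor_matrix_square:
  assumes alt: "alternating_array c" and sd: "self_dual_components c"
    and delta: "\<And>i j k l. delta_array c i j k l = - (12 * \<kappa> * c i j k l)"
  shows "spinor_matrix c ** spinor_matrix c = (6 * \<kappa>) *\<^sub>R spinor_matrix c
    + (\<Sum>(i, j, k, l)\<leftarrow>filter (\<lambda>q. fst q = 1) quadruples. (c i j k l)\<^sup>2) *\<^sub>R mat 1"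
proof -
  define Q where "Q = spinor_matrix c"
  define S where "S x y = (\<Sum>z\<in>UNIV. Q $ x $ z * Q $ z $ y)" for x y
  define N where "N = (\<Sum>(i, j, k, l)\<leftarrow>filter (\<lambda>q. fst q = 1) quadruples. (c i j k l)\<^sup>2)"
  note nth = spinor_matrix_nth[of c, folded Q_def]
  \<comment> \<open>Solved for the products of the unknowns with \<open>\<kappa>\<close>, the quadratic equations turn each entry of the
     claim into an identity between quadratic polynomials in the components.\<close>
  note d = delta_array_self_dual[OF alt sd, unfolded delta, THEN scaled_equation]
  note expand = mult.assoc distrib_left right_diff_distrib mult_minus_right d
  have N: "N = (c 1 2 3 4)\<^sup>2 + (c 1 2 3 5)\<^sup>2 + (c 1 2 3 6)\<^sup>2 + (c 1 2 3 7)\<^sup>2 + (c 1 2 3 8)\<^sup>2 + (c 1 2 4 5)\<^sup>2 + (c 1 2 4 6)\<^sup>2 + (c 1 2 4 7)\<^sup>2 + (c 1 2 4 8)\<^sup>2 + (c 1 2 5 6)\<^sup>2 + (c 1 2 5 7)\<^sup>2 + (c 1 2 5 8)\<^sup>2 + (c 1 2 6 7)\<^sup>2 + (c 1 2 6 8)\<^sup>2 + (c 1 2 7 8)\<^sup>2 + (c 1 3 4 5)\<^sup>2 + (c 1 3 4 6)\<^sup>2 + (c 1 3 4 7)\<^sup>2 + (c 1 3 4 8)\<^sup>2 + (c 1 3 5 6)\<^sup>2 + (c 1 3 5 7)\<^sup>2 + (c 1 3 5 8)\<^sup>2 + (c 1 3 6 7)\<^sup>2 + (c 1 3 6 8)\<^sup>2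 + (c 1 3 7 8)\<^sup>2 + (c 1 4 5 6)\<^sup>2 + (c 1 4 5 7)\<^sup>2 + (c 1 4 5 8)\<^sup>2 + (c 1 4 6 7)\<^sup>2 + (c 1 4 6 8)\<^sup>2 + (c 1 4 7 8)\<^sup>2 + (c 1 5 6 7)\<^sup>2 + (c 1 5 6 8)\<^sup>2 + (c 1 5 7 8)\<^sup>2 + (c 1 6 7 8)\<^sup>2"
    by (simp add: N_def unit_quadruples)
  have q11: "S 1 1 = 6 * \<kappa> * Q $ 1 $ 1 + N"
    unfolding S_def sum_8 nth N by (simp only: expand) (simp add: algebra_simps power2_eq_square)
  have q12: "S 1 2 = 6 * \<kappa> * Q $ 1 $ 2"
    unfolding S_def sum_8 nth by (simp only: expand) (simp add: algebra_simps power2_eq_square)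
  have q13: "S 1 3 = 6 * \<kappa> * Q $ 1 $ 3"
    unfolding S_def sum_8 nth by (simp only: expand) (simp add: algebra_simps power2_eq_square)
  have q14: "S 1 4 = 6 * \<kappa> * Q $ 1 $ 4"
    unfolding S_def sum_8 nth by (simp only: expand) (simp add: algebra_simps power2_eq_square)
  have q15: "S 1 5 = 6 * \<kappa> * Q $ 1 $ 5"
    unfolding S_def sum_8 nth by (simp only: expand) (simp add: algebra_simps power2_eq_square)
  have q16: "S 1 6 = 6 * \<kappa> * Q $ 1 $ 6"
    unfolding S_def sum_8 nth by (simp only: expand) (simp add: algebra_simps power2_eq_square)
  have q17: "S 1 7 = 6 * \<kappa> * Q $ 1 $ 7"
    unfolding S_def sum_8 nth by (simp only: expand) (simp add: algebra_simps power2_eq_square)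
  have q18: "S 1 8 = 6 * \<kappa> * Q $ 1 $ 8"
    unfolding S_def sum_8 nth by (simp only: expand) (simp add: algebra_simps power2_eq_square)
  have q22: "S 2 2 = 6 * \<kappa> * Q $ 2 $ 2 + N"
    unfolding S_def sum_8 nth N by (simp only: expand) (simp add: algebra_simps power2_eq_square)
  have q23: "S 2 3 = 6 * \<kappa> * Q $ 2 $ 3"
    unfolding S_def sum_8 nth by (simp only: expand) (simp add: algebra_simps power2_eq_square)
  have q24: "S 2 4 = 6 * \<kappa> * Q $ 2 $ 4"
    unfolding S_def sum_8 nth by (simp only: expand) (simp add: algebra_simps power2_eq_square)
  have q25: "S 2 5 = 6 * \<kappa> * Q $ 2 $ 5"
    unfolding S_def sum_8 nth by (simp only: expand) (simp add: algebra_simps power2_eq_square)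
  have q26: "S 2 6 = 6 * \<kappa> * Q $ 2 $ 6"
    unfolding S_def sum_8 nth by (simp only: expand) (simp add: algebra_simps power2_eq_square)
  have q27: "S 2 7 = 6 * \<kappa> * Q $ 2 $ 7"
    unfolding S_def sum_8 nth by (simp only: expand) (simp add: algebra_simps power2_eq_square)
  have q28: "S 2 8 = 6 * \<kappa> * Q $ 2 $ 8"
    unfolding S_def sum_8 nth by (simp only: expand) (simp add: algebra_simps power2_eq_square)
  have q33: "S 3 3 = 6 * \<kappa> * Q $ 3 $ 3 + N"
    unfolding S_def sum_8 nth N by (simp only: expand) (simp add: algebra_simps power2_eq_square)
  have q34: "S 3 4 = 6 * \<kappa> * Q $ 3 $ 4"
    unfolding S_def sum_8 nth by (simp only: expand) (simp add: algebra_simps power2_eq_square)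
  have q35: "S 3 5 = 6 * \<kappa> * Q $ 3 $ 5"
    unfolding S_def sum_8 nth by (simp only: expand) (simp add: algebra_simps power2_eq_square)
  have q36: "S 3 6 = 6 * \<kappa> * Q $ 3 $ 6"
    unfolding S_def sum_8 nth by (simp only: expand) (simp add: algebra_simps power2_eq_square)
  have q37: "S 3 7 = 6 * \<kappa> * Q $ 3 $ 7"
    unfolding S_def sum_8 nth by (simp only: expand) (simp add: algebra_simps power2_eq_square)
  have q38: "S 3 8 = 6 * \<kappa> * Q $ 3 $ 8"
    unfolding S_def sum_8 nth by (simp only: expand) (simp add: algebra_simps power2_eq_square)
  have q44: "S 4 4 = 6 * \<kappa> * Q $ 4 $ 4 + N"
    unfolding S_def sum_8 nth N by (simp only: expand) (simp add: algebra_simps power2_eq_square)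
  have q45: "S 4 5 = 6 * \<kappa> * Q $ 4 $ 5"
    unfolding S_def sum_8 nth by (simp only: expand) (simp add: algebra_simps power2_eq_square)
  have q46: "S 4 6 = 6 * \<kappa> * Q $ 4 $ 6"
    unfolding S_def sum_8 nth by (simp only: expand) (simp add: algebra_simps power2_eq_square)
  have q47: "S 4 7 = 6 * \<kappa> * Q $ 4 $ 7"
    unfolding S_def sum_8 nth by (simp only: expand) (simp add: algebra_simps power2_eq_square)
  have q48: "S 4 8 = 6 * \<kappa> * Q $ 4 $ 8"
    unfolding S_def sum_8 nth by (simp only: expand) (simp add: algebra_simps power2_eq_square)
  have q55: "S 5 5 = 6 * \<kappa> * Q $ 5 $ 5 + N"
    unfolding S_def sum_8 nth N by (simp only: expand) (simp add: algebra_simps power2_eq_square)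
  have q56: "S 5 6 = 6 * \<kappa> * Q $ 5 $ 6"
    unfolding S_def sum_8 nth by (simp only: expand) (simp add: algebra_simps power2_eq_square)
  have q57: "S 5 7 = 6 * \<kappa> * Q $ 5 $ 7"
    unfolding S_def sum_8 nth by (simp only: expand) (simp add: algebra_simps power2_eq_square)
  have q58: "S 5 8 = 6 * \<kappa> * Q $ 5 $ 8"
    unfolding S_def sum_8 nth by (simp only: expand) (simp add: algebra_simps power2_eq_square)
  have q66: "S 6 6 = 6 * \<kappa> * Q $ 6 $ 6 + N"
    unfolding S_def sum_8 nth N by (simp only: expand) (simp add: algebra_simps power2_eq_square)
  have q67: "S 6 7 = 6 * \<kappa> * Q $ 6 $ 7"
    unfolding S_def sum_8 nth by (simp only: expand) (simp add: algebra_simps power2_eq_square)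
  have q68: "S 6 8 = 6 * \<kappa> * Q $ 6 $ 8"
    unfolding S_def sum_8 nth by (simp only: expand) (simp add: algebra_simps power2_eq_square)
  have q77: "S 7 7 = 6 * \<kappa> * Q $ 7 $ 7 + N"
    unfolding S_def sum_8 nth N by (simp only: expand) (simp add: algebra_simps power2_eq_square)
  have q78: "S 7 8 = 6 * \<kappa> * Q $ 7 $ 8"
    unfolding S_def sum_8 nth by (simp only: expand) (simp add: algebra_simps power2_eq_square)
  have q88: "S 8 8 = 6 * \<kappa> * Q $ 8 $ 8 + N"
    unfolding S_def sum_8 nth N by (simp only: expand) (simp add: algebra_simps power2_eq_square)
  have sym: "Q $ x $ y = Q $ y $ x" for x y
  proof -
    have "\<forall>x y. Q $ x $ y = Q $ y $ x"
      unfolding forall_8 by (simp add: nth)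
    then show ?thesis by blast
  qed
  have S_sym: "S x y = S y x" for x y
    unfolding S_def by (rule sum.cong[OF refl]) (simp add: sym[of x] sym[of _ y] mult.commute)
  have S_upper: "position x \<le> position y \<longrightarrow> S x y = 6 * \<kappa> * Q $ x $ y + (if x = y then N else 0)" for x y
  proof -
    have "\<forall>x y. position x \<le> position y \<longrightarrow> S x y = 6 * \<kappa> * Q $ x $ y + (if x = y then N else 0)"
      unfolding forall_8
      by (simp add: q11 q12 q13 q14 q15 q16 q17 q18 q22 q23 q24 q25 q26 q27 q28 q33 q34 q35 q36 q37 q38 q44 q45 q46 q47 q48 q55 q56 q57 q58 q66 q67 q68 q77 q78 q88)
    then show ?thesis by blast
  qed
  have S: "S x y = 6 * \<kappa> * Q $ x $ y + (if x = y then N else 0)" for x y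
    using S_upper[of x y] S_upper[of y x] S_sym[of x y] sym[of x y] by (cases "position x \<le> position y") auto
  show ?thesis
    unfolding N_def[symmetric] Q_def[symmetric] vec_eq_iff using S by (simp add: S_def matrix_matrix_mult_def mat_def)
qed

text \<open>
  The quadratic equation for \<open>Q\<close> makes \<open>P = (Q + \<kappa>) / (8 \<kappa>)\<close> idempotent, and its trace is
  \<open>8 \<kappa> / (8 \<kappa>) = 1\<close> because \<open>Q\<close> has trace zero. A self-dual form can be recovered from its spinor
  matrix, as symmetric matrices of trace zero and self-dual four-forms both form a space of dimension
  thirty-five; so \<open>P = s s\<^sup>T\<close> determines all components.
\<close>

lemma ex_spinor:
  assumes alt: "alternating_array c" and sd: "self_dual_components c"
    and delta: "\<And>i j k l. delta_array c i j k l = - (12 * \<kappa> * c i j k l)"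
    and norm: "(\<Sum>(i, j, k, l)\<leftarrow>filter (\<lambda>q. fst q = 1) quadruples. (c i j k l)\<^sup>2) = 7 * \<kappa>\<^sup>2"
    and pos: "\<kappa> > 0"
  shows "\<exists>s. s \<bullet> s = 1 \<and> (\<forall>(i, j, k, l)\<in>set quadruples.
    c i j k l = \<kappa> * spinor_pairing s s (axis i 1) (axis j 1) (axis k 1) (axis l 1))"
proof -
  define Q where "Q = spinor_matrix c"
  define P where "P = (1 / (8 * \<kappa>)) *\<^sub>R (Q + \<kappa> *\<^sub>R mat 1)"
  note nth = spinor_matrix_nth[of c, folded Q_def]
  have Psym: "transpose P = P"
    unfolding vec_eq_iff forall_8 by (simp add: transpose_def P_def nth mat_def)
  have QQ: "Q ** Q = (6 * \<kappa>) *\<^sub>R Q + (7 * \<kappa>\<^sup>2) *\<^sub>R mat 1"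
    unfolding Q_def using spinor_matrix_square[OF alt sd delta] norm by simp
  have sum_QQ: "(\<Sum>z\<in>UNIV. Q $ x $ z * Q $ z $ y) = 6 * \<kappa> * Q $ x $ y + 7 * \<kappa>\<^sup>2 * (if x = y then 1 else 0)" for x y
    using arg_cong[OF QQ, of "\<lambda>M. M $ x $ y"] by (simp add: matrix_matrix_mult_def mat_def)
  have "(P ** P) $ x $ y = P $ x $ y" for x y
  proof -
    have "(P ** P) $ x $ y = (\<Sum>z\<in>UNIV. (Q $ x $ z * Q $ z $ y + (if x = z then \<kappa> * Q $ z $ y else 0)
        + (if z = y then \<kappa> * Q $ x $ z else 0) + (if z = y then (if x = z then \<kappa>\<^sup>2 else 0) else 0)) / (64 * \<kappa>\<^sup>2))"
      unfolding matrix_matrix_mult_def vec_lambda_beta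
      by (rule sum.cong[OF refl]) (simp add: P_def mat_def power2_eq_square field_simps)
    also have "\<dots> = (6 * \<kappa> * Q $ x $ y + 7 * \<kappa>\<^sup>2 * (if x = y then 1 else 0) + 2 * \<kappa> * Q $ x $ y
        + \<kappa>\<^sup>2 * (if x = y then 1 else 0)) / (64 * \<kappa>\<^sup>2)"
      by (simp add: sum.distrib sum_QQ flip: sum_divide_distrib)
    also have "\<dots> = P $ x $ y"
      using pos by (simp add: P_def mat_def power2_eq_square field_simps)
    finally show ?thesis .
  qed
  then have Pidem: "P ** P = P" by (simp add: vec_eq_iff)
  have Ptr: "trace P = 1"
    using pos by (simp add: trace_def sum_8 P_def nth mat_def field_simps)
  obtain s where s: "s \<bullet> s = 1" "\<And>x y. P $ x $ y = s $ x * s $ y"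
    using rank_one_projection[OF Psym Pidem Ptr] by blast
  have Qs: "Q $ x $ y + (if x = y then \<kappa> else 0) = 8 * (\<kappa> * (s $ x * s $ y))" for x y
    using s(2)[of x y] pos by (simp add: P_def mat_def field_simps split: if_splits)
  note sd' = sd[unfolded self_dual_components_def]
  have r: "\<kappa> * (s $ x * s $ y) = (Q $ x $ y + (if x = y then \<kappa> else 0)) / 8" for x y
    using Qs[of x y] by simp
  note expand = spinor_pairing_axis distrib_left right_diff_distrib mult_minus_right mult_minus_left r sd'
  have "\<forall>(i, j, k, l)\<in>set quadruples.
    c i j k l = \<kappa> * spinor_pairing s s (axis i 1) (axis j 1) (axis k 1) (axis l 1)"
    unfolding quadruples_def list.set ball_simps prod.case
    by (intro conjI TrueI, simp_all only: expand, simp_all add: nth, simp_all add: field_simps)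
  with s(1) show ?thesis by blast
qed

section \<open>All spinors are equivalent\<close>

lemma omul_unit: "omul v (axis 1 1) = v" "omul (axis 1 1) v = v"
  by (simp_all add: vec_eq_iff forall_8 omul_nth axis_nth)

text \<open>
  For a unit vector \<open>u\<close>, this is minus the reflection in the hyperplane orthogonal to \<open>u\<close>.
\<close>

definition half_turn :: "real^8 \<Rightarrow> real^8 \<Rightarrow> real^8" where
  "half_turn u v = (2 * (u \<bullet> v)) *\<^sub>R u - v"

lemma linear_half_turn: "linear (half_turn u)"
  by (rule linearI) (simp_all add: half_turn_def inner_add_right algebra_simps)

lemma half_turn_inner: "u \<bullet> u = 1 \<Longrightarrow> half_turn u v \<bullet> half_turn u w = v \<bullet> w"
  by (simp add: half_turn_def inner_diff_left inner_diff_right inner_commute algebra_simps)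

lemma half_turn_twice: "u \<bullet> u = 1 \<Longrightarrow> half_turn u (half_turn u v) = v"
  by (simp add: half_turn_def inner_diff_right algebra_simps)

text \<open>
  Half turns about two unit vectors are conjugate by an orthogonal map that takes one vector to the
  other.
\<close>

lemma det_half_turn_eq:
  assumes "u \<bullet> u = 1" "w \<bullet> w = 1"
  shows "det (matrix (half_turn u)) = det (matrix (half_turn w))"
proof -
  have "norm w = norm u" using assms by (simp add: norm_eq)
  then obtain f where f: "orthogonal_transformation f" "f w = u"
    using orthogonal_transformation_exists by blast
  have lf: "linear f" using f(1) by (rule orthogonal_transformation_linear)
  have "half_turn u (f v) = f (half_turn w v)" for v
  proof -
    have "u \<bullet> f v = w \<bullet> v" using f unfolding orthogonal_transformation_def by metis
    then show ?thesis by (simp add: half_turn_def linear_diff[OF lf] linear_scale[OF lf] f(2))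
  qed
  then have "half_turn u \<circ> f = f \<circ> half_turn w" by (simp add: fun_eq_iff)
  then have "matrix (half_turn u) ** matrix f = matrix f ** matrix (half_turn w)"
    using matrix_compose[OF lf linear_half_turn[of u]] matrix_compose[OF linear_half_turn[of w] lf] by simp
  then have "det (matrix (half_turn u)) * det (matrix f) = det (matrix f) * det (matrix (half_turn w))"
    by (metis det_mul)
  moreover have "det (matrix f) \<noteq> 0"
    using det_orthogonal_matrix f(1) orthogonal_transformation_matrix by fastforce
  ultimately show ?thesis by simp
qed

text \<open>
  A product of two half turns, and so orientation preserving; the one about \<open>e\<^sub>1\<close> is octonion conjugation.
\<close>

definition spinor_rotation :: "real^8 \<Rightarrow> real^8 \<Rightarrow> real^8" where
  "spinor_rotation s v = half_turn s (half_turn (axis 1 1) v)"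

lemma half_turn_conj: "half_turn (axis 1 1) v = oconj v"
  by (simp add: half_turn_def oconj_def inner_axis')

lemma linear_spinor_rotation: "linear (spinor_rotation s)"
  using linear_compose[OF linear_half_turn linear_half_turn, of s "axis 1 1"]
  by (simp add: spinor_rotation_def[abs_def] comp_def)

lemma spinor_rotation_inner: "s \<bullet> s = 1 \<Longrightarrow> spinor_rotation s v \<bullet> spinor_rotation s w = v \<bullet> w"
  by (simp add: spinor_rotation_def half_turn_inner inner_axis_axis)

lemma det_spinor_rotation:
  assumes "s \<bullet> s = 1"
  shows "det (matrix (spinor_rotation s)) > 0"
proof -
  let ?a = "axis 1 1 :: real^8"
  have u: "?a \<bullet> ?a = 1" by (simp add: inner_axis_axis)
  have m: "matrix (half_turn x \<circ> half_turn ?a) = matrix (half_turn x) ** matrix (half_turn ?a)" for x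
    by (rule matrix_compose[OF linear_half_turn linear_half_turn])
  have "half_turn ?a \<circ> half_turn ?a = id" using half_turn_twice[OF u] by (simp add: fun_eq_iff)
  then have "det (matrix (half_turn ?a)) * det (matrix (half_turn ?a)) = 1"
    using m[of ?a] by (metis det_I det_mul matrix_id)
  then have "det (matrix (half_turn s)) * det (matrix (half_turn ?a)) = 1"
    using det_half_turn_eq[OF assms u] by simp
  moreover have "spinor_rotation s = half_turn s \<circ> half_turn ?a"
    by (simp add: fun_eq_iff spinor_rotation_def)
  ultimately show ?thesis using m[of s] by (simp add: det_mul)
qed

text \<open>
  The spinor \<open>s\<close> is the Clifford product of the vector \<open>s\<close> with the unit spinor \<open>e\<^sub>1\<close>. Moving this vector
  through the four arguments by the Clifford relations replaces each argument by its image under the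
  rotation; what is left of the vector acts as an isometry of spinors and drops out of the pairing.
\<close>

lemma spinor_form_rotation:
  assumes "s \<bullet> s = 1"
  shows "spinor_form s = pullback (spinor_rotation s) model_form"
proof -
  let ?a = "axis 1 1 :: real^8"
  let ?B = "spinor_rotation s"
  have B: "?B v = (2 * (oconj v \<bullet> s)) *\<^sub>R s - oconj v" for v
    by (simp add: spinor_rotation_def half_turn_conj half_turn_def[of s] inner_commute)
  \<comment> \<open>Moving the vector \<open>s\<close> past the innermost argument, and then past the next one.\<close>
  have first: "omul v s = omul (oconj s) (omul (?B v) ?a)" for v
  proof -
    have "omul v s = omul (oconj (oconj v)) (omul s ?a)" by (simp add: omul_unit)
    also have "\<dots> = (2 * (oconj v \<bullet> s)) *\<^sub>R ?a - omul (oconj s) (omul (oconj v) ?a)"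
      using omul_clifford(1)[of "oconj v" s ?a] by (simp add: algebra_simps)
    also have "\<dots> = omul (oconj s) (omul (?B v) ?a)"
      using omul_cancel(1)[of s ?a] assms unfolding B
      by (simp add: omul_unit omul_add_right omul_scale_right diff_conv_add_uminus
          omul_scale_right[of _ "-1", simplified] del: add_uminus_conv_diff)
    finally show ?thesis .
  qed
  have second: "omul (oconj b) (omul (oconj s) y) = omul s (omul (oconj (?B b)) y)" for b y
  proof -
    have "oconj (?B b) = (2 * (oconj b \<bullet> s)) *\<^sub>R oconj s + (-1) *\<^sub>R b"
      unfolding B using oconj_add[of "(2 * (oconj b \<bullet> s)) *\<^sub>R s" "(-1) *\<^sub>R oconj b"]
      by (simp add: oconj_scale oconj_scale[of "-1", simplified])
    then have A: "omul s (omul (oconj (?B b)) y) = (2 * (oconj b \<bullet> s)) *\<^sub>R y + (-1) *\<^sub>R omul s (omul b y)"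
      using omul_cancel(2)[of s y] assms
      by (simp only: omul_add_left omul_add_right omul_scale_left omul_scale_right scaleR_one)
    have B': "omul (oconj b) (omul (oconj s) y) + omul s (omul b y) = (2 * (oconj b \<bullet> s)) *\<^sub>R y"
      using omul_clifford(2)[of "oconj b" s y] by simp
    show ?thesis unfolding A B'[symmetric] by simp
  qed
  have pairing: "spinor_pairing s s a b c d = spinor_pairing ?a ?a (?B a) (?B b) (?B c) (?B d)" for a b c d
    unfolding spinor_pairing_def first second using assms by (simp add: omul_inner)
  show ?thesis
  proof
    fix vs
    show "spinor_form s vs = pullback ?B model_form vs"
    proof (cases "length vs = 4")
      case True
      then obtain a b c d where vs: "vs = [a, b, c, d]" by (auto simp: length_Suc_conv eval_nat_numeral)
      show ?thesis
        unfolding vs pullback_def spinor_form_model[symmetric] list.map spinor_form_eval pairing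
          spinor_rotation_inner[OF assms] by (simp add: assms inner_axis_axis)
    qed (simp add: spinor_form_length pullback_def spinor_form_model[symmetric])
  qed
qed

section \<open>Self-dual forms in an oriented orthonormal basis\<close>

lemma four_form_scale:
  assumes "polyform \<alpha>"
  shows "\<alpha> [r *\<^sub>R a, r *\<^sub>R b, r *\<^sub>R c, r *\<^sub>R d] = r ^ 4 * \<alpha> [a, b, c, d]"
  using linear_scale[OF polyform_linear[OF assms, of "[]" "[r *\<^sub>R b, r *\<^sub>R c, r *\<^sub>R d]"], of r a]
    linear_scale[OF polyform_linear[OF assms, of "[a]" "[r *\<^sub>R c, r *\<^sub>R d]"], of r b]
    linear_scale[OF polyform_linear[OF assms, of "[a, b]" "[r *\<^sub>R d]"], of r c]
    linear_scale[OF polyform_linear[OF assms, of "[a, b, c]" "[]"], of r d]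
  by (simp add: power4_eq_xxxx)

text \<open>
  The pair matrix is symmetric, so the six terms of \<open>Delta2_components\<close> agree in pairs.
\<close>

lemma Delta2_delta_array:
  assumes "h \<in> Met" "orthonormal_basis h e" "\<Phi> \<in> forms 4"
  shows "Delta2 h \<Phi> \<Phi> [e i, e j, e k, e l] = delta_array (\<lambda>i j k l. \<Phi> [e i, e j, e k, e l]) i j k l"
proof -
  let ?X = "\<lambda>i j k l. (pair_matrix e \<Phi> ** pair_matrix e \<Phi>) $ (i, j) $ (k, l)"
  note perm = four_form_permutes(4)[OF forms_polyform[OF assms(3)]]
  have X: "?X i j k l = (\<Sum>a\<in>UNIV. \<Sum>b\<in>UNIV. \<Phi> [e i, e j, e a, e b] * \<Phi> [e a, e b, e k, e l])" for i j k l
    by (simp add: matrix_matrix_mult_def pair_matrix_def sum_pairs)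
  have "?X k l i j = ?X i j k l" for i j k l
    unfolding X by (intro sum.cong refl) (metis perm mult.commute)
  then have "Delta2 h \<Phi> \<Phi> [e i, e j, e k, e l] = ?X i j k l - ?X i k j l + ?X i l j k"
    unfolding Delta2_components[OF assms(1,2,3,3)] by simp
  then show ?thesis
    unfolding X delta_array_def delta_summand_def by (simp add: sum.distrib sum_subtractf)
qed

lemma form_inner_quadruples:
  assumes "h \<in> Met" "orthonormal_basis h e" "\<Phi> \<in> forms 4"
  shows "form_inner h \<Phi> \<Phi> = (\<Sum>(i, j, k, l)\<leftarrow>quadruples. (\<Phi> [e i, e j, e k, e l])\<^sup>2)"
proof -
  have "form_inner h \<Phi> \<Phi> = subset_sum 4 (frame e) (\<lambda>vs. \<Phi> vs * \<Phi> vs)"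
    using frame_subset_sum(2)[OF assms(3) forms_polyform[OF assms(3)], of e]
    unfolding form_inner_orthonormal[OF assms forms_polyform[OF assms(3)]] by simp
  also have "\<dots> = subset_sum (Suc (Suc (Suc (Suc 0)))) (frame e) (\<lambda>vs. \<Phi> vs * \<Phi> vs)"
    by (simp add: numeral_eq_Suc)
  also have "\<dots> = (\<Sum>(i, j, k, l)\<leftarrow>quadruples. (\<Phi> [e i, e j, e k, e l])\<^sup>2)"
    unfolding frame_def quadruples_def by (simp add: power2_eq_square)
  finally show ?thesis .
qed

lemma form_inner_self_dual:
  assumes "h \<in> Met" "orthonormal_basis h e" "\<Phi> \<in> forms 4" "self_dual_components (\<lambda>i j k l. \<Phi> [e i, e j, e k, e l])"
  shows "form_inner h \<Phi> \<Phi>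
    = 2 * (\<Sum>(i, j, k, l)\<leftarrow>filter (\<lambda>q. fst q = 1) quadruples. (\<Phi> [e i, e j, e k, e l])\<^sup>2)"
  unfolding form_inner_quadruples[OF assms(1-3)] unit_quadruples quadruples_def
  using assms(4) unfolding self_dual_components_def by simp

lemma form_inner_add_scale:
  assumes "h \<in> Met" "orthonormal_basis h e" "\<alpha> \<in> forms 4" "\<beta> \<in> forms 4" "\<gamma> \<in> forms 4"
  shows "form_inner h (\<lambda>vs. a * \<alpha> vs + b * \<beta> vs) \<gamma> = a * form_inner h \<alpha> \<gamma> + b * form_inner h \<beta> \<gamma>"
  unfolding form_inner_orthonormal[OF assms(1,2) forms_add_scale[OF assms(3,4)] forms_polyform[OF assms(5)]]
    form_inner_orthonormal[OF assms(1,2,3) forms_polyform[OF assms(5)]]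
    form_inner_orthonormal[OF assms(1,2,4) forms_polyform[OF assms(5)]]
  by (simp add: sum.distrib sum_distrib_left distrib_right mult.assoc add_divide_distrib sum_divide_distrib)

lemma self_dual_imp_components:
  assumes "orientation Or" "h \<in> Met" "e \<in> Or" "orthonormal_basis h e" "\<Phi> \<in> forms 4" "self_dual Or h \<Phi>"
  shows "self_dual_components (\<lambda>i j k l. \<Phi> [e i, e j, e k, e l])"
  using hodge_components[OF assms(1-5)] assms(6) unfolding self_dual_def self_dual_components_def by simp

text \<open>
  The vanishing derivative is tested in the direction of the gradient itself,
  \<open>\<Psi> = sqrt 14 (\<Phi> \<Delta>\<^sub>2 \<Phi> + 12 \<kappa> \<Phi>)\<close>.
\<close>

lemma critical_imp_Delta2_eq:
  assumes "h \<in> Met" "orthonormal_basis h e" "\<Phi> \<in> forms 4" "\<Phi> \<noteq> (\<lambda>_. 0)" "critical_point W (h, \<Phi>)"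
    and \<kappa>: "form_inner h \<Phi> \<Phi> = 14 * \<kappa>\<^sup>2" "\<kappa> > 0"
  shows "Delta2 h \<Phi> \<Phi> vs = - (12 * \<kappa> * \<Phi> vs)"
proof -
  have sq: "sqrt (form_inner h \<Phi> \<Phi>) = sqrt 14 * \<kappa>"
    using \<kappa> by (simp add: real_sqrt_mult)
  \<comment> \<open>The gradient of the potential in the direction of forms.\<close>
  define \<Psi> where "\<Psi> = (\<lambda>vs. sqrt 14 * Delta2 h \<Phi> \<Phi> vs + (12 * (sqrt 14 * \<kappa>)) * \<Phi> vs)"
  note \<Delta> = Delta2_forms[OF assms(1,2,3,3)]
  have \<Psi>: "\<Psi> \<in> forms 4" unfolding \<Psi>_def by (rule forms_add_scale[OF \<Delta> assms(3)])
  have "form_inner h \<Psi> \<Psi> = 0"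
    using critical_point_form_equation[OF assms(1,2,3) \<Psi> assms(4,5)]
      form_inner_add_scale[OF assms(1,2) \<Delta> assms(3) \<Psi>, of "sqrt 14" "12 * (sqrt 14 * \<kappa>)"]
    by (simp add: \<Psi>_def[symmetric] sq)
  then have "\<Psi> = (\<lambda>_. 0)" using form_inner_pos[OF assms(1,2) \<Psi>] by fastforce
  then have "\<Psi> vs = 0" by simp
  then have "sqrt 14 * (Delta2 h \<Phi> \<Phi> vs + 12 * \<kappa> * \<Phi> vs) = 0"
    unfolding \<Psi>_def by (simp add: algebra_simps)
  then show ?thesis by simp
qed

lemma Delta2_eq_imp_critical:
  assumes "h \<in> Met" "orthonormal_basis h e" "\<Phi> \<in> forms 4" "\<Phi> \<noteq> (\<lambda>_. 0)"
    and \<kappa>: "form_inner h \<Phi> \<Phi> = 14 * \<kappa>\<^sup>2" "\<kappa> > 0"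
    and eq: "Delta2 h \<Phi> \<Phi> = (\<lambda>vs. - (12 * \<kappa> * \<Phi> vs))"
  shows "critical_point W (h, \<Phi>)"
proof (rule critical_pointI[OF assms(1,3,4)])
  fix \<Psi> :: "'a list \<Rightarrow> real" assume \<Psi>: "\<Psi> \<in> forms 4"
  have sq: "sqrt (form_inner h \<Phi> \<Phi>) = sqrt 14 * \<kappa>"
    using \<kappa> by (simp add: real_sqrt_mult)
  have "form_inner h (Delta2 h \<Phi> \<Phi>) \<Psi> = - (12 * \<kappa>) * form_inner h \<Phi> \<Psi>"
    using form_inner_add_scale[OF assms(1,2,3,3) \<Psi>, of "- (12 * \<kappa>)" 0] unfolding eq by simp
  then show "sqrt 14 * form_inner h (Delta2 h \<Phi> \<Phi>) \<Psi> + 12 * sqrt (form_inner h \<Phi> \<Phi>) * form_inner h \<Phi> \<Psi> = 0"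
    unfolding sq by simp
qed

section \<open>Linear isomorphisms and orientations\<close>

lemma is_basis_image:
  assumes "linear g" "bij g" "is_basis b"
  shows "is_basis (g \<circ> b)"
proof (rule is_basisI)
  have lin: "(\<Sum>i\<in>UNIV. c i *\<^sub>R (g \<circ> b) i) = g (\<Sum>i\<in>UNIV. c i *\<^sub>R b i)" for c
    by (simp add: linear_sum[OF assms(1)] linear_scale[OF assms(1)])
  show "c = (\<lambda>_. 0)" if "(\<Sum>i\<in>UNIV. c i *\<^sub>R (g \<circ> b) i) = 0" for c
  proof -
    have "g (\<Sum>i\<in>UNIV. c i *\<^sub>R b i) = g 0" using that lin linear_0[OF assms(1)] by simp
    then have "(\<Sum>i\<in>UNIV. c i *\<^sub>R b i) = (\<Sum>i\<in>UNIV. 0 *\<^sub>R b i)"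
      using assms(2) by (simp add: bij_def inj_eq)
    from basis_coords_unique[OF assms(3) this] show ?thesis by auto
  qed
  show "\<exists>c. v = (\<Sum>i\<in>UNIV. c i *\<^sub>R (g \<circ> b) i)" for v
  proof -
    obtain w where w: "v = g w" using assms(2) by (metis bij_pointE)
    obtain c where c: "w = (\<Sum>i\<in>UNIV. c i *\<^sub>R b i)" using basis_coords[OF assms(3)] .
    have "v = (\<Sum>i\<in>UNIV. c i *\<^sub>R (g \<circ> b) i)" unfolding lin using w c by simp
    then show ?thesis by blast
  qed
qed

lemma same_orientation_image:
  assumes "linear g" "same_orientation b b'"
  shows "same_orientation (g \<circ> b) (g \<circ> b')"
proof -
  obtain M :: "real^8^8" where M: "\<And>j. b' j = (\<Sum>i\<in>UNIV. (M $ i $ j) *\<^sub>R b i)" "det M > 0"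
    using assms(2) unfolding same_orientation_def by blast
  have "(g \<circ> b') j = (\<Sum>i\<in>UNIV. (M $ i $ j) *\<^sub>R (g \<circ> b) i)" for j
    by (simp add: M(1) linear_sum[OF assms(1)] linear_scale[OF assms(1)])
  then show ?thesis using M(2) unfolding same_orientation_def by blast
qed

lemma same_orientation_scale:
  fixes b :: "8 \<Rightarrow> 'v::real_vector"
  assumes "r > 0"
  shows "same_orientation b (\<lambda>i. r *\<^sub>R b i)"
proof -
  define M :: "real^8^8" where "M = (\<chi> i j. if i = j then r else 0)"
  have "det M = (\<Prod>i\<in>UNIV. M $ i $ i)" by (rule det_diagonal) (simp add: M_def)
  then have "det M > 0" using assms by (simp add: M_def)
  moreover have "r *\<^sub>R b j = (\<Sum>i\<in>UNIV. (M $ i $ j) *\<^sub>R b i)" for j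
  proof -
    have "(\<Sum>i\<in>UNIV. (M $ i $ j) *\<^sub>R b i) = (\<Sum>i\<in>UNIV. if i = j then r *\<^sub>R b i else 0)"
      by (intro sum.cong) (auto simp: M_def)
    then show ?thesis by simp
  qed
  ultimately show ?thesis unfolding same_orientation_def by blast
qed

lemma is_basis_scale:
  assumes "is_basis b" "r \<noteq> 0"
  shows "is_basis (\<lambda>i. r *\<^sub>R b i)"
proof -
  have "bij (\<lambda>v. r *\<^sub>R v :: 'a)"
    by (rule bij_betw_byWitness[where f' = "\<lambda>v. (1 / r) *\<^sub>R v"]) (use assms(2) in auto)
  from is_basis_image[OF linear_scale_self this assms(1)] show ?thesis by (simp add: comp_def)
qed

section \<open>Conformal pairs\<close>

lemma std_orientation_image:
  assumes "orientation Or" "e \<in> Or" "linear f" "bij f" "same_orientation (\<lambda>i. axis i 1) (f \<circ> e)" "d \<in> Or"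
  shows "f \<circ> d \<in> std_orientation"
proof -
  note cls = orientation_class[OF assms(1,2)]
  have d: "is_basis d" "same_orientation e d" using assms(6) cls(2) by auto
  have "same_orientation (\<lambda>i. axis i 1) (f \<circ> d)"
    by (rule same_orientation_trans[OF assms(5) same_orientation_image[OF assms(3) d(2)]])
  then show ?thesis using is_basis_image[OF assms(3,4) d(1)] by (simp add: std_orientation_def)
qed

text \<open>
  The isomorphism to \<open>\<real>\<^sup>8\<close> takes orthonormal coordinates, applies the rotation that belongs to \<open>s\<close>, and
  scales. A scaling by \<open>r\<close> multiplies four-forms by \<open>r\<^sup>4\<close> and the metric by \<open>r\<^sup>2\<close>, so \<open>r\<^sup>4 = \<kappa>\<close>, and the
  conformal factor is \<open>sqrt \<kappa>\<close>.
\<close>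

lemma conformal_spin7_pairI:
  fixes h :: "'v::real_vector \<Rightarrow> 'v \<Rightarrow> real"
  assumes "orientation Or" "h \<in> Met" "e \<in> Or" "orthonormal_basis h e" "\<Phi> \<in> forms 4" "\<kappa> > 0" "s \<bullet> s = 1"
    and comps: "\<forall>(i, j, k, l)\<in>set quadruples.
      \<Phi> [e i, e j, e k, e l] = \<kappa> * spinor_pairing s s (axis i 1) (axis j 1) (axis k 1) (axis l 1)"
  shows "conformal_spin7_pair Or h \<Phi>"
proof -
  define r where "r = sqrt (sqrt \<kappa>)"
  have r: "r > 0" "r ^ 2 = sqrt \<kappa>" "r ^ 4 = \<kappa>"
  proof -
    show "r > 0" "r ^ 2 = sqrt \<kappa>" using assms(6) by (simp_all add: r_def)
    then have "r ^ 4 = (sqrt \<kappa>)\<^sup>2" by (metis mult_2_right numeral_Bit0 power_mult power2_eq_square power_add)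
    then show "r ^ 4 = \<kappa>" using assms(6) by simp
  qed
  define x where "x v = (\<chi> i. h v (e i))" for v
  define f where "f v = r *\<^sub>R spinor_rotation s (x v)" for v
  have e: "is_basis e" "\<And>i j. h (e i) (e j) = (if i = j then 1 else 0)"
    using assms(4) by (auto simp: orthonormal_basis_def)
  have bl: "bilinear h" using assms(2) by (rule Met_bilinear)
  have linx: "linear x"
    unfolding x_def by (intro linearI) (simp_all add: vec_eq_iff bilinear_ladd[OF bl] bilinear_lmul[OF bl])
  have linf: "linear f"
    using linear_compose_scale_right[OF linear_compose[OF linx linear_spinor_rotation[of s]], of r]
    by (simp add: f_def[abs_def] comp_def)
  have xe: "x (e i) = axis i 1" for i by (simp add: x_def e(2) vec_eq_iff axis_def)
  have xx: "x v \<bullet> x w = h v w" for v w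
    using orthonormal_inner[OF assms(2,4), of v w] by (simp add: x_def inner_vec_def)
  have ff: "f v \<bullet> f w = sqrt \<kappa> * h v w" for v w
    using r(2) by (simp add: f_def spinor_rotation_inner[OF assms(7)] xx power2_eq_square)
  have bijf: "bij f"
  proof -
    have "v = 0" if "f v = 0" for v
    proof (rule ccontr)
      assume "v \<noteq> 0"
      then have "0 < sqrt \<kappa> * h v v" using Met_pos[OF assms(2)] assms(6) by simp
      moreover have "f v \<bullet> f v = 0" using that by simp
      ultimately show False using ff[of v v] by linarith
    qed
    then have "inj f" using linear_injective_0[OF linf] by blast
    moreover have "surj f"
    proof -
      have "inj (spinor_rotation s)"
        unfolding linear_injective_0[OF linear_spinor_rotation]
        using spinor_rotation_inner[OF assms(7)] by (metis inner_eq_zero_iff)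
      then have "surj (spinor_rotation s)"
        by (intro linear_injective_imp_surjective[OF linear_spinor_rotation] refl)
      have "\<exists>v. y = f v" for y
      proof -
        obtain z where z: "(1 / r) *\<^sub>R y = spinor_rotation s z"
          using \<open>surj (spinor_rotation s)\<close> by (metis surjD)
        have "z = x (\<Sum>i\<in>UNIV. (z $ i) *\<^sub>R e i)"
          by (simp add: linear_sum[OF linx] linear_scale[OF linx] xe vec_eq_iff axis_def if_distrib cong: if_cong)
        then have "f (\<Sum>i\<in>UNIV. (z $ i) *\<^sub>R e i) = y"
          using r(1) by (simp add: f_def z[symmetric])
        then show ?thesis by metis
      qed
      then show ?thesis unfolding surj_def by blast
    qed
    ultimately show ?thesis by (simp add: bij_def)
  qed
  have orient: "same_orientation (\<lambda>i. axis i 1) (f \<circ> e)"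
  proof -
    let ?M = "matrix (spinor_rotation s)"
    have "spinor_rotation s (axis j 1) = (\<Sum>i\<in>UNIV. (?M $ i $ j) *\<^sub>R axis i 1)" for j
      by (simp add: vec_eq_iff matrix_def axis_def if_distrib cong: if_cong)
    then have "same_orientation (\<lambda>i. axis i 1) (\<lambda>j. spinor_rotation s (axis j 1))"
      unfolding same_orientation_def using det_spinor_rotation[OF assms(7)] by blast
    moreover have "same_orientation (\<lambda>j. spinor_rotation s (axis j 1)) (f \<circ> e)"
      using same_orientation_scale[OF r(1), of "\<lambda>j. spinor_rotation s (axis j 1)"] by (simp add: f_def xe comp_def)
    ultimately show ?thesis by (rule same_orientation_trans)
  qed
  have "oriented_iso Or f"
    unfolding oriented_iso_def using linf bijf std_orientation_image[OF assms(1,3) linf bijf orient] by blast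
  moreover have "\<Phi> = pullback f model_form"
  proof (rule four_forms_eq_on_quadruples[OF assms(5) forms_pullback[OF linf model_form_forms] e(1)])
    have "pullback f model_form [e i, e j, e k, e l] = \<kappa> * spinor_form s [axis i 1, axis j 1, axis k 1, axis l 1]" for i j k l
      unfolding spinor_form_rotation[OF assms(7)]
      by (simp add: pullback_def f_def xe four_form_scale[OF forms_polyform[OF model_form_forms]] r(3))
    then show "\<forall>(i, j, k, l)\<in>set quadruples. \<Phi> [e i, e j, e k, e l] = pullback f model_form [e i, e j, e k, e l]"
      using comps by (simp add: quadruples_def spinor_form_axis)
  qed
  ultimately have "spin7_form_inducing Or \<Phi> (\<lambda>v w. f v \<bullet> f w)"
    unfolding spin7_form_inducing_def by blast
  then show ?thesis
    unfolding conformal_spin7_pair_def ff using assms(6) by (intro exI[of _ "\<lambda>v w. sqrt \<kappa> * h v w"] exI[of _ "sqrt \<kappa>"]) auto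
qed

text \<open>
  The preimage of the standard basis, rescaled by the square root of the conformal factor to make it
  orthonormal.
\<close>

lemma conformal_spin7_pair_components:
  fixes h :: "'v::real_vector \<Rightarrow> 'v \<Rightarrow> real"
  assumes "orientation Or" "h \<in> Met" "conformal_spin7_pair Or h \<Phi>"
  shows "\<exists>e\<in>Or. \<exists>\<kappa>>0. orthonormal_basis h e \<and>
    (\<forall>i j k l. \<Phi> [e i, e j, e k, e l] = \<kappa> * model_form [axis i 1, axis j 1, axis k 1, axis l 1])"
proof -
  obtain f c where f: "oriented_iso Or f" "\<Phi> = pullback f model_form" "c > 0" "\<And>v w. f v \<bullet> f w = c * h v w"
    using assms(3) unfolding conformal_spin7_pair_def spin7_form_inducing_def by (metis (no_types, lifting))
  have lin: "linear f" and bij: "bij f" and or: "\<And>d. d \<in> Or \<Longrightarrow> f \<circ> d \<in> std_orientation"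
    using f(1) by (auto simp: oriented_iso_def)
  define g where "g = inv f"
  have fg: "f (g y) = y" and gf: "g (f v) = v" for y v
    using bij unfolding g_def by (simp_all add: bij_is_surj surj_f_inv_f bij_is_inj)
  have ling: "linear g"
  proof (rule linearI)
    show "g (a + b) = g a + g b" for a b by (metis fg gf linear_add[OF lin])
    show "g (r *\<^sub>R a) = r *\<^sub>R g a" for r a by (metis fg gf linear_scale[OF lin])
  qed
  have bijg: "bij g" unfolding g_def using bij by (rule bij_imp_bij_inv)
  define e0 where "e0 = g \<circ> (\<lambda>i. axis i 1)"
  define e where "e = (\<lambda>i. sqrt c *\<^sub>R e0 i)"
  have b0: "is_basis e0" unfolding e0_def by (rule is_basis_image[OF ling bijg std_basis])
  have b: "is_basis e" unfolding e_def using f(3) by (intro is_basis_scale[OF b0]) simp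
  obtain d where d: "d \<in> Or" using orientation_nonempty[OF assms(1)] by blast
  note cls = orientation_class[OF assms(1) d]
  have "same_orientation (g \<circ> (\<lambda>i. axis i 1)) (g \<circ> (f \<circ> d))"
    using or[OF d] by (intro same_orientation_image[OF ling]) (simp add: std_orientation_def)
  moreover have "g \<circ> (f \<circ> d) = d" by (simp add: fun_eq_iff gf)
  ultimately have "same_orientation e0 d" by (simp add: e0_def)
  then have "same_orientation d e0" by (rule same_orientation_sym[OF b0 cls(1)])
  then have "same_orientation d e"
    unfolding e_def by (rule same_orientation_trans) (use f(3) in \<open>simp add: same_orientation_scale\<close>)
  then have eOr: "e \<in> Or" using cls(2) b by blast
  have fe: "f (e i) = sqrt c *\<^sub>R axis i 1" for i
    by (simp add: e_def e0_def linear_scale[OF lin] fg)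
  have "h (e i) (e j) = (if i = j then 1 else 0)" for i j
    using f(4)[of "e i" "e j"] f(3) by (simp add: fe inner_axis_axis split: if_splits)
  then have on: "orthonormal_basis h e" using b by (simp add: orthonormal_basis_def)
  have "\<Phi> [e i, e j, e k, e l] = sqrt c ^ 4 * model_form [axis i 1, axis j 1, axis k 1, axis l 1]" for i j k l
    by (simp add: f(2) pullback_def fe four_form_scale[OF forms_polyform[OF model_form_forms]])
  then show ?thesis using eOr on f(3) by (intro bexI[of _ e] exI[of _ "sqrt c ^ 4"]) auto
qed

lemma model_form_axis:
  "model_form [axis i 1, axis j 1, axis k 1, axis l 1] = spinor_form (axis 1 1) [axis i 1, axis j 1, axis k 1, axis l 1]"
  by (simp add: spinor_form_model)

theorem theorem4p13:
  fixes Or :: "(8 \<Rightarrow> 'v::real_vector) set"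
    and h :: "'v \<Rightarrow> 'v \<Rightarrow> real"
    and \<Phi> :: "'v list \<Rightarrow> real"
  assumes "dim (UNIV :: 'v set) = 8"
    and "orientation Or"
    and "h \<in> Met"
    and "\<Phi> \<in> forms 4"
  shows "conformal_spin7_pair Or h \<Phi> \<longleftrightarrow>
           \<Phi> \<noteq> (\<lambda>_. 0) \<and> self_dual Or h \<Phi> \<and> critical_point W (h, \<Phi>)"
proof
  assume "conformal_spin7_pair Or h \<Phi>"
  from conformal_spin7_pair_components[OF assms(2,3) this] obtain e \<kappa> where
    e: "e \<in> Or" "orthonormal_basis h e" and \<kappa>: "\<kappa> > 0"
    and \<Phi>: "\<And>i j k l. \<Phi> [e i, e j, e k, e l] = \<kappa> * model_form [axis i 1, axis j 1, axis k 1, axis l 1]"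
    by blast
  have b: "is_basis e" using e(2) by (simp add: orthonormal_basis_def)
  note eval = \<Phi> model_form_axis spinor_form_axis spinor_pairing_axis axis_nth
  have hodge: "hodge Or h 4 \<Phi> = \<Phi>"
  proof (rule four_forms_eq_on_quadruples[OF hodge_4(1)[OF assms(2,3) e assms(4)] assms(4) b])
    show "\<forall>(i, j, k, l)\<in>set quadruples. hodge Or h 4 \<Phi> [e i, e j, e k, e l] = \<Phi> [e i, e j, e k, e l]"
      by (simp add: quadruples_def hodge_components[OF assms(2,3) e assms(4)] eval)
  qed
  then have sd: "self_dual Or h \<Phi>" by (simp add: self_dual_def)
  define \<phi> where "\<phi> = (\<lambda>i j k l. \<Phi> [e i, e j, e k, e l])"
  have sdc: "self_dual_components \<phi>"
    unfolding \<phi>_def by (rule self_dual_imp_components[OF assms(2,3) e assms(4) sd])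
  have \<phi>: "\<phi> i j k l = \<kappa> * model_form [axis i 1, axis j 1, axis k 1, axis l 1]" for i j k l
    by (simp add: \<phi>_def \<Phi>)
  note eval' = \<phi> model_form_axis spinor_form_axis spinor_pairing_axis axis_nth
  have alt: "alternating_array \<phi>"
    unfolding \<phi>_def alternating_array_def using four_form_swaps[OF forms_polyform[OF assms(4)]] by blast
  have norm: "form_inner h \<Phi> \<Phi> = 14 * \<kappa>\<^sup>2"
    unfolding form_inner_self_dual[OF assms(3) e(2) assms(4) sdc[unfolded \<phi>_def]] unit_quadruples
    by (simp add: eval)
  then have ne: "\<Phi> \<noteq> (\<lambda>_. 0)"
    using \<kappa> by (auto simp: form_inner_def Let_def)
  \<comment> \<open>The summand zero gives the right-hand side the shape in which it is known to be a four-form.\<close>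
  have "Delta2 h \<Phi> \<Phi> = (\<lambda>vs. (- (12 * \<kappa>)) * \<Phi> vs + 0 * \<Phi> vs)"
  proof (rule four_forms_eq_on_quadruples[OF Delta2_forms[OF assms(3) e(2) assms(4,4)] forms_add_scale[OF assms(4,4)] b])
    have \<Delta>: "Delta2 h \<Phi> \<Phi> [e i, e j, e k, e l] = delta_array \<phi> i j k l" for i j k l
      unfolding \<phi>_def by (rule Delta2_delta_array[OF assms(3) e(2) assms(4)])
    show "\<forall>(i, j, k, l)\<in>set quadruples. Delta2 h \<Phi> \<Phi> [e i, e j, e k, e l]
        = (- (12 * \<kappa>)) * \<Phi> [e i, e j, e k, e l] + 0 * \<Phi> [e i, e j, e k, e l]"
      unfolding \<Delta> by (simp add: quadruples_def delta_array_complement[OF alt sdc] delta_array_self_dual[OF alt sdc] eval eval' power2_eq_square)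
  qed
  then have "Delta2 h \<Phi> \<Phi> = (\<lambda>vs. - (12 * \<kappa> * \<Phi> vs))" by simp
  then show "\<Phi> \<noteq> (\<lambda>_. 0) \<and> self_dual Or h \<Phi> \<and> critical_point W (h, \<Phi>)"
    using ne sd Delta2_eq_imp_critical[OF assms(3) e(2) assms(4) ne norm \<kappa>] by blast
next
  assume *: "\<Phi> \<noteq> (\<lambda>_. 0) \<and> self_dual Or h \<Phi> \<and> critical_point W (h, \<Phi>)"
  obtain e where e: "e \<in> Or" "orthonormal_basis h e"
    using ex_oriented_orthonormal_basis[OF assms(2,3)] by blast
  define \<kappa> where "\<kappa> = sqrt (form_inner h \<Phi> \<Phi> / 14)"
  have pos: "form_inner h \<Phi> \<Phi> > 0" using form_inner_pos[OF assms(3) e(2) assms(4)] * by blast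
  then have \<kappa>: "form_inner h \<Phi> \<Phi> = 14 * \<kappa>\<^sup>2" "\<kappa> > 0" by (simp_all add: \<kappa>_def)
  define \<phi> where "\<phi> = (\<lambda>i j k l. \<Phi> [e i, e j, e k, e l])"
  have sdc: "self_dual_components \<phi>"
    unfolding \<phi>_def using self_dual_imp_components[OF assms(2,3) e assms(4)] * by blast
  have alt: "alternating_array \<phi>"
    unfolding \<phi>_def alternating_array_def using four_form_swaps[OF forms_polyform[OF assms(4)]] by blast
  have "Delta2 h \<Phi> \<Phi> vs = - (12 * \<kappa> * \<Phi> vs)" for vs
    using critical_imp_Delta2_eq[OF assms(3) e(2) assms(4) _ _ \<kappa>] * by blast
  then have delta: "delta_array \<phi> i j k l = - (12 * \<kappa> * \<phi> i j k l)" for i j k l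
    using Delta2_delta_array[OF assms(3) e(2) assms(4), of i j k l] by (simp add: \<phi>_def)
  have norm: "(\<Sum>(i, j, k, l)\<leftarrow>filter (\<lambda>q. fst q = 1) quadruples. (\<phi> i j k l)\<^sup>2) = 7 * \<kappa>\<^sup>2"
    using form_inner_self_dual[OF assms(3) e(2) assms(4) sdc[unfolded \<phi>_def]] \<kappa>(1) unfolding \<phi>_def by linarith
  obtain s where "s \<bullet> s = 1" "\<forall>(i, j, k, l)\<in>set quadruples.
      \<phi> i j k l = \<kappa> * spinor_pairing s s (axis i 1) (axis j 1) (axis k 1) (axis l 1)"
    using ex_spinor[OF alt sdc delta norm \<kappa>(2)] by blast
  then show "conformal_spin7_pair Or h \<Phi>"
    unfolding \<phi>_def by (intro conformal_spin7_pairI[OF assms(2,3) e assms(4) \<kappa>(2)])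
qed

end
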